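(* Let $(K,v)$ be a valued field. Fix an extension of $v$ to a separable-algebraic closure $K^{sep}$ of $K$; all subextensions of $K^{sep}|K$ are equipped with its restrictions. Then: 1) $\Omega_{\mathcal{O}_{K^{sep}}|\mathcal{O}_K}=0$ if and only if $\Omega_{\mathcal{O}_L|\mathcal{O}_K}=0$ for all finite Galois subextensions $L|K$ of $K^{sep}$. 2) Let $L|K$ be a finite Galois subextension of $K^{sep}$ and assume that $$K\subseteq K^{in}=K_0\subseteq K_1\subseteq\cdots\subseteq K_\ell=L$$ is a tower of field extensions such that $K^{in}$ is the inertia field of $(L|K,v)$ and $K_{i+1}|K_i$ is Galois of prime degree for all $i$. Then $\Omega_{\mathcal{O}_L|\mathcal{O}_K}=0$ if and only if $\Omega_{\mathcal{O}_{K_{i+1}}|\mathcal{O}_{K_i}}=0$ for $0\le i\le\ell-1$.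
   Context: Valuations are Krull valuations of arbitrary rank. $\mathcal{O}_F$ denotes the valuation ring of a valued field $F$. $\Omega_{B|A}$ is the module of relative Kähler differentials of an $A$-algebra $B$. For a finite Galois extension $(L|K,v)$ of valued fields, the inertia group is $\{\sigma\in\mathrm{Gal}(L|K)\mid v(\sigma x-x)>0\text{ for all }x\in\mathcal{O}_L\}$, and the inertia field is its fixed field in $L$. *)

theory Defs
  imports
    "HOL-Algebra.Algebraic_Closure_Type"
    "HOL-Algebra.Module"
    "HOL-Library.Poly_Mapping"
    "HOL-Library.Extended"
begin

text \<open>
  All fields are subfields, as sets, of one ambient field given by a type, and all rings are
  subrings of it.  The constant \<^const>\<open>ring_of_type_algebra\<close> turns the ambient type into a ring of
  HOL-Algebra, so that \<^const>\<open>subfield\<close>, \<^const>\<open>ring.dim\<close>, \<^const>\<open>ring_iso\<close> and \<^const>\<open>module\<close>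
  are available.
\<close>

definition subring_of :: "'a::comm_ring_1 set \<Rightarrow> 'a ring"
  where "subring_of B = ring_of_type_algebra\<lparr>carrier := B\<rparr>"


section \<open>Valuations\<close>

text \<open>
  Krull valuations, written additively.  The value group is an arbitrary linearly ordered abelian
  group, so the rank is arbitrary, and the valuation need not be onto it.  The trivial valuation is
  included.  The type \<^typ>\<open>'g extended\<close> also has a least element \<^const>\<open>Minf\<close>, which is not a
  value of a valuation.
\<close>

definition valuation_on ::
    "'a::field set \<Rightarrow> ('a \<Rightarrow> 'g::linordered_ab_group_add extended) \<Rightarrow> bool"
  where "valuation_on F v \<longleftrightarrow>
    (\<forall>x\<in>F. v x \<noteq> Minf) \<and>
    (\<forall>x\<in>F. v x = Pinf \<longleftrightarrow> x = 0) \<and>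
    (\<forall>x\<in>F. \<forall>y\<in>F. v (x * y) = v x + v y) \<and>
    (\<forall>x\<in>F. \<forall>y\<in>F. min (v x) (v y) \<le> v (x + y))"

definition valuation_ring ::
    "('a::field \<Rightarrow> 'g::linordered_ab_group_add extended) \<Rightarrow> 'a set \<Rightarrow> 'a set"
  where "valuation_ring v F = {x \<in> F. 0 \<le> v x}"


section \<open>Separable and Galois extensions\<close>

text \<open>
  A polynomial over the subfield \<open>K\<close> is a polynomial over the ambient field whose coefficients lie
  in \<open>K\<close>.
\<close>

definition minimal_polynomial :: "'a::field set \<Rightarrow> 'a \<Rightarrow> 'a poly \<Rightarrow> bool"
  where "minimal_polynomial K x p \<longleftrightarrow>
    lead_coeff p = 1 \<and> set (coeffs p) \<subseteq> K \<and> poly p x = 0 \<and>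
    (\<forall>q. q \<noteq> 0 \<and> set (coeffs q) \<subseteq> K \<and> poly q x = 0 \<longrightarrow>
      Polynomial.degree p \<le> Polynomial.degree q)"

text \<open>
  Coprimality of two polynomials does not depend on the field containing their coefficients, so it
  may be tested over the ambient field.
\<close>

definition separable_poly :: "'a::field poly \<Rightarrow> bool"
  where "separable_poly p \<longleftrightarrow> coprime p (pderiv p)"

definition separable_over :: "'a::field set \<Rightarrow> 'a \<Rightarrow> bool"
  where "separable_over K x \<longleftrightarrow> (\<exists>p. minimal_polynomial K x p \<and> separable_poly p)"

definition separable_extension :: "'a::field set \<Rightarrow> 'a set \<Rightarrow> bool"
  where "separable_extension K L \<longleftrightarrow>
    subfield K ring_of_type_algebra \<and> subfield L ring_of_type_algebra \<and> K \<subseteq> L \<and>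
    (\<forall>x\<in>L. separable_over K x)"

definition separable_closure :: "'a::field set \<Rightarrow> 'a set \<Rightarrow> bool"
  where "separable_closure K S \<longleftrightarrow>
    separable_extension K S \<and>
    (\<forall>p. set (coeffs p) \<subseteq> S \<and> Polynomial.degree p > 0 \<and> separable_poly p \<longrightarrow>
      (\<exists>x\<in>S. poly p x = 0))"

definition splits_over :: "'a::field set \<Rightarrow> 'a poly \<Rightarrow> bool"
  where "splits_over L p \<longleftrightarrow>
    (\<exists>c rs. set rs \<subseteq> L \<and> p = Polynomial.smult c (\<Prod>r\<leftarrow>rs. [:- r, 1:]))"

definition galois_extension :: "'a::field set \<Rightarrow> 'a set \<Rightarrow> bool"
  where "galois_extension K L \<longleftrightarrow>
    separable_extension K L \<and>
    (\<forall>x\<in>L. \<forall>p. minimal_polynomial K x p \<longrightarrow> splits_over L p)"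

definition finite_galois_extension :: "'a::field set \<Rightarrow> 'a set \<Rightarrow> bool"
  where "finite_galois_extension K L \<longleftrightarrow>
    galois_extension K L \<and> ring.finite_dimension ring_of_type_algebra K L"

text \<open>
  Automorphisms of \<open>L\<close> are functions on the ambient type; \<^const>\<open>extensional\<close> removes the irrelevant
  values outside \<open>L\<close>.
\<close>

definition galois_group :: "'a::field set \<Rightarrow> 'a set \<Rightarrow> ('a \<Rightarrow> 'a) set"
  where "galois_group K L =
    {\<sigma> \<in> extensional L \<inter> ring_iso (subring_of L) (subring_of L). \<forall>x\<in>K. \<sigma> x = x}"

definition inertia_group ::
    "('a::field \<Rightarrow> 'g::linordered_ab_group_add extended) \<Rightarrow> 'a set \<Rightarrow> 'a set \<Rightarrow> ('a \<Rightarrow> 'a) set"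
  where "inertia_group v K L =
    {\<sigma> \<in> galois_group K L. \<forall>x\<in>valuation_ring v L. 0 < v (\<sigma> x - x)}"

definition inertia_field ::
    "('a::field \<Rightarrow> 'g::linordered_ab_group_add extended) \<Rightarrow> 'a set \<Rightarrow> 'a set \<Rightarrow> 'a set"
  where "inertia_field v K L = {x \<in> L. \<forall>\<sigma>\<in>inertia_group v K L. \<sigma> x = x}"


section \<open>Kaehler differentials\<close>

text \<open>
  For subrings \<open>A \<subseteq> B\<close>, the \<open>B\<close>-module \<open>\<Omega>\<^bsub>B|A\<^esub>\<close> is presented by generators and relations.
  The element \<open>\<Sum>b\<in>B. c b * d b\<close> of the free module on the symbols \<open>d b\<close> is the finitely supported
  function \<open>c\<close>; thus \<open>Poly_Mapping.single b c\<close> stands for \<open>c * d b\<close>.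
\<close>

definition free_differentials :: "'a::comm_ring_1 set \<Rightarrow> ('a, 'a \<Rightarrow>\<^sub>0 'a) module"
  where "free_differentials B =
    \<lparr>carrier = {f. Poly_Mapping.keys f \<subseteq> B \<and> (\<forall>b. Poly_Mapping.lookup f b \<in> B)},
     monoid.mult = undefined, one = undefined,
     ring.zero = 0, add = (+), module.smult = (\<lambda>c. Poly_Mapping.map ((*) c))\<rparr>"

inductive_set kaehler_relations :: "'a::comm_ring_1 set \<Rightarrow> 'a set \<Rightarrow> ('a \<Rightarrow>\<^sub>0 'a) set"
  for B A
  where
    const: "a \<in> A \<Longrightarrow> Poly_Mapping.single a 1 \<in> kaehler_relations B A"
  | sum: "\<lbrakk>x \<in> B; y \<in> B\<rbrakk> \<Longrightarrow>
      Poly_Mapping.single (x + y) 1 - Poly_Mapping.single x 1 - Poly_Mapping.single y 1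
        \<in> kaehler_relations B A"
  | leibniz: "\<lbrakk>x \<in> B; y \<in> B\<rbrakk> \<Longrightarrow>
      Poly_Mapping.single (x * y) 1 - Poly_Mapping.single y x - Poly_Mapping.single x y
        \<in> kaehler_relations B A"
  | zero: "0 \<in> kaehler_relations B A"
  | add: "\<lbrakk>f \<in> kaehler_relations B A; g \<in> kaehler_relations B A\<rbrakk> \<Longrightarrow>
      f + g \<in> kaehler_relations B A"
  | scale: "\<lbrakk>c \<in> B; f \<in> kaehler_relations B A\<rbrakk> \<Longrightarrow>
      Poly_Mapping.map ((*) c) f \<in> kaehler_relations B A"

text \<open>The multiplication and unit fields of the record carry no meaning for a module.\<close>

definition quotient_module :: "('a, 'm) module \<Rightarrow> 'm set \<Rightarrow> ('a, 'm set) module"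
  where "quotient_module M N =
    \<lparr>carrier = a_rcosets\<^bsub>M\<^esub> N, monoid.mult = undefined, one = undefined,
     ring.zero = N, add = set_add M,
     module.smult = (\<lambda>c Y. \<Union>x\<in>Y. N +>\<^bsub>M\<^esub> (c \<odot>\<^bsub>M\<^esub> x))\<rparr>"

definition kaehler :: "'a::comm_ring_1 set \<Rightarrow> 'a set \<Rightarrow> ('a, ('a \<Rightarrow>\<^sub>0 'a) set) module"
  where "kaehler B A = quotient_module (free_differentials B) (kaehler_relations B A)"

definition zero_module :: "('a, 'm) module \<Rightarrow> bool"
  where "zero_module M \<longleftrightarrow> carrier M = {\<zero>\<^bsub>M\<^esub>}"

text \<open>The construction does yield a \<open>B\<close>-module:\<close>

lemma lookup_scale: "Poly_Mapping.lookup (Poly_Mapping.map ((*) c) f) b = c * Poly_Mapping.lookup f b"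
  for c :: "'a::comm_ring_1"
  by (simp add: Poly_Mapping.map.rep_eq when_def)

lemma module_free_differentials:
  assumes "subring B ring_of_type_algebra"
  shows "module (subring_of B) (free_differentials B)"
proof -
  have B: "0 \<in> B" "1 \<in> B" "\<And>x y. x \<in> B \<Longrightarrow> y \<in> B \<Longrightarrow> x + y \<in> B" "\<And>x y. x \<in> B \<Longrightarrow> y \<in> B \<Longrightarrow> x * y \<in> B"
    using subringE[OF assms] by (auto simp: ring_of_type_algebra_def)
  interpret U: cring "ring_of_type_algebra :: 'a ring" by (rule cring_from_type_algebra)
  have m: "\<And>h. h \<in> B \<Longrightarrow> - h \<in> B"
  proof -
    fix h assume h: "h \<in> B"
    have "\<ominus>\<^bsub>ring_of_type_algebra\<^esub> h \<oplus>\<^bsub>ring_of_type_algebra\<^esub> h = \<zero>\<^bsub>ring_of_type_algebra\<^esub>"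
      by (rule U.l_neg) (simp add: ring_of_type_algebra_def)
    then have "\<ominus>\<^bsub>ring_of_type_algebra\<^esub> h = - h"
      by (simp add: ring_of_type_algebra_def eq_neg_iff_add_eq_0)
    then show "- h \<in> B" using subringE(5)[OF assms h] by simp
  qed
  have c: "cring (subring_of B)" unfolding subring_of_def
    using U.subcring_iff[of B] U.subcringI'[OF assms] by (simp add: ring_of_type_algebra_def)
  show ?thesis
  proof (rule moduleI[OF c])
    have closed: "x + y \<in> carrier (free_differentials B)"
      if "x \<in> carrier (free_differentials B)" "y \<in> carrier (free_differentials B)" for x y
      using that Poly_Mapping.keys_add[of x y] B by (auto simp: free_differentials_def lookup_add)
    have "- x \<in> carrier (free_differentials B)" if "x \<in> carrier (free_differentials B)" for x
      using that m by (auto simp: free_differentials_def)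
    then have "\<exists>y\<in>carrier (free_differentials B). y + x = 0"
      if "x \<in> carrier (free_differentials B)" for x
      using that by (intro bexI[of _ "-x"]) auto
    with closed B show "abelian_group (free_differentials B)"
      by (intro abelian_groupI) (simp_all add: free_differentials_def ac_simps)
  next
    fix a f assume "a \<in> carrier (subring_of B)" "f \<in> carrier (free_differentials B)"
    then show "a \<odot>\<^bsub>free_differentials B\<^esub> f \<in> carrier (free_differentials B)"
      using B(4) by (simp add: subring_of_def free_differentials_def lookup_scale
          Poly_Mapping.in_keys_iff subset_iff) (metis mult_zero_right)
  qed (auto simp: subring_of_def ring_of_type_algebra_def free_differentials_def lookup_scale lookup_add algebra_simps intro!: poly_mapping_eqI)
qed

lemma submodule_kaehler_relations:
  assumes "subring B ring_of_type_algebra" "A \<subseteq> B"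
  shows "submodule (kaehler_relations B A) (subring_of B) (free_differentials B)"
proof -
  interpret M: module "subring_of B" "free_differentials B" by (rule module_free_differentials) fact
  have B: "0 \<in> B" "1 \<in> B" "\<And>x y. x \<in> B \<Longrightarrow> y \<in> B \<Longrightarrow> x + y \<in> B" "\<And>x y. x \<in> B \<Longrightarrow> y \<in> B \<Longrightarrow> x * y \<in> B"
    using subringE[OF assms(1)] by (auto simp: ring_of_type_algebra_def)
  have s: "Poly_Mapping.single b c \<in> carrier (free_differentials B)" if "b \<in> B" "c \<in> B" for b c
    using that B by (auto simp: free_differentials_def lookup_single when_def split: if_splits)
  have d: "f - g \<in> carrier (free_differentials B)" 
    if "f \<in> carrier (free_differentials B)" "g \<in> carrier (free_differentials B)" for f g
  proof -
    have "\<ominus>\<^bsub>free_differentials B\<^esub> g \<oplus>\<^bsub>free_differentials B\<^esub> g = \<zero>\<^bsub>free_differentials B\<^esub>"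
      using that by (rule_tac M.l_neg)
    then have "\<ominus>\<^bsub>free_differentials B\<^esub> g = - g"
      by (simp add: free_differentials_def eq_neg_iff_add_eq_0)
    moreover have "f \<oplus>\<^bsub>free_differentials B\<^esub> (\<ominus>\<^bsub>free_differentials B\<^esub> g) \<in> carrier (free_differentials B)"
      using that by blast
    ultimately show ?thesis by (simp add: free_differentials_def)
  qed
  have sub: "f \<in> carrier (free_differentials B)" if "f \<in> kaehler_relations B A" for f
    using that
  proof induction
    case (zero) then show ?case using M.M.zero_closed by (simp add: free_differentials_def)
  next
    case (add f g) then show ?case using M.M.a_closed[of f g] by (simp add: free_differentials_def)
  next
    case (scale c f) then show ?case using M.smult_closed[of c f] by (simp add: free_differentials_def subring_of_def)
  qed (use assms B in \<open>auto intro!: s d\<close>)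
  show ?thesis
  proof (rule M.submoduleI)
    fix f assume f: "f \<in> kaehler_relations B A"
    have "\<ominus>\<^bsub>free_differentials B\<^esub> f = (\<ominus>\<^bsub>subring_of B\<^esub> \<one>\<^bsub>subring_of B\<^esub>) \<odot>\<^bsub>free_differentials B\<^esub> f"
      using sub[OF f] by (simp add: M.smult_l_minus)
    moreover have "\<ominus>\<^bsub>subring_of B\<^esub> \<one>\<^bsub>subring_of B\<^esub> \<in> B"
      using M.R.a_inv_closed[OF M.R.one_closed] by (simp add: subring_of_def)
    ultimately show "\<ominus>\<^bsub>free_differentials B\<^esub> f \<in> kaehler_relations B A"
      using f by (auto simp: free_differentials_def intro: kaehler_relations.scale)
  qed (use sub in \<open>auto simp: free_differentials_def subring_of_def intro: kaehler_relations.intros\<close>)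
qed

lemma module_quotient_module:
  assumes "module R M" "submodule N R M"
  shows "module R (quotient_module M N)"
proof -
  interpret M: module R M by fact
  interpret N: abelian_subgroup N M
    using assms(2) M.a_comm_group by (auto intro!: abelian_subgroupI2 submodule.axioms)
  let ?q = "\<lambda>x. N +>\<^bsub>M\<^esub> x"
  have carr: "carrier (quotient_module M N) = ?q ` carrier M"
    by (auto simp: quotient_module_def A_RCOSETS_def RCOSETS_def a_r_coset_def)
  have add: "?q x \<oplus>\<^bsub>quotient_module M N\<^esub> ?q y = ?q (x \<oplus>\<^bsub>M\<^esub> y)"
    if "x \<in> carrier M" "y \<in> carrier M" for x y
    using that N.a_rcos_sum by (simp add: quotient_module_def)
  have scale: "c \<odot>\<^bsub>quotient_module M N\<^esub> ?q x = ?q (c \<odot>\<^bsub>M\<^esub> x)"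
    if c: "c \<in> carrier R" and x: "x \<in> carrier M" for c x
  proof -
    have "?q (c \<odot>\<^bsub>M\<^esub> y) = ?q (c \<odot>\<^bsub>M\<^esub> x)" if y: "y \<in> ?q x" for y
    proof -
      obtain n where n: "n \<in> N" "y = n \<oplus>\<^bsub>M\<^esub> x"
        using y by (auto simp: a_r_coset_def' [of M])
      have nM: "n \<in> carrier M" using n(1) N.a_Hcarr by blast
      have "c \<odot>\<^bsub>M\<^esub> y = (c \<odot>\<^bsub>M\<^esub> n) \<oplus>\<^bsub>M\<^esub> (c \<odot>\<^bsub>M\<^esub> x)"
        using n nM c x by (simp add: M.smult_r_distr)
      then have "c \<odot>\<^bsub>M\<^esub> y \<in> ?q (c \<odot>\<^bsub>M\<^esub> x)"
        using submodule.smult_closed[OF assms(2) c n(1)] by (auto simp: a_r_coset_def' [of M])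
      then show ?thesis
        by (rule M.a_repr_independence[OF _ M.smult_closed[OF c x] N.a_subgroup, symmetric])
    qed
    moreover have "?q x \<noteq> {}"
      using N.a_rcos_self[OF x] by blast
    ultimately have "(\<Union>y\<in>?q x. ?q (c \<odot>\<^bsub>M\<^esub> y)) = ?q (c \<odot>\<^bsub>M\<^esub> x)"
      by (rule SUP_eq_const[rotated])
    then show ?thesis
      by (simp add: quotient_module_def)
  qed
  have zero: "\<zero>\<^bsub>quotient_module M N\<^esub> = ?q \<zero>\<^bsub>M\<^esub>"
    using N.a_subset by (auto simp: quotient_module_def a_r_coset_def' [of M] subset_iff)
  have "abelian_group (quotient_module M N)"
  proof (rule abelian_groupI)
    show "\<exists>y\<in>carrier (quotient_module M N).
        y \<oplus>\<^bsub>quotient_module M N\<^esub> x = \<zero>\<^bsub>quotient_module M N\<^esub>"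
      if "x \<in> carrier (quotient_module M N)" for x
      using that by (auto simp: carr add zero M.l_neg intro!: bexI[of _ "\<ominus>\<^bsub>M\<^esub> _"])
  qed (auto simp: carr add zero M.a_ac)
  then show ?thesis
    by (intro moduleI M.R.is_cring)
      (auto simp: carr add scale M.smult_l_distr M.smult_r_distr M.smult_assoc1)
qed

lemma module_kaehler:
  assumes "subring B ring_of_type_algebra" "A \<subseteq> B"
  shows "module (subring_of B) (kaehler B A)"
  unfolding kaehler_def
  using assms by (intro module_quotient_module module_free_differentials submodule_kaehler_relations)

end

theory Submission
  imports Defs
begin

text \<open>
  Write \<open>O\<^sub>L\<close> for the valuation ring of \<open>L\<close>.  The vanishing of \<open>\<Omega>\<close> passes from the top to the bottom of a
  tower because \<open>\<Omega>\<^bsub>B|A\<^esub> \<rightarrow> \<Omega>\<^bsub>C|A\<^esub>\<close> is injective on differentials for \<open>B = O\<^sub>E\<close> and \<open>C\<close> the valuation ring of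
  the separable closure.  For \<open>C = B[z]\<close> with \<open>z\<close> separable this holds because a new relation
  would come from a polynomial \<open>P\<close> over \<open>B\<close> with \<open>P(z) = P'(z) = 0\<close>, and by Gauss' lemma such a \<open>P\<close> is
  a product of two polynomials over \<open>B\<close> that vanish at \<open>z\<close>.  In general one climbs by extensions
  \<open>L'|L\<close> for which \<open>O\<^bsub>L'\<^esub>\<close> is a directed union of rings \<open>O\<^sub>L[z]\<close>: if the value group can still grow, \<open>L'\<close>
  is generated by a root of \<open>X\<^sup>q + \<epsilon> X - b\<close> with a suitable new value, and otherwise by an element
  of minimal degree over \<open>L\<close>, where the \<open>z\<close> are obtained from it by affine transformations.

  In the other direction only \<open>\<Omega>\<close> of the inertia field has to be dealt with.  Elements of
  \<open>O\<^sub>L \<otimes> O\<^sub>L\<close> are determined by their images under all \<open>1 \<otimes> \<sigma>\<close>.  For \<open>x\<close> in the inertia field,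
  \<open>1 \<otimes> x - x \<otimes> 1\<close> vanishes on the inertia group, and a product of elements that are units there and
  vanish at the other automorphisms annihilates it, so \<open>dx = 0\<close> in \<open>\<Omega>\<close> of \<open>O\<^sub>L\<close> over \<open>O\<^sub>K\<close>.
\<close>

section \<open>Subrings, subfields and polynomials over them\<close>

text \<open>The differentials dx generate \<Omega>, so the whole argument concerns statements of the
  form "dx is a relation". The obstacle to descending along the given tower is that the valuation
  ring of a finite extension need not be finitely generated over the one below, and a prescribed
  step offers no good generators. Starting from the separable closure leaves the intermediate fields
  free to choose, and roots of auxiliary separable polynomials are then available in the ambient
  field. The climb works because a relation involves only finitely many elements, so it already
  holds over a single ring O_L[z]. Scalars from O_L[z] that enter on the way are removed by flatness
  over the valuation ring O_L. At the inertia field the difficulty is that automorphisms of L over K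
  need not preserve O_L; this is why the factors used there carry a denominator c.\<close>

abbreviation degree :: "'a::zero poly \<Rightarrow> nat"
  where "degree \<equiv> Polynomial.degree"

abbreviation coeff :: "'a::zero poly \<Rightarrow> nat \<Rightarrow> 'a"
  where "coeff \<equiv> Polynomial.coeff"

abbreviation smult :: "'a::comm_semiring_0 \<Rightarrow> 'a poly \<Rightarrow> 'a poly"
  where "smult \<equiv> Polynomial.smult"

abbreviation monom :: "'a::zero \<Rightarrow> nat \<Rightarrow> 'a poly"
  where "monom \<equiv> Polynomial.monom"

abbreviation single :: "'b \<Rightarrow> 'a::zero \<Rightarrow> ('b \<Rightarrow>\<^sub>0 'a)"
  where "single \<equiv> Poly_Mapping.single"

abbreviation lookup :: "('b \<Rightarrow>\<^sub>0 'a::zero) \<Rightarrow> 'b \<Rightarrow> 'a"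
  where "lookup \<equiv> Poly_Mapping.lookup"

abbreviation keys :: "('b \<Rightarrow>\<^sub>0 'a::zero) \<Rightarrow> 'b set"
  where "keys \<equiv> Poly_Mapping.keys"

definition is_subring :: "'a::comm_ring_1 set \<Rightarrow> bool"
  where "is_subring B \<longleftrightarrow> 0 \<in> B \<and> 1 \<in> B \<and>
    (\<forall>x\<in>B. \<forall>y\<in>B. x + y \<in> B \<and> x - y \<in> B \<and> x * y \<in> B)"

abbreviation is_subfield :: "'a::field set \<Rightarrow> bool"
  where "is_subfield F \<equiv> subfield F ring_of_type_algebra"

lemma
  assumes "is_subring B"
  shows subring_0: "0 \<in> B" and subring_1: "1 \<in> B"
    and subring_add: "x \<in> B \<Longrightarrow> y \<in> B \<Longrightarrow> x + y \<in> B"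
    and subring_diff: "x \<in> B \<Longrightarrow> y \<in> B \<Longrightarrow> x - y \<in> B"
    and subring_mult: "x \<in> B \<Longrightarrow> y \<in> B \<Longrightarrow> x * y \<in> B"
  using assms unfolding is_subring_def by auto

lemma subring_uminus: "is_subring B \<Longrightarrow> x \<in> B \<Longrightarrow> - x \<in> B"
  using subring_diff[of B 0 x] subring_0[of B] by simp

lemma subring_power: "is_subring B \<Longrightarrow> x \<in> B \<Longrightarrow> x ^ n \<in> B"
  by (induction n) (auto intro: subring_1 subring_mult)

lemma subring_sum: "is_subring B \<Longrightarrow> (\<And>i. i \<in> I \<Longrightarrow> f i \<in> B) \<Longrightarrow> sum f I \<in> B"
  by (induction I rule: infinite_finite_induct) (auto intro: subring_0 subring_add)

lemma subring_of_nat: "is_subring B \<Longrightarrow> of_nat n \<in> B"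
  by (induction n) (auto intro: subring_0 subring_1 subring_add)

lemma is_subringI:
  assumes "0 \<in> B" "1 \<in> B" "\<And>x y. x \<in> B \<Longrightarrow> y \<in> B \<Longrightarrow> x + y \<in> B"
    "\<And>x. x \<in> B \<Longrightarrow> - x \<in> B" "\<And>x y. x \<in> B \<Longrightarrow> y \<in> B \<Longrightarrow> x * y \<in> B"
  shows "is_subring B"
  unfolding is_subring_def using assms(3)[of _ "- _"] assms by simp

lemma is_subring_Int: "is_subring A \<Longrightarrow> is_subring B \<Longrightarrow> is_subring (A \<inter> B)"
  unfolding is_subring_def by auto

lemma is_subring_UNIV: "is_subring UNIV"
  unfolding is_subring_def by auto

lemma a_inv_type_algebra [simp]: "\<ominus>\<^bsub>ring_of_type_algebra\<^esub> h = - (h::'a::comm_ring_1)"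
proof -
  interpret U: cring "ring_of_type_algebra :: 'a ring" by (rule cring_from_type_algebra)
  have "\<ominus>\<^bsub>ring_of_type_algebra\<^esub> h \<oplus>\<^bsub>ring_of_type_algebra\<^esub> h = \<zero>\<^bsub>ring_of_type_algebra\<^esub>"
    by (rule U.l_neg) (simp add: ring_of_type_algebra_def)
  then show ?thesis by (simp add: ring_of_type_algebra_def eq_neg_iff_add_eq_0)
qed

lemma subring_type_algebra_iff: "subring B ring_of_type_algebra \<longleftrightarrow> is_subring B"
proof
  assume "subring B ring_of_type_algebra"
  from subringE[OF this] show "is_subring B"
    by (intro is_subringI) (auto simp: ring_of_type_algebra_def simp flip: a_inv_type_algebra)
next
  interpret U: cring "ring_of_type_algebra :: 'a ring" by (rule cring_from_type_algebra)
  assume B: "is_subring B"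
  show "subring B ring_of_type_algebra"
  proof (rule U.subringI)
    show "\<ominus>\<^bsub>ring_of_type_algebra\<^esub> h \<in> B" if "h \<in> B" for h
      using subring_uminus[OF B that] by simp
  qed (use B in \<open>auto simp: ring_of_type_algebra_def intro: subring_1 subring_add subring_mult\<close>)
qed

lemma m_inv_type_algebra: "x \<noteq> 0 \<Longrightarrow> inv\<^bsub>ring_of_type_algebra\<^esub> x = inverse (x::'a::field)"
proof -
  assume "x \<noteq> 0"
  interpret U: field "ring_of_type_algebra :: 'a ring" by (rule field_from_type_algebra)
  show ?thesis using \<open>x \<noteq> 0\<close>
    by (intro U.inv_char) (auto simp: ring_of_type_algebra_def)
qed

lemma is_subfield_iff: "is_subfield F \<longleftrightarrow> is_subring F \<and> (\<forall>x\<in>F. inverse x \<in> F)"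
  for F :: "'a::field set"
proof -
  interpret U: field "ring_of_type_algebra :: 'a ring" by (rule field_from_type_algebra)
  have z: "\<zero>\<^bsub>ring_of_type_algebra\<^esub> = (0::'a)" by (simp add: ring_of_type_algebra_def)
  show ?thesis
  proof
    assume F: "is_subfield F"
    have "inverse x \<in> F" if "x \<in> F" for x
    proof (cases "x = 0")
      case True then show ?thesis using subfieldE(1)[OF F] subring_0
        by (auto simp: subring_type_algebra_iff)
    next
      case False
      then show ?thesis using U.subfield_m_inv(1)[OF F, of x] that m_inv_type_algebra[OF False]
        by (simp add: z)
    qed
    then show "is_subring F \<and> (\<forall>x\<in>F. inverse x \<in> F)"
      using subfieldE(1)[OF F] by (auto simp: subring_type_algebra_iff)
  next
    assume F: "is_subring F \<and> (\<forall>x\<in>F. inverse x \<in> F)"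
    show "is_subfield F"
      using F by (intro U.subfieldI') (auto simp: subring_type_algebra_iff z m_inv_type_algebra)
  qed
qed

lemma subfield_subring: "is_subfield F \<Longrightarrow> is_subring F"
  and subfield_inverse: "is_subfield F \<Longrightarrow> x \<in> F \<Longrightarrow> inverse x \<in> F"
  by (auto simp: is_subfield_iff)

lemma subfield_divide: "is_subfield F \<Longrightarrow> x \<in> F \<Longrightarrow> y \<in> F \<Longrightarrow> x / y \<in> F"
  unfolding divide_inverse by (intro subring_mult subfield_subring subfield_inverse)

lemma is_subfield_UNIV: "is_subfield UNIV"
  by (simp add: is_subfield_iff is_subring_UNIV)

section \<open>Polynomials with coefficients in a subring\<close>

definition polys :: "'a::comm_ring_1 set \<Rightarrow> 'a poly set"
  where "polys B = {p. \<forall>i. coeff p i \<in> B}"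

lemma coeff_in_polys: "p \<in> polys B \<Longrightarrow> coeff p i \<in> B"
  by (simp add: polys_def)

lemma polys_mono: "B \<subseteq> C \<Longrightarrow> polys B \<subseteq> polys C"
  by (auto simp: polys_def)

lemma coeffs_subset_iff: "is_subring B \<Longrightarrow> set (coeffs p) \<subseteq> B \<longleftrightarrow> p \<in> polys B"
proof -
  assume B: "is_subring B"
  have "insert 0 (set (coeffs p)) = range (coeff p)"
    by (simp add: range_coeff)
  then have "insert 0 (set (coeffs p)) \<subseteq> B \<longleftrightarrow> p \<in> polys B"
    by (auto simp: polys_def)
  then show ?thesis using subring_0[OF B] by simp
qed

lemma is_subring_polys: "is_subring B \<Longrightarrow> is_subring (polys B)"
  by (intro is_subringI)
    (auto simp: polys_def coeff_mult subring_0 subring_1 subring_uminus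
      intro: subring_add subring_sum subring_mult)

lemma polys_const [simp]: "is_subring B \<Longrightarrow> [:c:] \<in> polys B \<longleftrightarrow> c \<in> B"
  by (auto simp: polys_def coeff_pCons subring_0 split: nat.splits dest: spec[of _ 0])

lemma polys_pCons [simp]: "pCons c p \<in> polys B \<longleftrightarrow> c \<in> B \<and> p \<in> polys B"
  by (auto simp: polys_def coeff_pCons split: nat.splits dest: spec[of _ "Suc _"] spec[of _ 0])

lemma polys_0 [simp]: "is_subring B \<Longrightarrow> 0 \<in> polys B"
  and polys_1 [simp]: "is_subring B \<Longrightarrow> 1 \<in> polys B"
  using is_subring_polys subring_0 subring_1 by blast+

lemma polys_smult: "is_subring B \<Longrightarrow> c \<in> B \<Longrightarrow> p \<in> polys B \<Longrightarrow> smult c p \<in> polys B"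
  by (auto simp: polys_def intro: subring_mult)

lemma polys_monom: "is_subring B \<Longrightarrow> c \<in> B \<Longrightarrow> monom c n \<in> polys B"
  by (auto simp: polys_def subring_0)

lemma polys_pderiv: "is_subring B \<Longrightarrow> p \<in> polys B \<Longrightarrow> pderiv p \<in> polys B"
  by (auto simp: polys_def coeff_pderiv intro!: subring_mult simp del: of_nat_Suc intro:
    subring_of_nat)

lemma polys_poly: "is_subring B \<Longrightarrow> p \<in> polys B \<Longrightarrow> x \<in> B \<Longrightarrow> poly p x \<in> B"
  by (auto simp: poly_altdef polys_def intro!: subring_sum subring_mult subring_power)

lemma polys_pcompose: "is_subring B \<Longrightarrow> p \<in> polys B \<Longrightarrow> q \<in> polys B \<Longrightarrow> pcompose p q \<in> polys B"
  by (induction p) (auto simp: pcompose_pCons intro!: subring_add subring_mult is_subring_polys)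

text \<open>Long division inverts only the leading coefficient of \<open>g\<close>, so quotient and
  remainder keep their coefficients in \<open>L\<close>.\<close>

lemma polys_division:
  fixes f g :: "'a::field poly"
  assumes L: "is_subfield L" and f: "f \<in> polys L" and g: "g \<in> polys L" "g \<noteq> 0"
  shows "\<exists>q\<in>polys L. \<exists>r\<in>polys L. f = q * g + r \<and> (r = 0 \<or> degree r < degree g)"
  using f
proof (induction "degree f" arbitrary: f rule: less_induct)
  case less
  note R = subfield_subring[OF L]
  show ?case
  proof (cases "f = 0 \<or> degree f < degree g")
    case True
    then show ?thesis using less.prems R
      by (intro bexI[of _ 0] bexI[of _ f]) auto
  next
    case False
    define t where "t = monom (lead_coeff f / lead_coeff g)
      (degree f - degree g)"
    have t: "t \<in> polys L" unfolding t_def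
      using L R less.prems g by (intro polys_monom subfield_divide coeff_in_polys) auto
    define h where "h = f - t * g"
    have h: "h \<in> polys L" unfolding h_def
      using t less.prems g is_subring_polys[OF R] by (auto intro: subring_diff subring_mult)
    have t0: "t \<noteq> 0" using False g by (auto simp: t_def)
    have dt: "degree (t * g) = degree f"
      using False g t0 by (subst degree_mult_eq) (auto simp: t_def degree_monom_eq)
    have "lead_coeff (t * g) = lead_coeff f"
      using g False by (auto simp: lead_coeff_mult t_def degree_monom_eq)
    with dt have c0: "coeff h (degree f) = 0"
      by (simp add: h_def)
    have "degree h \<le> degree f"
      unfolding h_def using degree_diff_le_max[of f "t * g"] dt by simp
    then have "h = 0 \<or> degree h < degree f"
      using c0 by (metis leading_coeff_0_iff le_neq_implies_less)
    then show ?thesis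
    proof
      assume "h = 0"
      then have "f = t * g + 0" by (simp add: h_def)
      then show ?thesis using t polys_0[OF R] by blast
    next
      assume "degree h < degree f"
      from less.hyps[OF this h] obtain q r where
        "q \<in> polys L" "r \<in> polys L" "h = q * g + r" "r = 0 \<or> degree r < degree g"
        by blast
      moreover from this have "f = (q + t) * g + r" by (simp add: h_def algebra_simps)
      ultimately show ?thesis using t is_subring_polys[OF R] subring_add by blast
    qed
  qed
qed

text \<open>Divisibility over the ambient field descends to \<open>L\<close>, because the remainder
  computed over \<open>L\<close> is divisible by \<open>g\<close> and has smaller degree.\<close>

lemma polys_dvd_quotient:
  fixes f g :: "'a::field poly"
  assumes L: "is_subfield L" and "f \<in> polys L" "g \<in> polys L" "g dvd f"
  obtains q where "q \<in> polys L" "f = q * g"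
proof (cases "g = 0")
  case True then show ?thesis using assms that[of 0] polys_0 subfield_subring by auto
next
  case False
  obtain q r where qr: "q \<in> polys L" "f = q * g + r" "r = 0 \<or> degree r < degree g"
    using polys_division[OF assms(1-3) False] by blast
  have "g dvd r" using assms(4) qr(2) by (simp add: dvd_add_right_iff)
  then have "r = 0" using qr(3) by (metis dvd_imp_degree_le leD)
  then show ?thesis using that qr by auto
qed

text \<open>Euclid's algorithm stays inside \<open>polys L\<close>, so failure of coprimality over
  the ambient field is witnessed over \<open>L\<close>.\<close>

lemma polys_common_divisor:
  fixes f g :: "'a::field poly"
  assumes L: "is_subfield L" and "f \<in> polys L" "g \<in> polys L" "f \<noteq> 0" "\<not> coprime f g"
  shows "\<exists>d\<in>polys L. degree d > 0 \<and> d dvd f \<and> d dvd g"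
  using assms(2-)
\<comment> \<open>Zero and the nonzero constants share the degree 0; the shift by \<open>Suc\<close>
  lets the last division, from a constant to 0, decrease the measure.\<close>
proof (induction "if g = 0 then 0 else Suc (degree g)" arbitrary: f g rule: less_induct)
  case less
  show ?case
  proof (cases "g = 0")
    case True
    then have "\<not> is_unit f" using less.prems by auto
    then have "degree f > 0" using less.prems by (simp add: is_unit_iff_degree)
    then show ?thesis using less.prems True by auto
  next
    case False
    obtain q r where qr: "q \<in> polys L" "r \<in> polys L" "f = q * g + r"
        "r = 0 \<or> degree r < degree g"
      using polys_division[OF L less.prems(1,2) False] by blast
    have "\<not> coprime g r"
    proof
      assume "coprime g r"
      then have "coprime f g"
        unfolding qr(3) by (intro coprimeI) (metis coprime_common_divisor dvd_add_right_iff
          dvd_mult)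
      then show False using less.prems by simp
    qed
    then have "\<exists>d\<in>polys L. degree d > 0 \<and> d dvd g \<and> d dvd r"
      using less.hyps[OF _ less.prems(2) qr(2) False] qr(4) False by auto
    then obtain d where d: "d \<in> polys L" "degree d > 0" "d dvd g" "d dvd r" by blast
    then show ?thesis using qr(3) by (auto intro!: bexI[of _ d])
  qed
qed

section \<open>Minimal polynomials, up to a scalar, and simple extensions\<close>

definition minpoly :: "'a::field set \<Rightarrow> 'a \<Rightarrow> 'a poly \<Rightarrow> bool"
  where "minpoly L x p \<longleftrightarrow> p \<in> polys L \<and> p \<noteq> 0 \<and> poly p x = 0 \<and>
    (\<forall>q\<in>polys L. q \<noteq> 0 \<longrightarrow> poly q x = 0 \<longrightarrow> degree p \<le> degree q)"

lemma minpoly_exists: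
  assumes "q \<in> polys L" "q \<noteq> 0" "poly q x = 0"
  obtains p where "minpoly L x p"
proof -
  let ?Q = "\<lambda>p. p \<in> polys L \<and> p \<noteq> 0 \<and> poly p x = 0"
  have "?Q (arg_min degree ?Q) \<and> (\<forall>q. ?Q q \<longrightarrow>
      degree (arg_min degree ?Q) \<le> degree q)"
    by (rule arg_min_nat_lemma[of ?Q q]) (use assms in auto)
  then show ?thesis using that unfolding minpoly_def by blast
qed

lemma minpoly_dvd:
  assumes L: "is_subfield L" and p: "minpoly L x p" and q: "q \<in> polys L" "poly q x = 0"
  obtains s where "s \<in> polys L" "q = s * p"
proof -
  obtain s r where sr: "s \<in> polys L" "r \<in> polys L" "q = s * p + r"
      "r = 0 \<or> degree r < degree p"
    using polys_division[OF L q(1), of p] p unfolding minpoly_def by blast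
  have "poly r x = 0" using sr(3) q(2) p by (simp add: minpoly_def)
  then have "r = 0" using p sr unfolding minpoly_def by (meson leD)
  then show ?thesis using that sr by auto
qed

lemma minpoly_degree_pos:
  assumes "minpoly L x p"
  shows "degree p > 0"
proof (rule ccontr)
  assume "\<not> ?thesis"
  then obtain c where "p = [:c:]" using degree_eq_zeroE by blast
  then show False using assms by (auto simp: minpoly_def)
qed

lemma poly_in_adjoin_reduce:
  assumes L: "is_subfield L" and p: "p \<in> polys L" "p \<noteq> 0" "poly p x = 0" and q: "q \<in> polys L"
  obtains r where "r \<in> polys L" "poly r x = poly q x" "r = 0 \<or> degree r < degree p"
proof -
  obtain s r where "s \<in> polys L" "r \<in> polys L" "q = s * p + r"
      "r = 0 \<or> degree r < degree p"
    using polys_division[OF L q p(1,2)] by blast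
  then show ?thesis using that[of r] p by auto
qed

definition adjoin :: "'a::comm_ring_1 set \<Rightarrow> 'a \<Rightarrow> 'a set"
  where "adjoin B z = (\<lambda>p. poly p z) ` polys B"

lemma adjoinI: "p \<in> polys B \<Longrightarrow> y = poly p z \<Longrightarrow> y \<in> adjoin B z"
  by (auto simp: adjoin_def)

lemma is_subring_adjoin: "is_subring B \<Longrightarrow> is_subring (adjoin B z)"
proof (rule is_subringI)
  assume B: "is_subring B"
  note P = is_subring_polys[OF B]
  show "0 \<in> adjoin B z" by (rule adjoinI[of 0]) (use B in auto)
  show "1 \<in> adjoin B z" by (rule adjoinI[of 1]) (use B in auto)
  fix x y assume "x \<in> adjoin B z" "y \<in> adjoin B z"
  then obtain p q where "p \<in> polys B" "q \<in> polys B" "x = poly p z" "y = poly q z"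
    by (auto simp: adjoin_def)
  then show "x + y \<in> adjoin B z" "- x \<in> adjoin B z" "x * y \<in> adjoin B z"
    using adjoinI[OF subring_add[OF P, of p q]] adjoinI[OF subring_uminus[OF P, of p]]
      adjoinI[OF subring_mult[OF P, of p q]] by auto
qed

lemma subset_adjoin: "is_subring B \<Longrightarrow> B \<subseteq> adjoin B z"
  by (auto intro!: adjoinI[of "[:_:]"])

lemma gen_in_adjoin: "is_subring B \<Longrightarrow> z \<in> adjoin B z"
  by (rule adjoinI[of "[:0,1:]"]) (auto simp: subring_0 subring_1)

lemma adjoin_subset: "is_subring C \<Longrightarrow> B \<subseteq> C \<Longrightarrow> z \<in> C \<Longrightarrow> adjoin B z \<subseteq> C"
  unfolding adjoin_def using polys_poly polys_mono by blast

text \<open>Dividing \<open>m\<close> by \<open>q\<close> gives s(z) q(z) = - r(z) with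
  \<open>r\<close> of smaller degree, so an inverse of r(z) yields one of q(z).\<close>

lemma adjoin_inverse:
  assumes L: "is_subfield L" and m: "minpoly L z m" and q: "q \<in> polys L" "poly q z \<noteq> 0"
    "degree q < degree m"
  shows "\<exists>t\<in>polys L. poly t z * poly q z = 1"
  using q
proof (induction "degree q" arbitrary: q rule: less_induct)
  case less
  note R = subfield_subring[OF L]
  have m': "m \<in> polys L" "m \<noteq> 0" "poly m z = 0"
    "\<And>r. r \<in> polys L \<Longrightarrow> r \<noteq> 0 \<Longrightarrow> poly r z = 0 \<Longrightarrow> degree m \<le> degree r"
    using m unfolding minpoly_def by auto
  have q0: "q \<noteq> 0" using less.prems by auto
  show ?case
  proof (cases "degree q = 0")
    case True
    then obtain c where c: "q = [:c:]" by (rule degree_eq_zeroE)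
    with less.prems R show ?thesis
      by (intro bexI[of _ "[:inverse c:]"]) (auto intro: subfield_inverse[OF L])
  next
    case False
    obtain s r where sr: "s \<in> polys L" "r \<in> polys L" "m = s * q + r"
      "r = 0 \<or> degree r < degree q"
      using polys_division[OF L m'(1) less.prems(1) q0] by blast
    have eq: "poly s z * poly q z + poly r z = 0"
      using arg_cong[OF sr(3), of "\<lambda>f. poly f z"] m' by simp
    \<comment> \<open>If \<open>q\<close> divided \<open>m\<close>, the cofactor \<open>s\<close>
      would vanish at \<open>z\<close> with degree below that of \<open>m\<close>.\<close>
    have r0: "r \<noteq> 0"
    proof
      assume r: "r = 0"
      then have "poly s z = 0" "s \<noteq> 0" using eq less.prems sr(3) m' by auto
      then have "degree m \<le> degree s" using m' sr(1) by blast
      then show False using sr(3) r False \<open>s \<noteq> 0\<close> q0 by (simp add: degree_mult_eq)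
    qed
    then have "poly r z \<noteq> 0" using m'(4)[of r] sr less.prems by force
    then obtain t where t: "t \<in> polys L" "poly t z * poly r z = 1"
      using less.hyps[of r] sr r0 less.prems by auto
    have "poly r z = - (poly s z * poly q z)"
      using eq by (simp add: eq_neg_iff_add_eq_0 add.commute)
    then have "poly (- (t * s)) z * poly q z = 1"
      using t(2) by (simp add: mult.assoc)
    moreover have "- (t * s) \<in> polys L"
      using is_subring_polys[OF R] t sr by (intro subring_uminus subring_mult)
    ultimately show ?thesis by blast
  qed
qed

lemma is_subfield_adjoin:
  assumes L: "is_subfield L" and p: "p \<in> polys L" "p \<noteq> 0" "poly p z = 0"
  shows "is_subfield (adjoin L z)"
proof -
  note R = subfield_subring[OF L]
  obtain m where m: "minpoly L z m" using minpoly_exists[OF p] .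
  have m': "m \<in> polys L" "m \<noteq> 0" "poly m z = 0" using m unfolding minpoly_def by auto
  have "inverse y \<in> adjoin L z" if y: "y \<in> adjoin L z" for y
  proof (cases "y = 0")
    case True then show ?thesis using y by simp
  next
    case False
    obtain q' where q': "q' \<in> polys L" "y = poly q' z" using y by (auto simp: adjoin_def)
    obtain q where q: "q \<in> polys L" "poly q z = poly q' z" "q = 0 \<or> degree q < degree m"
      using poly_in_adjoin_reduce[OF L m' q'(1)] .
    then obtain t where t: "t \<in> polys L" "poly t z * poly q z = 1"
      using adjoin_inverse[OF L m, of q] False q' by auto
    then have "inverse y = poly t z"
      using q q' by (metis inverse_unique mult.commute)
    then show ?thesis using t by (auto simp: adjoin_def)
  qed
  then show ?thesis using is_subring_adjoin[OF R] by (simp add: is_subfield_iff)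
qed

lemma separable_poly_simple_root:
  assumes "separable_poly p" "poly p z = 0"
  shows "poly (pderiv p) z \<noteq> 0"
proof
  assume "poly (pderiv p) z = 0"
  then have "is_unit [:- z, 1:]" using assms
    by (auto simp: poly_eq_0_iff_dvd separable_poly_def intro: coprime_common_divisor)
  then show False by (simp add: is_unit_pCons_iff)
qed

section \<open>Valuation subrings of a field\<close>

text \<open>Antisymmetry is absent on purpose: the lemma is applied to \<open>vle\<close>, to its
  converse and to a comparison of value classes, where distinct elements may be equivalent.\<close>

lemma total_preorder_least:
  assumes "finite I" "I \<noteq> {}" "\<And>i j. R i j \<or> R j i" "\<And>i j k. R i j \<Longrightarrow> R j k \<Longrightarrow> R i k"
  shows "\<exists>i\<in>I. \<forall>j\<in>I. R i j"
  using assms(1,2)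
proof (induction rule: finite_ne_induct)
  case (singleton x)
  then show ?case using assms(3) by blast
next
  case (insert a I)
  then obtain i where "i \<in> I" "\<forall>j\<in>I. R i j" by blast
  then show ?case using assms(3,4) by (metis insert_iff)
qed

text \<open>A Krull valuation enters through its ring, which determines it up to equivalence.
  Divisibility in \<open>V\<close> replaces the value group, so arbitrary rank costs
  nothing.\<close>

locale valuation_subring =
  fixes V :: "'a::field set"
  assumes V_subring: "is_subring V"
    and V_total: "x \<in> V \<or> inverse x \<in> V"
begin

text \<open>The relation v(x) <= v(y) of the valuation with ring \<open>V\<close>; the largest
  element is 0.\<close>

definition vle :: "'a \<Rightarrow> 'a \<Rightarrow> bool"
  where "vle x y \<longleftrightarrow> (\<exists>c\<in>V. y = c * x)"

definition maximal_ideal :: "'a set"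
  where "maximal_ideal = {x \<in> V. x = 0 \<or> inverse x \<notin> V}"

lemmas V_0 = subring_0[OF V_subring]
  and V_1 = subring_1[OF V_subring]
  and V_add = subring_add[OF V_subring]
  and V_diff = subring_diff[OF V_subring]
  and V_mult = subring_mult[OF V_subring]
  and V_uminus = subring_uminus[OF V_subring]

lemma vle_refl [simp]: "vle x x"
  unfolding vle_def using V_1 by (intro bexI[of _ 1]) auto

lemma vle_trans [trans]: "vle x y \<Longrightarrow> vle y z \<Longrightarrow> vle x z"
  unfolding vle_def by (metis V_mult mult.assoc)

lemma vle_0 [simp]: "vle x 0"
  unfolding vle_def using V_0 by (intro bexI[of _ 0]) auto

lemma vle_0_iff [simp]: "vle 0 x \<longleftrightarrow> x = 0"
  using V_0 by (auto simp: vle_def)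

lemma vle_iff_divide: "x \<noteq> 0 \<Longrightarrow> vle x y \<longleftrightarrow> y / x \<in> V"
  by (auto simp: vle_def field_simps intro!: bexI[of _ "y / x"])

lemma vle_total: "vle x y \<or> vle y x"
proof (cases "x = 0 \<or> y = 0")
  case False
  then show ?thesis using V_total[of "x / y"] by (auto simp: vle_iff_divide field_simps)
qed auto

lemma vle_add: "vle x y \<Longrightarrow> vle x z \<Longrightarrow> vle x (y + z)"
  unfolding vle_def by (metis V_add distrib_right)

lemma vle_uminus [simp]: "vle x (- y) \<longleftrightarrow> vle x y"
  unfolding vle_def by (metis V_uminus minus_minus minus_mult_left)

lemma vle_diff: "vle x y \<Longrightarrow> vle x z \<Longrightarrow> vle x (y - z)"
  using vle_add[of x y "- z"] by simp

lemma vle_mult: "vle x y \<Longrightarrow> vle x' y' \<Longrightarrow> vle (x * x') (y * y')"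
  unfolding vle_def by (metis V_mult mult.assoc mult.left_commute)

lemma vle_mult_left [simp]: "c \<noteq> 0 \<Longrightarrow> vle (c * x) (c * y) \<longleftrightarrow> vle x y"
  by (auto simp: vle_def)

lemma vle_mult_right [simp]: "c \<noteq> 0 \<Longrightarrow> vle (x * c) (y * c) \<longleftrightarrow> vle x y"
  by (auto simp: vle_def)

lemma vle_power: "vle x y \<Longrightarrow> vle (x ^ n) (y ^ n)"
  by (induction n) (auto intro: vle_mult)

lemma vle_multV: "c \<in> V \<Longrightarrow> vle x y \<Longrightarrow> vle x (c * y)"
  unfolding vle_def by (metis V_mult mult.assoc)

lemma in_V_vle: "x \<in> V \<Longrightarrow> vle x y \<Longrightarrow> y \<in> V"
  by (auto simp: vle_def intro: V_mult)

lemma vle_min: "finite I \<Longrightarrow> I \<noteq> {} \<Longrightarrow> \<exists>i\<in>I. \<forall>j\<in>I. vle (f i) (f j)"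
  by (rule total_preorder_least) (use vle_total vle_trans in blast)+

lemma vle_max: "finite I \<Longrightarrow> I \<noteq> {} \<Longrightarrow> \<exists>i\<in>I. \<forall>j\<in>I. vle (f j) (f i)"
  by (rule total_preorder_least) (use vle_total vle_trans in blast)+

lemma maximal_ideal_iff: "x \<in> maximal_ideal \<longleftrightarrow> x \<in> V \<and> \<not> vle x 1"
  by (cases "x = 0") (auto simp: maximal_ideal_def vle_iff_divide inverse_eq_divide)

lemma maximal_ideal_mult: "c \<in> V \<Longrightarrow> x \<in> maximal_ideal \<Longrightarrow> c * x \<in> maximal_ideal"
  unfolding maximal_ideal_iff by (meson V_mult vle_multV vle_refl vle_trans)

lemma maximal_ideal_0: "0 \<in> maximal_ideal"
  by (simp add: maximal_ideal_def V_0)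

lemma one_notin_maximal_ideal: "1 \<notin> maximal_ideal"
  by (simp add: maximal_ideal_def V_1)

lemma maximal_ideal_add:
  assumes "x \<in> maximal_ideal" "y \<in> maximal_ideal"
  shows "x + y \<in> maximal_ideal"
proof -
  have *: "x + y \<in> maximal_ideal" if xy: "vle x y" "x \<in> maximal_ideal" for x y
  proof -
    obtain c where c: "c \<in> V" "y = c * x" using xy by (auto simp: vle_def)
    have "(1 + c) * x \<in> maximal_ideal" using c V_1 xy by (intro maximal_ideal_mult V_add)
    then show ?thesis using c by (simp add: algebra_simps)
  qed
  show ?thesis using *[of x y] *[of y x] assms vle_total by (metis add.commute)
qed

lemma maximal_ideal_sum: "(\<And>i. i \<in> I \<Longrightarrow> f i \<in> maximal_ideal) \<Longrightarrow> sum f I \<in> maximal_ideal"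
  by (induction I rule: infinite_finite_induct) (auto intro: maximal_ideal_add maximal_ideal_0)

lemma unit_mult: "x \<in> V - maximal_ideal \<Longrightarrow> y \<in> V - maximal_ideal \<Longrightarrow> x * y \<in> V - maximal_ideal"
  by (auto simp: maximal_ideal_def V_mult)

lemma inverse_in_maximal_ideal: "c \<notin> V \<Longrightarrow> inverse c \<in> maximal_ideal"
  using V_total[of c] by (auto simp: maximal_ideal_def)

text \<open>If \<open>s\<close> had a coefficient outside \<open>V\<close>, dividing by its
  coefficient of least value would make it primitive, while its product with the primitive
  \<open>g\<close> would have all coefficients in the maximal ideal.\<close>

lemma gauss_lemma:
  assumes g: "g \<in> polys V" "coeff g i1 = 1" and gs: "g * s \<in> polys V"
  shows "s \<in> polys V"
proof (rule ccontr)
  assume s: "s \<notin> polys V"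
  have s0: "s \<noteq> 0" using s V_subring by auto
  obtain j1 where j1: "\<And>j. j \<le> degree s \<Longrightarrow> vle (coeff s j1) (coeff s j)"
    using vle_min[of "{..degree s}" "coeff s"] by auto
  define c where "c = coeff s j1"
  have cle: "vle c (coeff s j)" for j
    using j1 by (cases "j \<le> degree s") (auto simp: c_def coeff_eq_0)
  have c: "c \<notin> V" using s cle in_V_vle by (auto simp: polys_def)
  then have c0: "c \<noteq> 0" using V_0 by auto
  define s' where "s' = smult (inverse c) s"
  have s': "coeff s' j \<in> V" for j
    using cle[of j] c0 by (simp add: s'_def vle_iff_divide divide_inverse mult.commute)
  have s'1: "coeff s' j1 = 1" using c0 by (simp add: s'_def c_def)
  have m: "coeff (g * s') k \<in> maximal_ideal" for k
    using maximal_ideal_mult[OF coeff_in_polys[OF gs] inverse_in_maximal_ideal[OF c], of k]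
    by (simp add: s'_def mult.commute)
  \<comment> \<open>In degree \<open>i + j\<close> the product of these two first unit coefficients
    is the only summand outside the maximal ideal.\<close>
  define i where "i = (LEAST i. coeff g i \<notin> maximal_ideal)"
  define j where "j = (LEAST j. coeff s' j \<notin> maximal_ideal)"
  have i: "coeff g i \<notin> maximal_ideal"
    unfolding i_def by (rule LeastI[of _ i1]) (simp add: g one_notin_maximal_ideal)
  have j: "coeff s' j \<notin> maximal_ideal"
    unfolding j_def by (rule LeastI[of _ j1]) (simp add: s'1 one_notin_maximal_ideal)
  have small: "coeff g k * coeff s' (i + j - k) \<in> maximal_ideal"
    if "k \<in> {..i+j} - {i}" for k
  proof (cases "k < i")
    case True
    then have "coeff g k \<in> maximal_ideal" unfolding i_def using not_less_Least by blast
    then show ?thesis using s' maximal_ideal_mult by (metis mult.commute)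
  next
    case False
    then have "i + j - k < j" using that by auto
    then have "coeff s' (i + j - k) \<in> maximal_ideal"
      unfolding j_def using not_less_Least by blast
    then show ?thesis using g coeff_in_polys maximal_ideal_mult by blast
  qed
  then have sm: "(\<Sum>k\<in>{..i+j} - {i}. coeff g k * coeff s' (i + j - k)) \<in> maximal_ideal"
    by (rule maximal_ideal_sum)
  have "coeff (g * s') (i + j) =
      coeff g i * coeff s' j +
      (\<Sum>k\<in>{..i+j} - {i}. coeff g k * coeff s' (i + j - k))"
    by (simp add: coeff_mult sum.remove[of "{..i+j}" i])
  then have "coeff g i * coeff s' j =
      coeff (g * s') (i + j) +
      (- 1) * (\<Sum>k\<in>{..i+j} - {i}. coeff g k * coeff s' (i + j - k))"
    by simp
  also have "\<dots> \<in> maximal_ideal"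
    using m sm V_1 V_uminus by (intro maximal_ideal_add maximal_ideal_mult) auto
  finally show False
    using unit_mult[of "coeff g i" "coeff s' j"] i j s' g coeff_in_polys by blast
qed

text \<open>Division by a coefficient of least value turns that coefficient into 1, the form of
  primitivity that \<open>gauss_lemma\<close> expects.\<close>

lemma primitive_multiple:
  assumes L: "is_subfield L" and p: "p \<in> polys L" "p \<noteq> 0"
  obtains c i where "c \<in> L" "c \<noteq> 0" "smult (inverse c) p \<in> polys (V \<inter> L)"
    "coeff (smult (inverse c) p) i = 1"
proof -
  obtain i where i: "\<And>j. j \<le> degree p \<Longrightarrow> vle (coeff p i) (coeff p j)"
    using vle_min[of "{..degree p}" "coeff p"] by auto
  define c where "c = coeff p i"
  have cle: "vle c (coeff p j)" for j
    using i by (cases "j \<le> degree p") (auto simp: c_def coeff_eq_0)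
  have c0: "c \<noteq> 0" using cle[of "degree p"] p by auto
  have cL: "c \<in> L" using p by (simp add: c_def coeff_in_polys)
  have "inverse c * coeff p j \<in> V \<inter> L" for j
    using cle[of j] c0 L cL coeff_in_polys[OF p(1)]
    by (auto simp: vle_iff_divide divide_inverse mult.commute
        intro: subring_mult subfield_subring subfield_inverse)
  then show ?thesis using that[of c i] c0 cL by (simp add: polys_def c_def)
qed

end

section \<open>Calculus in the presentation of Kaehler differentials\<close>

abbreviation pscale :: "'a::comm_ring_1 \<Rightarrow> ('b \<Rightarrow>\<^sub>0 'a) \<Rightarrow> ('b \<Rightarrow>\<^sub>0 'a)"
  where "pscale c \<equiv> Poly_Mapping.map ((*) c)"

declare lookup_scale [simp]

lemma pscale_simps [simp]:
  fixes f g :: "'b \<Rightarrow>\<^sub>0 'a::comm_ring_1"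
  shows "pscale c 0 = (0 :: 'b \<Rightarrow>\<^sub>0 'a)" "pscale 0 f = 0" "pscale 1 f = f"
    "pscale c (single b d) = single b (c * d)"
    "pscale c (pscale d f) = pscale (c * d) f"
  by (auto intro!: poly_mapping_eqI simp: lookup_single when_def)

lemma pscale_distribs:
  fixes f g :: "'b \<Rightarrow>\<^sub>0 'a::comm_ring_1"
  shows "pscale c (f + g) = pscale c f + pscale c g" "pscale c (f - g) = pscale c f - pscale c g"
    "pscale (c + d) f = pscale c f + pscale d f" "pscale (c - d) f = pscale c f - pscale d f"
    "pscale c (- f) = - pscale c f" "pscale (- c) f = - pscale c f"
  by (auto intro!: poly_mapping_eqI simp: lookup_add lookup_minus algebra_simps)

lemma pscale_sum: "pscale c (sum f I) = (\<Sum>i\<in>I. pscale c (f i))"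
  by (induction I rule: infinite_finite_induct) (auto simp: pscale_distribs)

text \<open>The linear extension of \<open>h\<close> from the symbols to the free module. The action
  \<open>s\<close> is a parameter because two targets occur: the ring itself, with multiplication,
  and a free module, with \<open>pscale\<close>.\<close>

definition lin_ext :: "('a \<Rightarrow> 'm \<Rightarrow> 'm) \<Rightarrow> ('b \<Rightarrow> 'm) \<Rightarrow> ('b \<Rightarrow>\<^sub>0 'a::comm_ring_1) \<Rightarrow> 'm::ab_group_add"
  where "lin_ext s h f = (\<Sum>b\<in>keys f. s (lookup f b) (h b))"

locale scalar_action =
  fixes s :: "'a::comm_ring_1 \<Rightarrow> 'm::ab_group_add \<Rightarrow> 'm"
  assumes act_add: "s (a + b) m = s a m + s b m"
    and act_add': "s a (m + n) = s a m + s a n"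
    and act_mult: "s (a * b) m = s a (s b m)"
begin

lemma act_0 [simp]: "s 0 m = 0"
  using act_add[of 0 0 m] by simp

lemma act_0' [simp]: "s a 0 = 0"
  using act_add'[of a 0 0] by simp

lemma act_sum: "s c (sum g I) = (\<Sum>i\<in>I. s c (g i))"
  by (induction I rule: infinite_finite_induct) (auto simp: act_add')

lemma act_sum_left: "s (sum g I) m = (\<Sum>i\<in>I. s (g i) m)"
  by (induction I rule: infinite_finite_induct) (auto simp: act_add)

lemma lin_ext_superset:
  "finite S \<Longrightarrow> keys f \<subseteq> S \<Longrightarrow> lin_ext s h f = (\<Sum>b\<in>S. s (lookup f b) (h b))"
  unfolding lin_ext_def by (intro sum.mono_neutral_left) (auto simp: in_keys_iff)

lemma lin_ext_0 [simp]: "lin_ext s h 0 = 0"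
  by (simp add: lin_ext_def)

lemma lin_ext_add: "lin_ext s h (f + g) = lin_ext s h f + lin_ext s h g"
proof -
  define S where "S = keys f \<union> keys g"
  have "lin_ext s h u = (\<Sum>b\<in>S. s (lookup u b) (h b))"
    if "keys u \<subseteq> S" for u
    using that by (intro lin_ext_superset) (auto simp: S_def)
  from this[of f] this[of g] this[of "f + g"] show ?thesis
    using keys_add[of f g] by (simp add: S_def lookup_add act_add sum.distrib)
qed

lemma lin_ext_diff: "lin_ext s h (f - g) = lin_ext s h f - lin_ext s h g"
  using lin_ext_add[of h "f - g" g] by simp

lemma lin_ext_sum: "lin_ext s h (sum f I) = (\<Sum>i\<in>I. lin_ext s h (f i))"
  by (induction I rule: infinite_finite_induct) (auto simp: lin_ext_add)

lemma lin_ext_single [simp]: "lin_ext s h (single b c) = s c (h b)"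
  by (simp add: lin_ext_def)

lemma lin_ext_pscale: "lin_ext s h (pscale c f) = s c (lin_ext s h f)"
proof -
  have "keys (pscale c f) \<subseteq> keys f"
    by (auto simp: in_keys_iff)
  then show ?thesis
    by (subst lin_ext_superset[of "keys f"]) (auto simp: act_mult act_sum lin_ext_def)
qed

end

interpretation mult_action: scalar_action "(*) :: 'a::comm_ring_1 \<Rightarrow> 'a \<Rightarrow> 'a"
  by unfold_locales (auto simp: algebra_simps)

interpretation pscale_action: scalar_action "pscale :: 'a::comm_ring_1 \<Rightarrow> ('b \<Rightarrow>\<^sub>0 'a) \<Rightarrow> ('b \<Rightarrow>\<^sub>0 'a)"
  by unfold_locales (auto simp: pscale_distribs)

lemma lin_ext_id: "lin_ext pscale (\<lambda>b. single b 1) f = (f :: 'a \<Rightarrow>\<^sub>0 'a::comm_ring_1)"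
proof (rule poly_mapping_eqI)
  fix k
  have "lookup (lin_ext pscale (\<lambda>b. single b 1) f) k =
      (\<Sum>b\<in>keys f. if b = k then lookup f b else 0)"
    by (simp add: lin_ext_def lookup_sum lookup_single when_def)
  then show "lookup (lin_ext pscale (\<lambda>b. single b 1) f) k = lookup f k"
    by (simp add: in_keys_iff)
qed

definition is_submodule :: "'a::comm_ring_1 set \<Rightarrow> ('b \<Rightarrow>\<^sub>0 'a) set \<Rightarrow> bool"
  where "is_submodule C N \<longleftrightarrow> 0 \<in> N \<and> (\<forall>f\<in>N. \<forall>g\<in>N. f + g \<in> N) \<and> (\<forall>c\<in>C. \<forall>f\<in>N. pscale c f \<in> N)"

lemma
  assumes "is_submodule C N"
  shows submodule_0: "0 \<in> N" and submodule_add: "f \<in> N \<Longrightarrow> g \<in> N \<Longrightarrow> f + g \<in> N"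
    and submodule_pscale: "c \<in> C \<Longrightarrow> f \<in> N \<Longrightarrow> pscale c f \<in> N"
  using assms unfolding is_submodule_def by auto

lemma submodule_uminus: "is_submodule C N \<Longrightarrow> is_subring C \<Longrightarrow> f \<in> N \<Longrightarrow> - f \<in> N"
  using submodule_pscale[of C N "- 1" f] subring_uminus[OF _ subring_1, of C]
  by (simp add: pscale_distribs)

lemma submodule_diff: "is_submodule C N \<Longrightarrow> is_subring C \<Longrightarrow> f \<in> N \<Longrightarrow> g \<in> N \<Longrightarrow> f - g \<in> N"
  using submodule_add[of C N f "- g"] submodule_uminus[of C N g] by simp

lemma submodule_sum: "is_submodule C N \<Longrightarrow> (\<And>i. i \<in> I \<Longrightarrow> f i \<in> N) \<Longrightarrow> sum f I \<in> N"
  by (induction I rule: infinite_finite_induct) (auto intro: submodule_0 submodule_add)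

lemma is_submodule_kaehler: "is_submodule B (kaehler_relations B A)"
  unfolding is_submodule_def by (auto intro: kaehler_relations.intros)

text \<open>Free modules over all subrings live in one type, so extending a module of relations to a
  larger ring \<open>C\<close> of scalars amounts to taking its \<open>C\<close>-span there.\<close>

inductive_set module_span :: "'a::comm_ring_1 set \<Rightarrow> ('b \<Rightarrow>\<^sub>0 'a) set \<Rightarrow> ('b \<Rightarrow>\<^sub>0 'a) set"
  for C N
  where
    zero: "0 \<in> module_span C N"
  | step: "c \<in> C \<Longrightarrow> f \<in> N \<Longrightarrow> g \<in> module_span C N \<Longrightarrow> pscale c f + g \<in> module_span C N"

lemma is_submodule_span: "is_subring C \<Longrightarrow> is_submodule C (module_span C N)"
proof -
  assume C: "is_subring C"
  have "f + g \<in> module_span C N" if "f \<in> module_span C N" "g \<in> module_span C N" for f g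
    using that by induction (auto simp: add.assoc intro: module_span.intros)
  moreover have "pscale c f \<in> module_span C N" if "c \<in> C" "f \<in> module_span C N" for c f
    using that(2,1) by induction
      (auto simp: pscale_distribs intro!: module_span.intros subring_mult C)
  ultimately show ?thesis by (auto simp: is_submodule_def intro: module_span.zero)
qed

lemma module_span_base: "is_subring C \<Longrightarrow> f \<in> N \<Longrightarrow> f \<in> module_span C N"
  using module_span.step[OF subring_1 _ module_span.zero, of C f N] by simp

lemma module_span_sum:
  assumes "f \<in> module_span C N"
  shows "\<exists>(n::nat) y g. (\<forall>i<n. y i \<in> C \<and> g i \<in> N) \<and> f = (\<Sum>i<n. pscale (y i) (g i))"
  using assms
proof induction
  case zero
  then show ?case by (intro exI[of _ 0]) auto
next
  case (step c f h)
  then obtain n :: nat and y g where "\<forall>i<n. y i \<in> C \<and> g i \<in> N" "h = (\<Sum>i<n. pscale (y i) (g i))"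
    by blast
  with step show ?case
    by (intro exI[of _ "Suc n"] exI[of _ "y(n := c)"] exI[of _ "g(n := f)"])
      (auto simp: less_Suc_eq add.commute)
qed

lemma d_0: "is_subring B \<Longrightarrow> single 0 1 \<in> kaehler_relations B A"
proof -
  assume B: "is_subring B"
  have "- (single 0 1 :: 'a \<Rightarrow>\<^sub>0 'a) \<in> kaehler_relations B A"
    using kaehler_relations.sum[of 0 B 0 A] subring_0[OF B] by simp
  from submodule_uminus[OF is_submodule_kaehler B this] show ?thesis by simp
qed

lemma d_1: "is_subring B \<Longrightarrow> single 1 1 \<in> kaehler_relations B A"
proof -
  assume B: "is_subring B"
  have "- (single 1 1 :: 'a \<Rightarrow>\<^sub>0 'a) \<in> kaehler_relations B A"
    using kaehler_relations.leibniz[of 1 B 1 A] subring_1[OF B] by simp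
  from submodule_uminus[OF is_submodule_kaehler B this] show ?thesis by simp
qed

text \<open>Functoriality and transitivity in towers at once: for the old constants it is enough
  that their differentials vanish already.\<close>

lemma kaehler_relations_mono:
  assumes "B \<subseteq> B'" "\<And>a. a \<in> A \<Longrightarrow> single a 1 \<in> kaehler_relations B' A'"
    and "f \<in> kaehler_relations B A"
  shows "f \<in> kaehler_relations B' A'"
  using assms(3)
  by induction (use assms(1,2) in \<open>auto intro: kaehler_relations.intros\<close>)

lemma kaehler_relations_carrier:
  assumes B: "is_subring B" and A: "A \<subseteq> B" and f: "f \<in> kaehler_relations B A"
  shows "keys f \<subseteq> B" "lookup f b \<in> B"
proof -
  have "f \<in> carrier (free_differentials B)"
    using submodule_kaehler_relations[of B A] assms f
    by (auto simp: subring_type_algebra_iff dest!: submodule.axioms(1) subgroup.subset)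
  then show "keys f \<subseteq> B" "lookup f b \<in> B"
    by (auto simp: free_differentials_def)
qed

text \<open>A derivation of \<open>f\<close> uses finitely many ring elements, collected in
  \<open>Y\<close>; the rule \<open>const\<close> asks nothing of the ring, so constants are left
  out. This brings relations over a directed union down to one member.\<close>

lemma kaehler_relations_finitary:
  assumes "f \<in> kaehler_relations B A"
  shows "\<exists>Y\<subseteq>B. finite Y \<and> (\<forall>B'. Y \<subseteq> B' \<longrightarrow> f \<in> kaehler_relations B' A)"
  using assms
proof induction
  case (const a)
  then show ?case by (auto intro!: exI[of _ "{}"] kaehler_relations.const)
next
  case (sum x y)
  then show ?case by (intro exI[of _ "{x,y}"]) (auto intro!: kaehler_relations.sum)
next
  case (leibniz x y)
  then show ?case by (intro exI[of _ "{x,y}"]) (auto intro!: kaehler_relations.leibniz)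
next
  case zero
  then show ?case by (intro exI[of _ "{}"]) (auto intro: kaehler_relations.zero)
next
  case (add f g)
  then obtain Y Z where "Y \<subseteq> B" "finite Y" "\<forall>B'. Y \<subseteq> B' \<longrightarrow> f \<in> kaehler_relations B' A"
    "Z \<subseteq> B" "finite Z" "\<forall>B'. Z \<subseteq> B' \<longrightarrow> g \<in> kaehler_relations B' A" by blast
  then show ?case by (intro exI[of _ "Y \<union> Z"]) (auto intro!: kaehler_relations.add)
next
  case (scale c f)
  then obtain Y where "Y \<subseteq> B" "finite Y" "\<forall>B'. Y \<subseteq> B' \<longrightarrow> f \<in> kaehler_relations B' A" by blast
  with scale show ?case by (intro exI[of _ "insert c Y"]) (auto intro!: kaehler_relations.scale)
qed

text \<open>The classes of the symbols \<open>single x 1\<close> generate the quotient, so its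
  vanishing becomes a statement about \<open>kaehler_relations\<close> alone.\<close>

lemma zero_module_kaehler_iff:
  assumes B: "is_subring B" and A: "A \<subseteq> B"
  shows "zero_module (kaehler B A) \<longleftrightarrow> (\<forall>x\<in>B. single x 1 \<in> kaehler_relations B A)"
proof -
  let ?F = "free_differentials B" and ?N = "kaehler_relations B A"
  have Bs: "subring B ring_of_type_algebra" using B by (simp add: subring_type_algebra_iff)
  interpret M: module "subring_of B" ?F using module_free_differentials[OF Bs] .
  have N: "submodule ?N (subring_of B) ?F" using submodule_kaehler_relations[OF Bs A] .
  interpret N: abelian_subgroup ?N ?F
    using N M.a_comm_group by (auto intro!: abelian_subgroupI2 submodule.axioms)
  have carr: "carrier (kaehler B A) = (\<lambda>x. ?N +>\<^bsub>?F\<^esub> x) ` carrier ?F"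
    by (auto simp: kaehler_def quotient_module_def A_RCOSETS_def RCOSETS_def a_r_coset_def)
  have sub: "?N \<subseteq> carrier ?F" using subgroup.subset[OF submodule.axioms(1)[OF N]] by simp
  have "zero_module (kaehler B A) \<longleftrightarrow> (\<lambda>x. ?N +>\<^bsub>?F\<^esub> x) ` carrier ?F = {?N}"
    unfolding zero_module_def carr by (simp add: kaehler_def quotient_module_def)
  also have "\<dots> \<longleftrightarrow> carrier ?F \<subseteq> ?N"
  proof
    assume *: "(\<lambda>x. ?N +>\<^bsub>?F\<^esub> x) ` carrier ?F = {?N}"
    show "carrier ?F \<subseteq> ?N"
    proof
      fix x assume x: "x \<in> carrier ?F"
      then have "?N +>\<^bsub>?F\<^esub> x = ?N" using * by blast
      then show "x \<in> ?N" using N.a_rcos_self[OF x] by simp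
    qed
  next
    assume *: "carrier ?F \<subseteq> ?N"
    have "?N +>\<^bsub>?F\<^esub> x = ?N" if "x \<in> carrier ?F" for x
      using that * M.a_coset_join2 N.a_subgroup by blast
    then show "(\<lambda>x. ?N +>\<^bsub>?F\<^esub> x) ` carrier ?F = {?N}"
      using M.M.zero_closed by blast
  qed
  also have "\<dots> \<longleftrightarrow> (\<forall>x\<in>B. single x 1 \<in> ?N)"
  proof
    assume *: "carrier ?F \<subseteq> ?N"
    have "single x 1 \<in> carrier ?F" if "x \<in> B" for x
      using that subring_0[OF B] subring_1[OF B]
      by (auto simp: free_differentials_def lookup_single when_def split: if_splits)
    with * show "\<forall>x\<in>B. single x 1 \<in> ?N" by blast
  next
    assume *: "\<forall>x\<in>B. single x 1 \<in> ?N"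
    show "carrier ?F \<subseteq> ?N"
    proof
      fix f assume f: "f \<in> carrier ?F"
      have "lin_ext pscale (\<lambda>b. single b 1) f \<in> ?N"
        unfolding lin_ext_def using f *
        by (intro submodule_sum[OF is_submodule_kaehler] submodule_pscale[OF is_submodule_kaehler])
          (auto simp: free_differentials_def)
      then show "f \<in> ?N" by (simp add: lin_ext_id)
    qed
  qed
  finally show ?thesis .
qed

section \<open>Adjoining one separable element\<close>

text \<open>Congruence modulo \<open>ext_relations\<close> is equality in the extension of scalars \<open>\<Omega>\<^bsub>B|A\<^esub> \<otimes> C\<close>, and
  \<open>poly_d P\<close> is the derivative of the coefficients of \<open>P\<close>, evaluated at \<open>z\<close>.\<close>

locale scalar_extension =
  fixes B A C :: "'a::idom set" and z :: 'a
  assumes B: "is_subring B" and C: "is_subring C" and BC: "B \<subseteq> C" and zC: "z \<in> C"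
begin

definition ext_relations where "ext_relations = module_span C (kaehler_relations B A)"

definition cong (infix "\<approx>" 50) where "f \<approx> g \<longleftrightarrow> f - g \<in> ext_relations"

definition poly_d :: "'a poly \<Rightarrow> ('a \<Rightarrow>\<^sub>0 'a)"
  where "poly_d P = fold_coeffs (\<lambda>a f. single a 1 + pscale z f) P 0"

lemma is_submodule_ext: "is_submodule C ext_relations"
  unfolding ext_relations_def by (rule is_submodule_span[OF C])

lemma relation_in_ext: "f \<in> kaehler_relations B A \<Longrightarrow> f \<in> ext_relations"
  unfolding ext_relations_def by (rule module_span_base[OF C])

lemma cong_refl [simp]: "f \<approx> f"
  by (simp add: cong_def submodule_0[OF is_submodule_ext])

lemma cong_sym: "f \<approx> g \<Longrightarrow> g \<approx> f"
  using submodule_uminus[OF is_submodule_ext C, of "f - g"] by (simp add: cong_def)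

lemma cong_trans [trans]: "f \<approx> g \<Longrightarrow> g \<approx> h \<Longrightarrow> f \<approx> h"
  using submodule_add[OF is_submodule_ext, of "f - g" "g - h"] by (simp add: cong_def)

lemma cong_eq_trans [trans]: "f \<approx> g \<Longrightarrow> g = h \<Longrightarrow> f \<approx> h" "f = g \<Longrightarrow> g \<approx> h \<Longrightarrow> f \<approx> h"
  by auto

lemma cong_add: "f \<approx> g \<Longrightarrow> f' \<approx> g' \<Longrightarrow> f + f' \<approx> g + g'"
  using submodule_add[OF is_submodule_ext, of "f - g" "f' - g'"]
    by (simp add: cong_def algebra_simps)

lemma cong_diff: "f \<approx> g \<Longrightarrow> f' \<approx> g' \<Longrightarrow> f - f' \<approx> g - g'"
  using submodule_diff[OF is_submodule_ext C, of "f - g" "f' - g'"]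
    by (simp add: cong_def algebra_simps)

lemma cong_pscale: "c \<in> C \<Longrightarrow> f \<approx> g \<Longrightarrow> pscale c f \<approx> pscale c g"
  using submodule_pscale[OF is_submodule_ext, of c "f - g"] by (simp add: cong_def pscale_distribs)

lemma d_0_cong: "single 0 1 \<approx> 0"
  using relation_in_ext[OF d_0[OF B]] by (simp add: cong_def)

lemma d_const_cong: "a \<in> A \<Longrightarrow> single a 1 \<approx> 0"
  by (simp add: cong_def relation_in_ext kaehler_relations.const)

lemma d_add_cong: "x \<in> B \<Longrightarrow> y \<in> B \<Longrightarrow>
    single (x + y) 1 \<approx> single x 1 + single y 1"
  using relation_in_ext[OF kaehler_relations.sum[of x B y A]] by (simp add: cong_def algebra_simps)

lemma d_mult_cong: "x \<in> B \<Longrightarrow> y \<in> B \<Longrightarrow>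
    single (x * y) 1 \<approx> single y x + single x y"
  using relation_in_ext[OF kaehler_relations.leibniz[of x B y A]]
    by (simp add: cong_def algebra_simps)

lemma poly_d_0 [simp]: "poly_d 0 = 0"
  by (simp add: poly_d_def)

lemma poly_d_pCons: "poly_d (pCons a P) \<approx> single a 1 + pscale z (poly_d P)"
proof (cases "pCons a P = 0")
  case True
  then show ?thesis using cong_sym[OF d_0_cong] by simp
next
  case False
  then have "poly_d (pCons a P) = single a 1 + pscale z (poly_d P)"
    by (auto simp: poly_d_def fold_coeffs_pCons_coeff_not_0_eq fold_coeffs_pCons_not_0_0_eq)
  then show ?thesis by simp
qed

lemma poly_in_C: "P \<in> polys B \<Longrightarrow> poly P z \<in> C"
  using polys_poly[OF C _ zC] polys_mono[OF BC] by blast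

lemma poly_d_add:
  assumes "P \<in> polys B" "Q \<in> polys B"
  shows "poly_d (P + Q) \<approx> poly_d P + poly_d Q"
  using assms
proof (induction P Q rule: poly_induct2)
  case (pCons a P b Q)
  have "poly_d (pCons a P + pCons b Q) \<approx> single (a + b) 1 + pscale z (poly_d (P + Q))"
    using poly_d_pCons[of "a + b" "P + Q"] by simp
  also have "\<dots> \<approx> (single a 1 + single b 1) + pscale z (poly_d P + poly_d Q)"
    using pCons by (intro cong_add cong_pscale d_add_cong zC) auto
  also have "\<dots> = (single a 1 + pscale z (poly_d P)) + (single b 1 + pscale z (poly_d Q))"
    by (simp add: pscale_distribs)
  also have "\<dots> \<approx> poly_d (pCons a P) + poly_d (pCons b Q)"
    by (intro cong_add cong_sym[OF poly_d_pCons])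
  finally show ?case .
qed auto

lemma poly_d_smult:
  assumes "a \<in> B" "Q \<in> polys B"
  shows "poly_d (smult a Q) \<approx> pscale a (poly_d Q) + single a (poly Q z)"
  using assms(2)
proof (induction Q)
  case (pCons b Q)
  have "poly_d (smult a (pCons b Q)) \<approx>
      single (a * b) 1 + pscale z (poly_d (smult a Q))"
    using poly_d_pCons[of "a * b" "smult a Q"] by simp
  also have "\<dots> \<approx> (single b a + single a b) +
      pscale z (pscale a (poly_d Q) + single a (poly Q z))"
    using pCons assms by (intro cong_add cong_pscale d_mult_cong zC) auto
  also have "\<dots> = pscale a (single b 1 + pscale z (poly_d Q)) +
      single a (poly (pCons b Q) z)"
    by (simp add: pscale_distribs single_add mult.commute)
  also have "\<dots> \<approx> pscale a (poly_d (pCons b Q)) + single a (poly (pCons b Q) z)"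
    using assms BC by (intro cong_add cong_pscale cong_sym[OF poly_d_pCons] cong_refl) auto
  finally show ?case .
qed auto

lemma poly_d_mult:
  assumes "P \<in> polys B" "Q \<in> polys B"
  shows "poly_d (P * Q) \<approx> pscale (poly P z) (poly_d Q) + pscale (poly Q z) (poly_d P)"
  using assms(1)
proof (induction P)
  case (pCons a P)
  note BP = is_subring_polys[OF B]
  have PQ: "pCons 0 (P * Q) \<in> polys B" "smult a Q \<in> polys B"
    using pCons assms B subring_0 by (auto intro: subring_mult[OF BP] polys_smult)
  have "poly_d (pCons a P * Q) = poly_d (smult a Q + pCons 0 (P * Q))"
    by simp
  also have "\<dots> \<approx> poly_d (smult a Q) + poly_d (pCons 0 (P * Q))"
    by (intro poly_d_add PQ)
  also have "\<dots> \<approx> (pscale a (poly_d Q) + single a (poly Q z)) +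
      (single 0 1 + pscale z (poly_d (P * Q)))"
    using pCons assms by (intro cong_add poly_d_smult poly_d_pCons) auto
  also have "\<dots> \<approx> (pscale a (poly_d Q) + single a (poly Q z)) +
      (0 + pscale z (pscale (poly P z) (poly_d Q) + pscale (poly Q z) (poly_d P)))"
    using pCons by (intro cong_add cong_refl cong_pscale d_0_cong zC) auto
  also have "\<dots> = pscale (poly (pCons a P) z) (poly_d Q) +
      pscale (poly Q z) (single a 1 + pscale z (poly_d P))"
    by (simp add: pscale_distribs mult.commute mult.left_commute)
  also have "\<dots> \<approx> pscale (poly (pCons a P) z) (poly_d Q) + pscale (poly Q z) (poly_d (pCons a P))"
    using assms poly_in_C by (intro cong_add cong_refl cong_pscale cong_sym[OF poly_d_pCons]) auto
  finally show ?case .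
qed auto

lemma poly_d_const: "poly_d [:a:] \<approx> single a 1"
  using poly_d_pCons[of a 0] by simp

lemma poly_d_uminus: "P \<in> polys B \<Longrightarrow> poly_d (- P) \<approx> - poly_d P"
  using cong_diff[OF poly_d_add[of "- P" P] cong_refl[of "poly_d P"]]
    subring_uminus[OF is_subring_polys[OF B]] cong_sym
  by simp

lemma poly_d_diff:
  assumes "P \<in> polys B" "Q \<in> polys B"
  shows "poly_d (P - Q) \<approx> poly_d P - poly_d Q"
  using cong_trans[OF poly_d_add[of P "- Q"] cong_add[OF cong_refl poly_d_uminus[of Q]]]
    assms subring_uminus[OF is_subring_polys[OF B]] by simp

text \<open>An arbitrary polynomial representing \<open>b\<close>. Two choices differ by a
  polynomial over \<open>B\<close> vanishing at \<open>z\<close>; the polynomial \<open>P\<close> in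
  \<open>relation_of_adjoin\<close> absorbs this ambiguity.\<close>

definition lift :: "'a \<Rightarrow> 'a poly"
  where "lift b = (SOME q. q \<in> polys B \<and> poly q z = b)"

lemma lift:
  assumes "b \<in> adjoin B z"
  shows "lift b \<in> polys B" "poly (lift b) z = b"
proof -
  have "\<exists>q. q \<in> polys B \<and> poly q z = b" using assms by (auto simp: adjoin_def)
  from someI_ex[OF this] show "lift b \<in> polys B" "poly (lift b) z = b"
    unfolding lift_def by auto
qed

text \<open>\<open>\<Omega>\<^bsub>B[z]|A\<^esub>\<close> is \<open>(\<Omega>\<^bsub>B|A\<^esub> \<otimes> B[z]) \<oplus> B[z] dz\<close> modulo the derivatives of the
  polynomials that vanish at \<open>z\<close>; a relation in \<open>\<Omega>\<^bsub>B[z]|A\<^esub>\<close> is therefore accounted for by one such polynomial.\<close>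

lemma relation_of_adjoin:
  assumes C': "C = adjoin B z" and A: "A \<subseteq> B" and f: "f \<in> kaehler_relations (adjoin B z) A"
  shows "\<exists>P\<in>polys B. poly P z = 0 \<and> lin_ext pscale (\<lambda>b. poly_d (lift b)) f \<approx> poly_d P \<and>
    lin_ext (*) (\<lambda>b. poly (pderiv (lift b)) z) f = poly (pderiv P) z"
  using f
proof induction
  note BP = is_subring_polys[OF B]
  {
    case (const a)
    then have a: "a \<in> B" "a \<in> adjoin B z" using A BC C' by auto
    \<comment> \<open>A constant is represented by \<open>[:a:]\<close>, both of whose components
      vanish; only the deviation of \<open>lift a\<close> from it is left.\<close>
    have P: "lift a - [:a:] \<in> polys B" using lift[OF a(2)] a B by (intro subring_diff BP) auto
    have "poly_d (lift a) = poly_d (lift a) - 0" by simp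
    also have "\<dots> \<approx> poly_d (lift a) - poly_d [:a:]"
      by (intro cong_diff cong_refl cong_sym[OF cong_trans[OF poly_d_const d_const_cong]] const)
    also have "\<dots> \<approx> poly_d (lift a - [:a:])"
      using lift[OF a(2)] a B by (intro cong_sym[OF poly_d_diff]) auto
    finally show ?case using P lift[OF a(2)]
      by (intro bexI[of _ "lift a - [:a:]"]) (auto simp: pderiv_diff pderiv_pCons)
  next
    case (sum x y)
    let ?P = "lift (x + y) - lift x - lift y"
    have xy: "x + y \<in> adjoin B z" using sum is_subring_adjoin[OF B] by (auto intro: subring_add)
    note l = lift[OF xy] lift[OF sum(1)] lift[OF sum(2)]
    have "poly_d ?P \<approx> poly_d (lift (x + y) - lift x) - poly_d (lift y)"
      using l by (intro poly_d_diff subring_diff[OF BP]) auto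
    also have "\<dots> \<approx> (poly_d (lift (x + y)) - poly_d (lift x)) - poly_d (lift y)"
      using l by (intro poly_d_diff cong_diff cong_refl) auto
    finally show ?case using l cong_sym
      by (intro bexI[of _ ?P])
        (auto simp: pderiv_diff pscale_action.lin_ext_diff mult_action.lin_ext_diff
          intro!: subring_diff[OF BP])
  next
    case (leibniz x y)
    let ?P = "lift (x * y) - lift x * lift y"
    have xy: "x * y \<in> adjoin B z" using leibniz is_subring_adjoin[OF B]
      by (auto intro: subring_mult)
    note l = lift[OF xy] lift[OF leibniz(1)] lift[OF leibniz(2)]
    have "poly_d ?P \<approx> poly_d (lift (x * y)) - poly_d (lift x * lift y)"
      using l by (intro poly_d_diff subring_mult[OF BP]) auto
    also have "\<dots> \<approx>
        poly_d (lift (x * y)) - (pscale x (poly_d (lift y)) + pscale y (poly_d (lift x)))"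
      using poly_d_mult[OF l(3,5)] l by (intro cong_diff cong_refl) auto
    finally have "poly_d (lift (x * y)) - pscale x (poly_d (lift y)) - pscale y (poly_d (lift x))
      \<approx> poly_d ?P"
      using cong_sym by (simp add: algebra_simps)
    then show ?case using l
      by (intro bexI[of _ ?P])
        (auto simp: pderiv_diff pderiv_mult pscale_action.lin_ext_diff mult_action.lin_ext_diff
          pscale_action.lin_ext_add mult_action.lin_ext_add algebra_simps
          intro!: subring_diff[OF BP] subring_mult[OF BP])
  next
    case zero
    show ?case by (rule bexI[of _ 0]) (use B in auto)
  next
    case (add f g)
    then obtain P Q where PQ: "P \<in> polys B" "poly P z = 0"
      "lin_ext pscale (\<lambda>b. poly_d (lift b)) f \<approx> poly_d P"
      "lin_ext (*) (\<lambda>b. poly (pderiv (lift b)) z) f = poly (pderiv P) z"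
      "Q \<in> polys B" "poly Q z = 0"
      "lin_ext pscale (\<lambda>b. poly_d (lift b)) g \<approx> poly_d Q"
      "lin_ext (*) (\<lambda>b. poly (pderiv (lift b)) z) g = poly (pderiv Q) z" by blast
    have "lin_ext pscale (\<lambda>b. poly_d (lift b)) (f + g) \<approx> poly_d P + poly_d Q"
      unfolding pscale_action.lin_ext_add by (intro cong_add PQ)
    also have "\<dots> \<approx> poly_d (P + Q)" using PQ by (intro cong_sym[OF poly_d_add])
    finally show ?case using PQ
      by (intro bexI[of _ "P + Q"]) (auto simp: mult_action.lin_ext_add pderiv_add intro:
        subring_add[OF BP])
  next
    case (scale c f)
    then obtain P where P: "P \<in> polys B" "poly P z = 0"
      "lin_ext pscale (\<lambda>b. poly_d (lift b)) f \<approx> poly_d P"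
      "lin_ext (*) (\<lambda>b. poly (pderiv (lift b)) z) f = poly (pderiv P) z" by blast
    note l = lift[OF scale(1)]
    have "lin_ext pscale (\<lambda>b. poly_d (lift b)) (pscale c f) \<approx> pscale c (poly_d P)"
      unfolding pscale_action.lin_ext_pscale using scale(1) C' by (intro cong_pscale P) auto
    also have "\<dots> = pscale (poly (lift c) z) (poly_d P) + pscale (poly P z) (poly_d (lift c))"
      using P l by simp
    also have "\<dots> \<approx> poly_d (lift c * P)" using P l by (intro cong_sym[OF poly_d_mult])
    finally show ?case using P l
      by (intro bexI[of _ "lift c * P"])
        (auto simp: mult_action.lin_ext_pscale pderiv_mult intro: subring_mult[OF BP])
  }
qed

text \<open>For \<open>x\<close> in \<open>B\<close> the constant polynomial is a representative
  without dz-component. Correcting \<open>P\<close> by \<open>lift x - [:x:]\<close>, which vanishes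
  at \<open>z\<close>, turns the first component into dx and the derivative at \<open>z\<close> into
  0.\<close>

lemma d_of_base_element:
  assumes C': "C = adjoin B z" and A: "A \<subseteq> B" and x: "x \<in> B"
    and f: "single x 1 \<in> kaehler_relations (adjoin B z) A"
  shows "\<exists>P\<in>polys B. poly P z = 0 \<and> poly (pderiv P) z = 0 \<and> single x 1 \<approx> poly_d P"
proof -
  note BP = is_subring_polys[OF B]
  obtain P where P: "P \<in> polys B" "poly P z = 0" "poly_d (lift x) \<approx> poly_d P"
      "poly (pderiv (lift x)) z = poly (pderiv P) z"
    using relation_of_adjoin[OF C' A f] by auto
  have "x \<in> adjoin B z" using x BC C' by auto
  note l = lift[OF this]
  let ?P = "P - (lift x - [:x:])"
  have xB: "lift x - [:x:] \<in> polys B" using l x B by (auto intro: subring_diff[OF BP])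
  have "poly_d ?P \<approx> poly_d P - poly_d (lift x - [:x:])"
    using P xB by (intro poly_d_diff) auto
  also have "\<dots> \<approx> poly_d (lift x) - (poly_d (lift x) - single x 1)"
    using P l x B
    by (intro cong_diff cong_sym[OF P(3)] cong_trans[OF poly_d_diff cong_diff[OF _ poly_d_const]]
      cong_refl) auto
  finally have "single x 1 \<approx> poly_d ?P" using cong_sym by simp
  then show ?thesis using P xB l
    by (intro bexI[of _ ?P]) (auto simp: pderiv_diff pderiv_pCons intro: subring_diff[OF BP])
qed

end

context valuation_subring
begin

text \<open>This is flatness of torsion-free modules over \<open>V \<inter> L\<close>: a linear relation between \<open>1\<close> and the
  coefficients \<open>y\<close>, divided by its largest coefficient, eliminates one of the \<open>y\<close>.  It is never \<open>1\<close>
  that would have to be eliminated, as \<open>1\<close> is not in the maximal ideal.\<close>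

lemma flat_descent:
  fixes f :: "nat \<Rightarrow> ('b \<Rightarrow>\<^sub>0 'a)"
  assumes L: "is_subfield L"
    and N: "is_submodule (V \<inter> L) N" "\<And>h b. h \<in> N \<Longrightarrow> lookup h b \<in> L"
    and "finite I" "\<And>i. i \<in> I \<Longrightarrow> y i \<in> V" "\<And>i. i \<in> I \<Longrightarrow> f i \<in> N" "g \<in> N"
    and "\<And>b. lookup F b \<in> L"
    and "F = g + (\<Sum>i\<in>I. pscale (y i) (f i))"
  shows "F \<in> N"
  using assms(4-7,9)
proof (induction "card I" arbitrary: I f g rule: less_induct)
  case less
  note LR = subfield_subring[OF L]
  note O = is_subring_Int[OF V_subring LR]
  show ?case
  proof (cases "\<exists>k0\<in>L. \<exists>k. (\<forall>i\<in>I. k i \<in> L) \<and> k0 + (\<Sum>i\<in>I. k i * y i) = 0 \<and> (\<exists>i\<in>I. k i \<noteq> 0)")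
    case False
    \<comment> \<open>Without a linear relation over \<open>L\<close>, comparing coefficients at
      each symbol forces all the \<open>f i\<close> to vanish.\<close>
    have "f i = 0" if i: "i \<in> I" for i
    proof (rule poly_mapping_eqI)
      fix b
      let ?kz = "lookup g b - lookup F b"
      let ?k = "\<lambda>i. lookup (f i) b"
      have "?kz \<in> L" using less.prems N assms(8) by (intro subring_diff[OF LR]) auto
      moreover have "\<forall>i\<in>I. ?k i \<in> L" using less.prems N by auto
      moreover have "?kz + (\<Sum>i\<in>I. ?k i * y i) = 0"
        using less.prems(5) by (simp add: lookup_add lookup_sum mult.commute)
      ultimately show "?k i = lookup 0 b" using False i by force
    qed
    then show ?thesis using less.prems by simp
  next
    case True
    then obtain k0 k where k: "k0 \<in> L" "\<forall>i\<in>I. k i \<in> L" "k0 + (\<Sum>i\<in>I. k i * y i) = 0" "\<exists>i\<in>I. k i \<noteq> 0"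
      by blast
    then obtain m where m: "m \<in> I" "\<forall>i\<in>I. vle (k m) (k i)"
      using vle_min[of I k] less.prems(1) by blast
    have km: "k m \<noteq> 0" using k(4) m(2) by auto
    \<comment> \<open>Otherwise every \<open>k i / k0\<close> lies in the maximal ideal, and the
      relation divided by \<open>k0\<close> puts - 1 there.\<close>
    have "vle (k m) k0"
    proof (rule ccontr)
      assume n: "\<not> vle (k m) k0"
      then have k00: "k0 \<noteq> 0" by auto
      have "k i / k0 * y i \<in> maximal_ideal" if i: "i \<in> I" for i
      proof -
        have "\<not> vle (k i) k0" using n m(2) i vle_trans by blast
        then have "k i / k0 \<in> maximal_ideal"
          using vle_total[of "k i" k0] k00 
          by (auto simp: maximal_ideal_def vle_iff_divide V_0)
        then show ?thesis using maximal_ideal_mult[of "y i" "k i / k0"] less.prems(2)[OF i]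
          by (simp add: mult.commute)
      qed
      then have "(\<Sum>i\<in>I. k i / k0 * y i) \<in> maximal_ideal" by (rule maximal_ideal_sum)
      moreover have "(\<Sum>i\<in>I. k i / k0 * y i) = - 1"
        using k(3) k00 by (simp add: sum_divide_distrib[symmetric] eq_neg_iff_add_eq_0 field_simps)
      ultimately have "- (1::'a) * - 1 \<in> maximal_ideal"
        using V_1 V_uminus by (intro maximal_ideal_mult) auto
      then show False using one_notin_maximal_ideal by simp
    qed
    define c where "c i = k i / k m" for i
    define c0 where "c0 = k0 / k m"
    have c0: "c0 \<in> V \<inter> L" using \<open>vle (k m) k0\<close> km k m L
      by (auto simp: c0_def vle_iff_divide intro: subfield_divide)
    have c: "c i \<in> V \<inter> L" if "i \<in> I" for i
      using km k m L that by (auto simp: c_def vle_iff_divide intro: subfield_divide)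
    have "c0 + (\<Sum>i\<in>I. c i * y i) = 0"
      using k(3) km by (simp add: c_def c0_def sum_divide_distrib[symmetric]
        add_divide_distrib[symmetric])
    moreover have "(\<Sum>i\<in>I. c i * y i) = y m + (\<Sum>i\<in>I-{m}. c i * y i)"
      using m less.prems(1) km by (simp add: sum.remove c_def)
    ultimately have ym: "y m = - c0 - (\<Sum>i\<in>I-{m}. y i * c i)"
      by (simp add: algebra_simps eq_neg_iff_add_eq_0)
    have "F = g + (pscale (y m) (f m) + (\<Sum>i\<in>I-{m}. pscale (y i) (f i)))"
      using less.prems m by (simp add: sum.remove)
    also have "pscale (y m) (f m) = - pscale c0 (f m) - (\<Sum>i\<in>I-{m}. pscale (y i * c i) (f m))"
      unfolding ym by (simp add: pscale_distribs pscale_action.act_sum_left)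
    finally have F: "F = (g - pscale c0 (f m)) + (\<Sum>i\<in>I-{m}. pscale (y i) (f i - pscale (c i) (f
      m)))"
      by (simp add: pscale_distribs sum_subtractf)
    show ?thesis
    proof (rule less.hyps[OF _ _ _ _ _ F])
      show "card (I - {m}) < card I" using m less.prems(1) by (rule_tac card_Diff1_less)
      show "f i - pscale (c i) (f m) \<in> N" if "i \<in> I - {m}" for i
        using that less.prems(3) m c by (intro submodule_diff[OF N(1) O] submodule_pscale[OF N(1)])
          auto
      show "g - pscale c0 (f m) \<in> N"
        using less.prems(3,4) m c0 by (intro submodule_diff[OF N(1) O] submodule_pscale[OF N(1)])
          auto
    qed (use less.prems in auto)
  qed
qed

text \<open>Gauss' lemma makes the differential of the polynomial from
  \<open>d_of_base_element\<close> vanish, so dx is zero after extending scalars to the ring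
  generated by \<open>z\<close>. That ring is torsion-free over \<open>V \<inter> L\<close>, and
  \<open>flat_descent\<close> removes the scalars.\<close>

lemma simple_extension_injective:
  assumes L: "is_subfield L" and z: "z \<in> V" "minpoly L z p" "poly (pderiv p) z \<noteq> 0"
    and A: "A \<subseteq> V \<inter> L" and x: "x \<in> V \<inter> L"
    and d: "single x 1 \<in> kaehler_relations (adjoin (V \<inter> L) z) A"
  shows "single x 1 \<in> kaehler_relations (V \<inter> L) A"
proof -
  let ?O = "V \<inter> L"
  note LR = subfield_subring[OF L]
  note O = is_subring_Int[OF V_subring LR]
  interpret E: scalar_extension ?O A "adjoin ?O z" z
    by unfold_locales (auto simp: O subset_adjoin[OF O] gen_in_adjoin[OF O] is_subring_adjoin[OF O])
  obtain P where P: "P \<in> polys ?O" "poly P z = 0" "poly (pderiv P) z = 0"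
      "E.cong (single x 1) (E.poly_d P)"
    using E.d_of_base_element[OF refl A x d] by blast
  have p: "p \<in> polys L" "p \<noteq> 0" "poly p z = 0" using z(2) by (auto simp: minpoly_def)
  have PL: "P \<in> polys L" using P(1) polys_mono[of ?O L] by auto
  obtain s where s: "s \<in> polys L" "P = s * p" using minpoly_dvd[OF L z(2) PL P(2)] .
  obtain c i where c: "c \<in> L" "c \<noteq> 0" "smult (inverse c) p \<in> polys ?O"
      "coeff (smult (inverse c) p) i = 1"
    using primitive_multiple[OF L p(1,2)] .
  define g where "g = smult (inverse c) p"
  define t where "t = smult c s"
  have Pgt: "P = g * t" using c s by (simp add: g_def t_def)
  have "t \<in> polys V"
    by (rule gauss_lemma[of g i]) (use c P polys_mono[of ?O V] in
      \<open>auto simp: g_def[symmetric] Pgt[symmetric]\<close>)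
  moreover have "t \<in> polys L" using s c LR by (simp add: t_def polys_smult)
  ultimately have t: "t \<in> polys ?O" by (auto simp: polys_def)
  have g: "g \<in> polys ?O" using c by (simp add: g_def)
  have gz: "poly g z = 0" using p by (simp add: g_def)
  \<comment> \<open>Since g(z) = 0, the product rule gives P'(z) = g'(z) t(z), and \<open>z\<close>
    is a simple root of \<open>g\<close>; hence t(z) = 0, and both terms of the product rule for dP
    vanish.\<close>
  have "poly (pderiv g) z \<noteq> 0" using z(3) c by (simp add: g_def pderiv_smult)
  then have tz: "poly t z = 0" using P(3) gz by (simp add: Pgt pderiv_mult)
  have "E.cong (E.poly_d P) 0" using E.poly_d_mult[OF g t] gz tz by (simp add: Pgt)
  with P(4) have "E.cong (single x 1) 0" by (rule E.cong_trans)
  then have "single x 1 \<in> module_span (adjoin ?O z) (kaehler_relations ?O A)"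
    by (simp add: E.cong_def E.ext_relations_def)
  from module_span_sum[OF this] obtain n :: nat and y h where
    yh: "\<forall>i<n. y i \<in> adjoin ?O z \<and> h i \<in> kaehler_relations ?O A"
      "single x 1 = (\<Sum>i<n. pscale (y i) (h i))" by blast
  have "adjoin ?O z \<subseteq> V" using z(1) by (intro adjoin_subset V_subring) auto
  with yh(1) have yV: "\<And>i. i \<in> {..<n} \<Longrightarrow> y i \<in> V" by auto
  show ?thesis
  proof (rule flat_descent[OF L is_submodule_kaehler])
    show "single x 1 = 0 + (\<Sum>i<n. pscale (y i) (h i))" using yh(2) by simp
    show "lookup f b \<in> L" if "f \<in> kaehler_relations ?O A" for f b
      using kaehler_relations_carrier(2)[OF O A that] by simp
    show "lookup (single x 1) b \<in> L" for b
      by (simp add: lookup_single when_def subring_0[OF LR] subring_1[OF LR])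
  qed (use yV yh(1) in \<open>auto intro: kaehler_relations.zero\<close>)
qed

end

section \<open>Approximating a valuation ring by simple extensions\<close>

context valuation_subring
begin

section \<open>Values of sums, and values lying in a subfield\<close>

definition veq :: "'a \<Rightarrow> 'a \<Rightarrow> bool"
  where "veq x y \<longleftrightarrow> vle x y \<and> vle y x"

definition has_value_in :: "'a set \<Rightarrow> 'a \<Rightarrow> bool"
  where "has_value_in L u \<longleftrightarrow> u \<noteq> 0 \<and> (\<exists>l\<in>L. veq u l)"

lemma veq_refl [simp]: "veq x x" by (simp add: veq_def)
lemma veq_sym: "veq x y \<Longrightarrow> veq y x" by (simp add: veq_def)
lemma veq_trans: "veq x y \<Longrightarrow> veq y z \<Longrightarrow> veq x z" unfolding veq_def using vle_trans by blast
lemma veq_mult: "veq x y \<Longrightarrow> veq x' y' \<Longrightarrow> veq (x * x') (y * y')"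
  by (auto simp: veq_def intro: vle_mult)
lemma veq_power: "veq x y \<Longrightarrow> veq (x ^ n) (y ^ n)" by (auto simp: veq_def intro: vle_power)
lemma veq_0_iff [simp]: "veq 0 x \<longleftrightarrow> x = 0" "veq x 0 \<longleftrightarrow> x = 0" by (auto simp: veq_def)

lemma vle_inverse: "x \<noteq> 0 \<Longrightarrow> y \<noteq> 0 \<Longrightarrow> vle x y \<Longrightarrow> vle (inverse y) (inverse x)"
  by (simp add: vle_iff_divide field_simps)

lemma veq_inverse: "veq x y \<Longrightarrow> veq (inverse x) (inverse y)"
  by (cases "x = 0 \<or> y = 0") (auto simp: veq_def intro: vle_inverse)

lemma not_vle_iff: "x \<noteq> 0 \<Longrightarrow> \<not> vle y x \<longleftrightarrow> y / x \<in> maximal_ideal"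
  using vle_total[of x y]
  by (cases "y = 0") (auto simp: maximal_ideal_def vle_iff_divide V_0)

lemma unit_veq: "x \<noteq> 0 \<Longrightarrow> y / x \<in> V - maximal_ideal \<Longrightarrow> veq x y"
  using not_vle_iff[of x y] by (auto simp: veq_def vle_iff_divide)

lemma one_plus_maximal_ideal: "m \<in> maximal_ideal \<Longrightarrow> 1 + m \<in> V - maximal_ideal"
proof -
  assume m: "m \<in> maximal_ideal"
  then have "m \<in> V" by (simp add: maximal_ideal_def)
  moreover have "1 + m \<notin> maximal_ideal"
  proof
    assume "1 + m \<in> maximal_ideal"
    moreover have "(- 1) * m \<in> maximal_ideal"
      using m V_1 V_uminus by (intro maximal_ideal_mult) auto
    ultimately have "(1 + m) + (- 1) * m \<in> maximal_ideal" by (rule maximal_ideal_add)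
    then show False using one_notin_maximal_ideal by simp
  qed
  ultimately show ?thesis using V_add V_1 by auto
qed

lemma veq_add_small: "x \<noteq> 0 \<Longrightarrow> \<not> vle y x \<Longrightarrow> veq x (x + y)"
  using one_plus_maximal_ideal[of "y / x"]
  by (intro unit_veq) (auto simp: not_vle_iff add_divide_distrib)

text \<open>Relative to a nonzero term of least value all other terms lie in the maximal ideal, so
  the sum has that least value.\<close>

lemma distinct_values_sum:
  assumes I: "finite I" "i \<in> I"
    and d: "\<And>i j. i \<in> I \<Longrightarrow> j \<in> I \<Longrightarrow> i \<noteq> j \<Longrightarrow> t i \<noteq> 0 \<Longrightarrow> t j \<noteq> 0 \<Longrightarrow> \<not> veq (t i) (t j)"
  shows "vle (sum t I) (t i)"
proof -
  obtain m where m: "m \<in> I" "\<And>j. j \<in> I \<Longrightarrow> vle (t m) (t j)"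
    using vle_min[of I t] I by blast
  show ?thesis
  proof (cases "t m = 0")
    case True then show ?thesis using m I by simp
  next
    case False
    have "t j / t m \<in> maximal_ideal" if "j \<in> I - {m}" for j
      using that d[of m j] m False
      by (cases "t j = 0") (auto simp: veq_def not_vle_iff[symmetric] maximal_ideal_0)
    then have "(\<Sum>j\<in>I-{m}. t j / t m) \<in> maximal_ideal" by (rule maximal_ideal_sum)
    then have "\<not> vle (\<Sum>j\<in>I-{m}. t j) (t m)"
      using False by (simp add: not_vle_iff sum_divide_distrib)
    from veq_add_small[OF False this] have "vle (sum t I) (t m)"
      using m I by (simp add: veq_def sum.remove)
    then show ?thesis using m I vle_trans by blast
  qed
qed

lemma has_value_in_mult:
  "is_subfield L \<Longrightarrow> has_value_in L x \<Longrightarrow> has_value_in L y \<Longrightarrow> has_value_in L (x * y)"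
  unfolding has_value_in_def using veq_mult subfield_subring subring_mult by (metis mult_eq_0_iff)

lemma has_value_in_inverse: "is_subfield L \<Longrightarrow> has_value_in L x \<Longrightarrow> has_value_in L (inverse x)"
  unfolding has_value_in_def using veq_inverse subfield_inverse
    by (metis inverse_nonzero_iff_nonzero)

lemma has_value_in_self: "x \<in> L \<Longrightarrow> x \<noteq> 0 \<Longrightarrow> has_value_in L x"
  unfolding has_value_in_def using veq_refl by blast

lemma has_value_in_power: "is_subfield L \<Longrightarrow> has_value_in L x \<Longrightarrow> has_value_in L (x ^ n)"
  unfolding has_value_in_def
  using veq_power subring_power[OF subfield_subring] by (metis power_not_zero)

lemma has_value_in_veq: "veq x y \<Longrightarrow> has_value_in L x \<Longrightarrow> has_value_in L y"
  unfolding has_value_in_def using veq_sym veq_trans veq_0_iff by metis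

lemma has_value_in_cancel:
  assumes L: "is_subfield L" and "has_value_in L x" "has_value_in L (x * y)"
  shows "has_value_in L y"
  using has_value_in_mult[OF L has_value_in_inverse[OF L assms(2)] assms(3)] assms(2)
  by (simp add: has_value_in_def field_simps)

text \<open>Two nonzero terms of equal value with indices i < j would give
  \<open>u ^ (j - i)\<close> a value in \<open>L\<close>.\<close>

lemma distinct_powers_sum:
  assumes L: "is_subfield L" and p: "p \<in> polys L" and u: "u \<noteq> 0" and I: "finite I" "k \<in> I"
    and d: "\<And>i j. i \<in> I \<Longrightarrow> j \<in> I \<Longrightarrow> i < j \<Longrightarrow> \<not> has_value_in L (u ^ (j - i))"
  shows "vle (\<Sum>i\<in>I. coeff p i * u ^ i) (coeff p k * u ^ k)"
proof (rule distinct_values_sum[OF I])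
  let ?t = "\<lambda>i. coeff p i * u ^ i"
  have *: "\<not> veq (?t i) (?t j)"
    if ij: "i \<in> I" "j \<in> I" "i < j" and nz: "?t i \<noteq> 0" "?t j \<noteq> 0" for i j
  proof
    assume "veq (?t i) (?t j)"
    moreover have "?t j = coeff p j * u ^ (j - i) * u ^ i" using ij by (simp flip: power_add)
    ultimately have "veq (coeff p i) (coeff p j * u ^ (j - i))" using u by (simp add: veq_def)
    then have "has_value_in L (coeff p j * u ^ (j - i))"
      using has_value_in_veq has_value_in_self[OF coeff_in_polys[OF p]] nz by auto
    then have "has_value_in L (u ^ (j - i))"
      using has_value_in_cancel[OF L has_value_in_self[OF coeff_in_polys[OF p]]] nz by auto
    then show False using d ij by blast
  qed
  show "\<not> veq (?t i) (?t j)" if "i \<in> I" "j \<in> I" "i \<noteq> j" "?t i \<noteq> 0" "?t j \<noteq> 0" for i j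
    using *[of i j] *[of j i] that veq_sym by (metis linorder_neqE_nat)
qed

text \<open>Otherwise the powers of \<open>u\<close> have distinct values modulo \<open>L\<close>,
  and the value of p(u) = 0 would be at most that of the nonzero leading term.\<close>

lemma algebraic_power_has_value_in:
  assumes L: "is_subfield L" and p: "p \<in> polys L" "p \<noteq> 0" "poly p u = 0" and u: "u \<noteq> 0"
  shows "\<exists>n>0. has_value_in L (u ^ n)"
proof (rule ccontr)
  assume "\<not> ?thesis"
  then have "\<not> has_value_in L (u ^ n)" if "0 < n" for n using that by blast
  then have "vle (\<Sum>i\<le>degree p. coeff p i * u ^ i) (coeff p (degree p) * u ^ degree p)"
    by (intro distinct_powers_sum[OF L p(1) u]) simp_all
  then show False using p u by (simp add: poly_altdef)
qed

end

locale separably_closed_extension = valuation_subring +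
  fixes L :: "'a set"
  assumes L: "is_subfield L"
    and sep_closed: "\<And>p :: 'a poly. degree p > 0 \<Longrightarrow> separable_poly p \<Longrightarrow> \<exists>x. poly p x = 0"
    and sep_alg: "\<And>z. \<exists>p. minpoly L z p \<and> poly (pderiv p) z \<noteq> 0"
begin

lemmas LR = subfield_subring[OF L]
lemmas O = is_subring_Int[OF V_subring LR]

subsection \<open>Enlarging the value group\<close>

text \<open>If \<open>m\<close> is the order of the value of \<open>u\<close> modulo the values of
  \<open>L\<close>, then \<open>u ^ (m div q)\<close> has prime order \<open>q\<close>. The Bezout
  relation a k = b q + 1 excludes exponents prime to \<open>q\<close>.\<close>

lemma prime_order_value:
  assumes "u \<noteq> 0" "\<not> has_value_in L u"
  obtains q x where "prime (q::nat)" "x \<noteq> 0" "has_value_in L (x ^ q)"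
    "\<And>k. \<not> q dvd k \<Longrightarrow> \<not> has_value_in L (x ^ k)"
proof -
  obtain p where "minpoly L u p" using sep_alg by blast
  then obtain n where n: "n > 0" "has_value_in L (u ^ n)"
    using algebraic_power_has_value_in[OF L, of p u] assms by (auto simp: minpoly_def)
  define m where "m = (LEAST n. n > 0 \<and> has_value_in L (u ^ n))"
  have m: "m > 0" "has_value_in L (u ^ m)"
    using LeastI[of "\<lambda>n. n > 0 \<and> has_value_in L (u ^ n)" n] n unfolding m_def by auto
  have mleast: "\<not> has_value_in L (u ^ k)" if "0 < k" "k < m" for k
    using not_less_Least[of k "\<lambda>n. n > 0 \<and> has_value_in L (u ^ n)"] that unfolding m_def by auto
  have "m \<noteq> 1" using m assms by auto
  then obtain q where q: "prime q" "q dvd m" using prime_factor_nat by blast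
  define x where "x = u ^ (m div q)"
  have xq: "has_value_in L (x ^ q)" using m q by (simp add: x_def flip: power_mult)
  have x: "\<not> has_value_in L x" unfolding x_def
    using q m prime_gt_1_nat[OF q(1)]
    by (intro mleast) (auto simp: dvd_div_eq_0_iff intro!: div_less_dividend)
  have "\<not> has_value_in L (x ^ k)" if k: "\<not> q dvd k" for k
  proof
    assume *: "has_value_in L (x ^ k)"
    have k0: "k \<noteq> 0" using k by (metis dvd_0_right)
    have "coprime k q" using q k by (metis coprime_commute prime_imp_coprime)
    then obtain a b where ab: "a * k = b * q + 1"
      using bezout_nat[OF k0, of q] by (auto simp: mult.commute)
    have "has_value_in L ((x ^ k) ^ a)" by (intro has_value_in_power L *)
    also have "(x ^ k) ^ a = x ^ (b * q + 1)" by (metis ab mult.commute power_mult)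
    also have "\<dots> = (x ^ q) ^ b * x"
      by (metis mult.commute power_add power_mult power_one_right)
    finally have "has_value_in L x" using has_value_in_cancel[OF L has_value_in_power[OF L xq]]
      by blast
    with x show False by contradiction
  qed
  moreover have "x \<noteq> 0" using assms by (simp add: x_def)
  ultimately show ?thesis using that q(1) xq by blast
qed

text \<open>Among the \<open>q - 1\<close> nonzero classes of values modulo \<open>L\<close>, one has positive elements coinitial in
  those of all the others.  A generator \<open>z\<close> of the extension with value in this class makes the
  rings \<open>(V \<inter> L)[z/c]\<close> exhaust the valuation ring of \<open>L(z)\<close>.\<close>

lemma minimal_value_class:
  assumes q: "prime (q::nat)" and x: "x \<noteq> 0" "has_value_in L (x ^ q)"
    "\<And>k. \<not> q dvd k \<Longrightarrow> \<not> has_value_in L (x ^ k)"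
  obtains u where "u \<noteq> 0" "has_value_in L (u ^ q)" "\<And>k. \<not> q dvd k \<Longrightarrow> \<not> has_value_in L (u ^ k)"
    "\<And>h k. h \<in> L \<Longrightarrow> h \<noteq> 0 \<Longrightarrow> \<not> q dvd k \<Longrightarrow> h * u ^ k \<in> V \<Longrightarrow>
      \<exists>c\<in>L. c \<noteq> 0 \<and> u / c \<in> V \<and> vle (u / c) (h * u ^ k)"
proof -
  \<comment> \<open>The nonnegative values in the class of \<open>x ^ k\<close>. Of two such sets
    one always has, below each element of the other, an element of its own; so \<open>R\<close> is
    total and a best class exists.\<close>
  define S where "S k = {s \<in> V. s \<noteq> 0 \<and> (\<exists>l\<in>L. veq s (l * x ^ k))}" for k
  define R where "R k k' \<longleftrightarrow> (\<forall>s'\<in>S k'. \<exists>s\<in>S k. vle s s')" for k k'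
  have "R k k' \<or> R k' k" for k k' unfolding R_def using vle_total by blast
  moreover have "R i k" if "R i j" "R j k" for i j k using that unfolding R_def using vle_trans
    by meson
  ultimately have "\<exists>i\<in>{1..<q}. \<forall>j\<in>{1..<q}. R i j"
    using prime_gt_1_nat[OF q] by (intro total_preorder_least) auto
  then obtain \<kappa> where \<kappa>: "\<kappa> \<in> {1..<q}" "\<And>j. j \<in> {1..<q} \<Longrightarrow> R \<kappa> j" by blast
  have \<kappa>q: "\<not> q dvd \<kappa>" using \<kappa>(1) by (auto dest: nat_dvd_not_less)
  define u where "u = x ^ \<kappa>"
  have u0: "u \<noteq> 0" using x by (simp add: u_def)
  have "has_value_in L ((x ^ q) ^ \<kappa>)" by (intro has_value_in_power L x)
  then have uq: "has_value_in L (u ^ q)" by (simp add: u_def mult.commute flip: power_mult)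
  have "\<exists>c\<in>L. c \<noteq> 0 \<and> u / c \<in> V \<and> vle (u / c) (h * u ^ k)"
    if h: "h \<in> L" "h \<noteq> 0" and k: "\<not> q dvd k" and hV: "h * u ^ k \<in> V" for h k
  proof -
    \<comment> \<open>As \<open>x ^ q\<close> has a value in \<open>L\<close>, only exponents modulo
      \<open>q\<close> matter; \<open>k'\<close> is nonzero because the prime \<open>q\<close>
      divides neither factor.\<close>
    define k' where "k' = \<kappa> * k mod q"
    have k': "k' \<in> {1..<q}"
      using \<kappa>q k q prime_gt_0_nat[OF q] by (auto simp: k'_def dvd_eq_mod_eq_0 prime_dvd_mult_iff
        Suc_le_eq)
        (metis dvd_eq_mod_eq_0 gr0I prime_dvd_mult_iff)
    have "u ^ k = x ^ (\<kappa> * k)" by (simp add: u_def power_mult)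
    also have "\<kappa> * k = k' + q * (\<kappa> * k div q)" by (simp add: k'_def)
    finally have uk: "u ^ k = x ^ k' * (x ^ q) ^ (\<kappa> * k div q)" by (simp add: power_add power_mult)
    obtain l where l: "l \<in> L" "veq ((x ^ q) ^ (\<kappa> * k div q)) l"
      using has_value_in_power[OF L x(2)] by (auto simp: has_value_in_def)
    have "veq (h * x ^ k' * (x ^ q) ^ (\<kappa> * k div q)) (h * x ^ k' * l)" by (intro veq_mult l) auto
    then have "veq (h * u ^ k) (h * l * x ^ k')" by (simp add: uk mult_ac)
    then have "h * u ^ k \<in> S k'"
      using hV h u0 l subring_mult[OF LR] by (auto simp: S_def)
    then obtain s where "s \<in> S \<kappa>" and sle: "vle s (h * u ^ k)"
      using \<kappa>(2)[OF k'] unfolding R_def by blast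
    then obtain l' where s: "s \<in> V" "s \<noteq> 0" and l': "l' \<in> L" "veq s (l' * u)"
      by (auto simp: S_def u_def)
    have l'0: "l' \<noteq> 0" using s l' by auto
    have "vle s (l' * u)" "vle (l' * u) s" using l' by (auto simp: veq_def)
    then have "l' * u \<in> V" "vle (l' * u) (h * u ^ k)" using s sle in_V_vle vle_trans by blast+
    then show ?thesis using l' l'0 subfield_inverse[OF L]
      by (intro bexI[of _ "inverse l'"]) (auto simp: divide_inverse mult.commute)
  qed
  moreover have "\<not> has_value_in L (u ^ k)" if "\<not> q dvd k" for k
    unfolding u_def power_mult[symmetric] using that \<kappa>q q
      by (intro x) (auto simp: prime_dvd_mult_iff)
  ultimately show ?thesis using that u0 uq by blast
qed

text \<open>Writing h u^k = (h c^k) (u/c)^k, the aim is a scaling \<open>c\<close> that makes both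
  factors integral. Induction finds \<open>c\<close> with (u/c)^(t+1) below h u^k. If s = u/c is not
  below the remaining quotient s', then s' = h c^(t+1) u^(k-t-1) is again a monomial with exponent
  prime to \<open>q\<close>, and minimality supplies u/c' below both s and s'.\<close>

lemma minimal_value_class_power:
  assumes u: "u \<noteq> 0"
    and min: "\<And>h k. h \<in> L \<Longrightarrow> h \<noteq> 0 \<Longrightarrow> \<not> q dvd k \<Longrightarrow> h * u ^ k \<in> V \<Longrightarrow>
      \<exists>c\<in>L. c \<noteq> 0 \<and> u / c \<in> V \<and> vle (u / c) (h * u ^ k)"
    and k: "0 < k" "k < q" and h: "h \<in> L" "h \<noteq> 0" "h * u ^ k \<in> V"
  shows "\<exists>c\<in>L. c \<noteq> 0 \<and> u / c \<in> V \<and> h * c ^ k \<in> V"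
proof -
  have "\<exists>c\<in>L. c \<noteq> 0 \<and> u / c \<in> V \<and> vle ((u / c) ^ Suc t) (h * u ^ k)" if "t < k" for t
    using that
  proof (induction t)
    case 0
    then show ?case using min[of h k] h k nat_dvd_not_less[of k q] by auto
  next
    case (Suc t)
    then obtain c where c: "c \<in> L" "c \<noteq> 0" "u / c \<in> V" "vle ((u / c) ^ Suc t) (h * u ^ k)" by auto
    define s where "s = u / c"
    have s0: "s \<noteq> 0" using c u by (simp add: s_def)
    define s' where "s' = h * u ^ k / s ^ Suc t"
    have s'V: "s' \<in> V" using c(4) s0 unfolding s_def[symmetric] s'_def by (simp add: vle_iff_divide)
    have hs: "h * u ^ k = s ^ Suc t * s'" using s0 by (simp add: s'_def)
    show ?case
    proof (cases "vle s s'")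
      case True
      have "vle (s ^ Suc t * s) (s ^ Suc t * s')" by (intro vle_mult True vle_refl)
      then have "vle (s ^ Suc (Suc t)) (h * u ^ k)" by (simp add: hs mult_ac)
      then show ?thesis using c by (auto simp: s_def)
    next
      case False
      have "u ^ k = u ^ (k - Suc t) * u ^ Suc t"
        unfolding power_add[symmetric] using Suc.prems by simp
      then have s': "s' = (h * c ^ Suc t) * u ^ (k - Suc t)"
        using u c by (simp add: s'_def s_def power_divide)
      have "h * c ^ Suc t \<in> L" using h c by (intro subring_mult[OF LR] subring_power[OF LR]) auto
      then obtain c' where c': "c' \<in> L" "c' \<noteq> 0" "u / c' \<in> V" "vle (u / c') s'"
        using min[of "h * c ^ Suc t" "k - Suc t"] s' s'V h c k Suc.prems
          nat_dvd_not_less[of "k - Suc t" q] by auto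
      have "vle (u / c') s" using c'(4) False vle_total vle_trans by blast
      then have "vle ((u / c') ^ Suc t * (u / c')) (s ^ Suc t * s')"
        using c' by (intro vle_mult vle_power)
      then show ?thesis using c' by (intro bexI[of _ c'])
        (simp_all add: hs mult.commute mult.left_commute)
    qed
  qed
  from this[of "k - 1"] k obtain c where c: "c \<in> L" "c \<noteq> 0" "u / c \<in> V"
    "vle ((u / c) ^ k) (h * u ^ k)"
    by auto
  have "h * c ^ k \<in> V" using c(4) c(2) u by (simp add: vle_iff_divide power_divide field_simps)
  then show ?thesis using c by blast
qed

text \<open>The root belongs to X^q + e X - b with v(b) = q v(u). If \<open>q\<close> is zero in the
  field, X^q - b is inseparable, and a linear term is added whose coefficient has value above (q-1)
  v(u), too large to affect the value of a root.\<close>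

lemma separable_root_of_value:
  assumes q: "prime (q::nat)" and u: "u \<noteq> 0" "has_value_in L (u ^ q)" "\<not> has_value_in L u"
  obtains r f where "f \<in> polys L" "degree f = q" "poly f r = 0" "veq r u"
proof -
  obtain b where b: "b \<in> L" "veq (u ^ q) b" using u by (auto simp: has_value_in_def)
  have b0: "b \<noteq> 0" using b u by auto
  have q1: "q > 1" using prime_gt_1_nat[OF q] .
  have nu: "\<not> veq 1 u" using u subring_1[OF LR] has_value_in_veq[of 1 u L] has_value_in_self[of 1 L]
    by auto
  \<comment> \<open>If v(u) >= 0, then v(u) > 0 since this value is not in \<open>L\<close>, and
    \<open>b\<close> has value q v(u) > (q-1) v(u); if v(u) < 0, the constant 1 is enough.\<close>
  obtain \<epsilon> where \<epsilon>: "\<epsilon> \<in> L" "\<epsilon> \<noteq> 0" "\<not> vle \<epsilon> (u ^ (q - 1))"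
  proof (cases "vle 1 u")
    case True
    have "\<not> vle u 1" using nu True by (auto simp: veq_def)
    then have "\<not> vle (u ^ (q - 1) * u) (u ^ (q - 1) * 1)" using u by (subst vle_mult_left) auto
    then have "\<not> vle (u ^ q) (u ^ (q - 1))" using q1 by (simp add: power_eq_if mult.commute)
    then have "\<not> vle b (u ^ (q - 1))" using b vle_trans unfolding veq_def by blast
    then show ?thesis using that b b0 by blast
  next
    case False
    have "\<not> vle 1 (u ^ (q - 1))"
    proof
      assume "vle 1 (u ^ (q - 1))"
      moreover have "vle (u ^ (q - 1)) u"
      proof -
        have "vle (u ^ (q - 2)) (1 ^ (q - 2))" using False vle_total by (intro vle_power) blast
        then have "vle (u ^ (q - 2) * u) (1 * u)" by (intro vle_mult) auto
        moreover have "q - 1 = Suc (q - 2)" using q1 by simp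
        ultimately show ?thesis by (simp add: mult.commute)
      qed
      ultimately show False using False vle_trans by blast
    qed
    then show ?thesis using that[of 1] subring_1[OF LR] by auto
  qed
  define e where "e = (if of_nat q = (0::'a) then \<epsilon> else 0)"
  have e: "e \<in> L" "\<not> vle e (u ^ (q - 1)) \<or> e = 0"
    using \<epsilon> subring_0[OF LR] by (auto simp: e_def)
  define f where "f = monom 1 q + [:- b, e:]"
  have fL: "f \<in> polys L" unfolding f_def
    using b e subring_1[OF LR] subring_uminus[OF LR] LR
    by (intro subring_add[OF is_subring_polys] polys_monom) auto
  have degf: "degree f = q" unfolding f_def
    using q1 by (subst degree_add_eq_left) (auto simp: degree_monom_eq)
  have "separable_poly f"
  proof (cases "of_nat q = (0::'a)")
    case True
    then have "pderiv f = [:\<epsilon>:]"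
      by (simp add: f_def e_def pderiv_add pderiv_monom pderiv_pCons)
    then show ?thesis using \<epsilon> by (simp add: separable_poly_def is_unit_pCons_iff coprime_commute
        is_unit_left_imp_coprime is_unit_right_imp_coprime)
  next
    case False
    have pf: "pderiv f = monom (of_nat q) (q - 1)" and f': "f = monom 1 q - [:b:]"
      using False by (simp_all add: f_def e_def pderiv_add pderiv_monom pderiv_pCons)
    have "coprime f (pderiv f)"
    proof (rule coprimeI)
      fix d assume d: "d dvd f" "d dvd pderiv f"
      \<comment> \<open>The combination X f' - q f eliminates X^q and leaves the nonzero constant q
        b.\<close>
      then have "d dvd [:0,1:] * pderiv f - smult (of_nat q) f"
        by (intro dvd_diff dvd_mult dvd_smult)
      also have "[:0,1:] * pderiv f = monom (of_nat q) (Suc (q - 1))"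
        by (simp add: pf monom_Suc)
      also have "Suc (q - 1) = q" using q1 by simp
      also have "monom (of_nat q) q - smult (of_nat q) f = [:of_nat q * b:]"
        by (simp add: f' smult_diff_right smult_monom)
      finally have "d dvd [:of_nat q * b:]" .
      moreover have "is_unit [:of_nat q * b:]" using False b0
        by (simp add: is_unit_const_poly_iff dvd_field_iff)
      ultimately show "is_unit d" by (rule dvd_unit_imp_unit)
    qed
    then show ?thesis by (simp add: separable_poly_def)
  qed
  then obtain r where r: "poly f r = 0" using sep_closed[of f] degf q1 by auto
  \<comment> \<open>After the scaling X = u Y the equation reads Y^q + \<eta> Y = \<beta> with
    \<eta> in the maximal ideal and \<beta> a unit, which forces solutions to be units.\<close>
  define \<rho> where "\<rho> = r / u"
  define \<eta> where "\<eta> = e / u ^ (q - 1)"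
  define \<beta> where "\<beta> = b / u ^ q"
  have \<eta>: "\<eta> \<in> maximal_ideal"
    using e u by (auto simp: \<eta>_def not_vle_iff maximal_ideal_0)
  have "vle (u ^ q) b" "vle b (u ^ q)" using b by (auto simp: veq_def)
  then have \<beta>: "\<beta> \<in> V" "\<beta> \<notin> maximal_ideal"
    using u not_vle_iff[of "u ^ q" b] by (auto simp: \<beta>_def vle_iff_divide)
  have uq: "u ^ q = u ^ (q - 1) * u" using q1 by (simp add: power_eq_if mult.commute)
  have "r ^ q + e * r = b" using r by (simp add: f_def poly_monom algebra_simps)
  then have "(r ^ q + e * r) / u ^ q = \<beta>" by (simp add: \<beta>_def)
  moreover have "e * r / u ^ q = \<eta> * \<rho>" using u by (simp add: \<eta>_def \<rho>_def uq)
  ultimately have eq: "\<rho> ^ q + \<eta> * \<rho> = \<beta>"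
    by (simp add: add_divide_distrib \<rho>_def power_divide)
  have "\<rho> \<in> V"
  proof (rule ccontr)
    assume \<rho>: "\<rho> \<notin> V"
    then have \<tau>: "inverse \<rho> \<in> maximal_ideal" by (rule inverse_in_maximal_ideal)
    have \<rho>0: "\<rho> \<noteq> 0" using \<rho> V_0 by auto
    define \<tau> where "\<tau> = inverse \<rho>"
    have \<tau>V: "\<tau> \<in> V" using \<tau> by (simp add: \<tau>_def maximal_ideal_def)
    have \<rho>q: "\<rho> ^ q = \<rho> ^ (q - 1) * \<rho>" using q1 by (simp add: power_eq_if mult.commute)
    have "1 = (\<beta> * \<tau> ^ (q - 1)) * \<tau> + (- (\<tau> ^ (q - 1))) * \<eta>"
      using \<rho>0 unfolding eq[symmetric] \<tau>_def by (simp add: \<rho>q field_simps)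
    also have "\<dots> \<in> maximal_ideal"
      using \<eta> \<tau> \<tau>V \<beta> unfolding \<tau>_def[symmetric]
      by (intro maximal_ideal_add maximal_ideal_mult V_mult V_uminus subring_power[OF V_subring])
    finally show False using one_notin_maximal_ideal by contradiction
  qed
  moreover have "\<rho> \<notin> maximal_ideal"
  proof
    assume \<rho>: "\<rho> \<in> maximal_ideal"
    have "\<rho> ^ q = \<rho> ^ (q - 1) * \<rho>" using q1 by (simp add: power_eq_if mult.commute)
    then have "\<beta> = (\<rho> ^ (q - 1) + \<eta>) * \<rho>" using eq by (simp add: algebra_simps)
    also have "\<dots> \<in> maximal_ideal" using \<rho> \<eta>
      by (intro maximal_ideal_mult V_add subring_power[OF V_subring]) (auto simp: maximal_ideal_def)
    finally show False using \<beta>(2) by contradiction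
  qed
  ultimately have "veq u r" using u by (intro unit_veq) (auto simp: \<rho>_def)
  then show ?thesis using that fL degf r veq_sym by blast
qed

text \<open>The powers of \<open>r\<close> below the \<open>q\<close>-th have distinct values modulo
  \<open>L\<close>, so the terms of an integral element of L(r) are integral. Each term is then an
  integral multiple of a power of r/c, and one \<open>c\<close> serves finitely many
  elements.\<close>

lemma value_extension_step:
  assumes "u \<noteq> 0" "\<not> has_value_in L u"
  shows "\<exists>L'. is_subfield L' \<and> L \<subset> L' \<and>
    (\<forall>Y. finite Y \<longrightarrow> Y \<subseteq> V \<inter> L' \<longrightarrow> (\<exists>z\<in>V. Y \<subseteq> adjoin (V \<inter> L) z))"
proof -
  obtain q x where q: "prime (q::nat)" and x: "x \<noteq> 0" "has_value_in L (x ^ q)"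
    "\<And>k. \<not> q dvd k \<Longrightarrow> \<not> has_value_in L (x ^ k)"
    using prime_order_value[OF assms] by blast
  obtain u where u: "u \<noteq> 0" "has_value_in L (u ^ q)" "\<And>k. \<not> q dvd k \<Longrightarrow> \<not> has_value_in L (u ^ k)"
    "\<And>h k. h \<in> L \<Longrightarrow> h \<noteq> 0 \<Longrightarrow> \<not> q dvd k \<Longrightarrow> h * u ^ k \<in> V \<Longrightarrow>
      \<exists>c\<in>L. c \<noteq> 0 \<and> u / c \<in> V \<and> vle (u / c) (h * u ^ k)"
    using minimal_value_class[OF q x] by blast
  have q1: "q > 1" using prime_gt_1_nat[OF q] .
  have u1: "\<not> has_value_in L u" using u(3)[of 1] q1 by auto
  obtain r f where f: "f \<in> polys L" "degree f = q" "poly f r = 0" "veq r u"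
    using separable_root_of_value[OF q u(1,2) u1] by blast
  have f0: "f \<noteq> 0" using f q1 by auto
  have r0: "r \<noteq> 0" using f u by auto
  have rL: "r \<notin> L" using has_value_in_veq[OF f(4)] u1 r0 has_value_in_self by blast
  have digits: "\<exists>h. h \<in> polys L \<and> y = (\<Sum>k<q. coeff h k * r ^ k) \<and>
      (\<forall>k<q. coeff h k * u ^ k \<in> V)" if y: "y \<in> V \<inter> adjoin L r" for y
  proof -
    obtain h' where h': "h' \<in> polys L" "y = poly h' r" using y by (auto simp: adjoin_def)
    obtain h where h: "h \<in> polys L" "poly h r = poly h' r" "h = 0 \<or> degree h < q"
      using poly_in_adjoin_reduce[OF L f(1) f0 f(3) h'(1)] f(2) by metis
    let ?t = "\<lambda>k. coeff h k * r ^ k"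
    have "poly h r = (\<Sum>k<q. ?t k)"
      unfolding poly_altdef using h(3) q1
      by (intro sum.mono_neutral_left) (auto simp: coeff_eq_0)
    then have sumt: "y = (\<Sum>k<q. ?t k)" using h h' by simp
    have "\<not> has_value_in L (r ^ (j - i))" if "i < j" "j < q" for i j
      using u(3)[of "j - i"] nat_dvd_not_less[of "j - i" q] that
        has_value_in_veq[OF veq_power[OF f(4)]] by auto
    then have "vle y (?t k)" if "k < q" for k
      unfolding sumt using that by (intro distinct_powers_sum[OF L h(1) r0]) auto
    then have tV: "?t k \<in> V" if "k < q" for k using that y in_V_vle by blast
    have "coeff h k * u ^ k \<in> V" if "k < q" for k
    proof -
      have "vle (?t k) (coeff h k * u ^ k)"
        using veq_power[OF f(4), of k] by (intro vle_mult) (auto simp: veq_def)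
      then show ?thesis using tV[OF that] in_V_vle by blast
    qed
    then show ?thesis using h sumt by blast
  qed
  have step: "\<exists>z\<in>V. Y \<subseteq> adjoin (V \<inter> L) z" if Y: "finite Y" "Y \<subseteq> V \<inter> adjoin L r" for Y
  proof -
    from digits Y have "\<forall>y\<in>Y. \<exists>h. h \<in> polys L \<and> y = (\<Sum>k<q. coeff h k * r ^ k) \<and>
      (\<forall>k<q. coeff h k * u ^ k \<in> V)" by blast
    then obtain h where h: "\<And>y. y \<in> Y \<Longrightarrow> h y \<in> polys L"
        "\<And>y. y \<in> Y \<Longrightarrow> y = (\<Sum>k<q. coeff (h y) k * r ^ k)"
        "\<And>y k. y \<in> Y \<Longrightarrow> k < q \<Longrightarrow> coeff (h y) k * u ^ k \<in> V"
      by metis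
    define P where "P = (\<lambda>(y, k) c. c \<in> L \<and> c \<noteq> 0 \<and> u / c \<in> V \<and> coeff (h y) k * c ^ k \<in> V)"
    have "\<exists>c. P i c" if i: "i \<in> Y \<times> {..<q}" for i
    proof -
      obtain y k where yk: "i = (y, k)" "y \<in> Y" "k < q" using i by auto
      obtain b where b: "b \<in> L" "veq (u ^ q) b" using u by (auto simp: has_value_in_def)
      \<comment> \<open>Digits with \<open>k = 0\<close> or zero coefficient impose only
        \<open>u / c \<in> V\<close>. If v(u) < 0, the element \<open>b\<close> of value q v(u) <=
        v(u) is such a \<open>c\<close>.\<close>
      have base: "\<exists>c\<in>L. c \<noteq> 0 \<and> u / c \<in> V"
      proof (cases "u \<in> V")
        case True then show ?thesis using subring_1[OF LR] by (intro bexI[of _ 1]) auto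
      next
        case False
        then have "inverse u \<in> V" using V_total by blast
        then have "vle u 1" using u by (simp add: vle_iff_divide inverse_eq_divide)
        then have "vle (u ^ (q - 1)) (1 ^ (q - 1))" by (rule vle_power)
        then have "vle (u ^ (q - 1) * u) (1 * u)" by (intro vle_mult) auto
        then have "vle (u ^ q) u" using q1 by (simp add: power_eq_if mult.commute)
        then have "vle b u" using b vle_trans unfolding veq_def by blast
        moreover have "b \<noteq> 0" using b u by auto
        ultimately show ?thesis using b by (intro bexI[of _ b]) (auto simp: vle_iff_divide)
      qed
      show ?thesis
      proof (cases "k = 0 \<or> coeff (h y) k = 0")
        case True
        then show ?thesis using base h(3)[OF yk(2,3)] yk V_0 by (auto simp: P_def)
      next
        case False
        have "\<exists>c\<in>L. c \<noteq> 0 \<and> u / c \<in> V \<and> coeff (h y) k * c ^ k \<in> V"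
          using False yk h by (intro minimal_value_class_power[OF u(1,4)])
            (auto intro: coeff_in_polys)
        then show ?thesis using yk by (auto simp: P_def)
      qed
    qed
    then obtain c where c: "\<And>i. i \<in> Y \<times> {..<q} \<Longrightarrow> P i (c i)" by metis
    show ?thesis
    proof (cases "Y = {}")
      case True then show ?thesis using V_0 by blast
    next
      case False
      \<comment> \<open>The conditions on the coefficients persist when the value of
        \<open>c\<close> grows, so the scaling of largest value serves all digits; u/c is integral
        for it by its own choice.\<close>
      then obtain m where m: "m \<in> Y \<times> {..<q}" "\<And>i. i \<in> Y \<times> {..<q} \<Longrightarrow> vle (c i) (c m)"
        using vle_max[of "Y \<times> {..<q}" c] Y q1 by (auto simp: lessThan_empty_iff)
      have cm: "c m \<in> L" "c m \<noteq> 0" "u / c m \<in> V" using c[OF m(1)] by (auto simp: P_def)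
      define z where "z = r / c m"
      have "vle (c m) u" using cm by (simp add: vle_iff_divide)
      then have "vle (c m) r" using f(4) vle_trans unfolding veq_def by blast
      then have zV: "z \<in> V" using cm by (simp add: z_def vle_iff_divide)
      have "y \<in> adjoin (V \<inter> L) z" if y: "y \<in> Y" for y
      proof -
        have coeff: "coeff (h y) k * c m ^ k \<in> V \<inter> L" if k: "k < q" for k
        proof
          have i: "(y, k) \<in> Y \<times> {..<q}" using y k by simp
          have "coeff (h y) k * c (y, k) ^ k \<in> V" using c[OF i] by (simp add: P_def)
          moreover have "vle (coeff (h y) k * c (y, k) ^ k) (coeff (h y) k * c m ^ k)"
            by (intro vle_mult vle_power m(2) i vle_refl)
          ultimately show "coeff (h y) k * c m ^ k \<in> V" using in_V_vle by blast
          show "coeff (h y) k * c m ^ k \<in> L"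
            using h(1)[OF y] cm by (intro subring_mult[OF LR] subring_power[OF LR] coeff_in_polys)
        qed
        have "y = (\<Sum>k<q. coeff (h y) k * r ^ k)" by (rule h(2)[OF y])
        also have "\<dots> = (\<Sum>k<q. (coeff (h y) k * c m ^ k) * z ^ k)"
          using cm by (simp add: z_def power_divide)
        also have "\<dots> \<in> adjoin (V \<inter> L) z"
        proof (rule subring_sum[OF is_subring_adjoin[OF O]])
          fix k assume "k \<in> {..<q}"
          then have "coeff (h y) k * c m ^ k \<in> adjoin (V \<inter> L) z"
            using coeff subset_adjoin[OF O] by blast
          then show "coeff (h y) k * c m ^ k * z ^ k \<in> adjoin (V \<inter> L) z"
            by (rule subring_mult[OF is_subring_adjoin[OF O] _
                  subring_power[OF is_subring_adjoin[OF O] gen_in_adjoin[OF O]]])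
        qed
        finally show ?thesis .
      qed
      then show ?thesis using zV by blast
    qed
  qed
  have "L \<subset> adjoin L r" using subset_adjoin[OF LR] gen_in_adjoin[OF LR] rL by blast
  then show ?thesis using is_subfield_adjoin[OF L f(1) f0 f(3)] step by blast
qed

end

context separably_closed_extension
begin

subsection \<open>Extensions without new values\<close>

text \<open>If \<open>L\<close> contains all elements of degree less than \<open>n\<close>, a polynomial of degree less than \<open>n\<close>
  splits into linear factors, except for irreducible factors \<open>h\<close> with \<open>h' = 0\<close>; these are replaced
  by \<open>h + \<epsilon> X\<close>.  So its value at \<open>z\<close> is controlled by a good approximation \<open>a\<close> of \<open>z\<close>.\<close>

lemma value_at_approximated:
  assumes val: "\<And>u. u \<noteq> 0 \<Longrightarrow> has_value_in L u"
    and z: "z \<in> V" "z \<notin> L"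
    and small: "\<And>x q. q \<in> polys L \<Longrightarrow> q \<noteq> 0 \<Longrightarrow> poly q x = 0 \<Longrightarrow> degree q < n \<Longrightarrow> x \<in> L"
    and h: "h \<in> polys L" "h \<noteq> 0" "degree h < n"
  shows "\<exists>Y\<subseteq>L. finite Y \<and> (\<forall>a\<in>V\<inter>L. \<forall>c\<in>V\<inter>L. c \<noteq> 0 \<longrightarrow> (z - a) / c \<in> V \<longrightarrow> (\<forall>y\<in>Y. vle (z - y) c) \<longrightarrow>
    (\<exists>e\<in>L. e \<noteq> 0 \<and> veq e (poly h z) \<and> poly h z / e \<in> adjoin (V \<inter> L) ((z - a) / c)))"
    (is "\<exists>Y\<subseteq>L. finite Y \<and> ?Q Y h")
  using h
proof (induction "degree h" arbitrary: h rule: less_induct)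
  case less
  note h = less.prems
  let ?A = "\<lambda>a c. adjoin (V \<inter> L) ((z - a) / c)"
  have nz: "poly p z \<noteq> 0" if "p \<in> polys L" "p \<noteq> 0" "degree p < n" for p
    using small[of p z] that z by blast
  have A: "is_subring (?A a c)" for a c by (rule is_subring_adjoin[OF O])
  have mult: "\<exists>Y\<subseteq>L. finite Y \<and> ?Q Y (h1 * h2)"
    if "h1 \<in> polys L" "h2 \<in> polys L" "h1 * h2 \<noteq> 0"
      "degree h1 < degree h" "degree h2 < degree h" for h1 h2
  proof -
    have "\<exists>Y\<subseteq>L. finite Y \<and> ?Q Y h1" using less.hyps[of h1] that h by auto
    then obtain Y1 where Y1: "Y1 \<subseteq> L" "finite Y1" "?Q Y1 h1" by blast
    have "\<exists>Y\<subseteq>L. finite Y \<and> ?Q Y h2" using less.hyps[of h2] that h by auto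
    then obtain Y2 where Y2: "Y2 \<subseteq> L" "finite Y2" "?Q Y2 h2" by blast
    have "?Q (Y1 \<union> Y2) (h1 * h2)"
    proof (intro ballI impI)
      fix a c assume ac: "a \<in> V \<inter> L" "c \<in> V \<inter> L" "c \<noteq> 0" "(z - a) / c \<in> V"
        "\<forall>y\<in>Y1 \<union> Y2. vle (z - y) c"
      then obtain e1 where e1: "e1 \<in> L" "e1 \<noteq> 0" "veq e1 (poly h1 z)" "poly h1 z / e1 \<in> ?A a c"
        using Y1(3) by blast
      obtain e2 where e2: "e2 \<in> L" "e2 \<noteq> 0" "veq e2 (poly h2 z)" "poly h2 z / e2 \<in> ?A a c"
        using Y2(3) ac by blast
      have "veq (e1 * e2) (poly (h1 * h2) z)" using veq_mult[OF e1(3) e2(3)] by simp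
      moreover have "poly (h1 * h2) z / (e1 * e2) = (poly h1 z / e1) * (poly h2 z / e2)" by simp
      ultimately show "\<exists>e\<in>L. e \<noteq> 0 \<and> veq e (poly (h1 * h2) z) \<and> poly (h1 * h2) z / e \<in> ?A a c"
        using e1 e2 subring_mult[OF LR e1(1) e2(1)] subring_mult[OF A e1(4) e2(4)]
        by (intro bexI[of _ "e1 * e2"]) auto
    qed
    then show ?thesis using Y1 Y2 by (intro exI[of _ "Y1 \<union> Y2"]) auto
  qed
  show ?case
  proof (cases "degree h = 0")
    case True
    then obtain b where b: "h = [:b:]" by (rule degree_eq_zeroE)
    have "?Q {} h" using b h LR subring_1[OF A] by (intro ballI impI bexI[of _ b]) auto
    then show ?thesis by (intro exI[of _ "{}"]) auto
  next
    case deg0: False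
    show ?thesis
    proof (cases "degree h = 1")
      case True
      define b where "b = coeff h 1"
      have b: "b \<in> L" "b \<noteq> 0" using h True by (auto simp: b_def coeff_in_polys)
        (metis leading_coeff_0_iff)
      define y where "y = - coeff h 0 / b"
      have y: "y \<in> L" unfolding y_def
        using h b by (intro subfield_divide[OF L] subring_uminus[OF LR] coeff_in_polys) auto
      have hz: "poly h z = b * (z - y)"
        using True b by (simp add: poly_altdef y_def b_def algebra_simps)
      have zy: "z - y \<noteq> 0" using y z by auto
      have "?Q {y} h"
      proof (intro ballI impI)
        fix a c assume ac: "a \<in> V \<inter> L" "c \<in> V \<inter> L" "c \<noteq> 0" "(z - a) / c \<in> V" "\<forall>y\<in>{y}. vle (z - y) c"
        obtain e where e: "e \<in> L" "veq (z - y) e" using val[OF zy] by (auto simp: has_value_in_def)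
        have e0: "e \<noteq> 0" using e zy by auto
        have ez: "vle e (z - y)" "vle (z - y) e" using e by (auto simp: veq_def)
        have "vle (z - y) c" using ac by simp
        then have ec: "vle e c" using ez vle_trans by blast
        have "vle c (z - a)" using ac by (simp add: vle_iff_divide)
        \<comment> \<open>The approximation \<open>a\<close> is at least as good as
          \<open>y\<close>, so \<open>a - y\<close> has value at least that of \<open>z - y\<close>;
          hence (z-y)/e is affine in (z-a)/c with integral coefficients.\<close>
        then have "vle e ((z - y) - (z - a))" by (rule vle_diff[OF ez(1) vle_trans[OF ec]])
        then have "(a - y) / e \<in> V" using e0 by (simp add: vle_iff_divide)
        moreover have "(a - y) / e \<in> L" using e ac y
          by (intro subfield_divide[OF L] subring_diff[OF LR]) auto
        moreover have "c / e \<in> V \<inter> L" using ec e0 e ac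
          by (simp add: vle_iff_divide subfield_divide[OF L])
        ultimately have "(c / e) * ((z - a) / c) + (a - y) / e \<in> ?A a c"
          by (intro subring_add[OF A] subring_mult[OF A _ gen_in_adjoin[OF O]]
              subsetD[OF subset_adjoin[OF O]]) auto
        also have "(c / e) * ((z - a) / c) + (a - y) / e = poly h z / (b * e)"
          using b e0 ac by (simp add: hz field_simps)
        finally have "poly h z / (b * e) \<in> ?A a c" .
        moreover have "veq (b * e) (poly h z)"
          unfolding hz using veq_sym[OF e(2)] by (intro veq_mult) auto
        ultimately show "\<exists>e\<in>L. e \<noteq> 0 \<and> veq e (poly h z) \<and> poly h z / e \<in> ?A a c"
          using e b e0 by (intro bexI[of _ "b * e"]) (auto intro: subring_mult[OF LR])
      qed
      then show ?thesis using y by (intro exI[of _ "{y}"]) auto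
    next
      case deg1: False
      have d2: "degree h \<ge> 2" using deg0 deg1 by simp
      have separable_factor: "\<exists>h1 h2. p = h1 * h2 \<and> h1 \<in> polys L \<and> h2 \<in> polys L \<and>
          degree h1 < degree h \<and> degree h2 < degree h"
        if p: "p \<in> polys L" "p \<noteq> 0" "separable_poly p" "degree p = degree h" for p
      proof -
        obtain x where x: "poly p x = 0" using sep_closed[of p] p d2 by auto
        then have xL: "x \<in> L" using small[of p x] p h by auto
        have "[:- x, 1:] dvd p" using x by (simp add: poly_eq_0_iff_dvd)
        then obtain h2 where h2: "h2 \<in> polys L" "p = h2 * [:- x, 1:]"
          using polys_dvd_quotient[OF L p(1), of
            "[:- x, 1:]"] xL LR subring_uminus[OF LR] subring_1[OF LR]
          by auto
        then have "degree p = degree h2 + 1"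
          using p by (subst h2, subst degree_mult_eq) auto
        then show ?thesis using h2 xL p d2 LR subring_uminus[OF LR] subring_1[OF LR]
          by (intro exI[of _ h2] exI[of _ "[:- x, 1:]"]) auto
      qed
      show ?thesis
      proof (cases "separable_poly h")
        case True
        then show ?thesis using separable_factor[OF h(1,2)] mult h by blast
      next
        case insep: False
        show ?thesis
        proof (cases "pderiv h = 0")
          case False
          \<comment> \<open>The derivative is nonzero of smaller degree, so this common divisor is a
            proper factor and \<open>mult\<close> applies.\<close>
          obtain d where d: "d \<in> polys L" "degree d > 0" "d dvd h" "d dvd pderiv h"
            using polys_common_divisor[OF L h(1) polys_pderiv[OF LR h(1)] h(2)] insep
            by (auto simp: separable_poly_def)
          obtain e where e: "e \<in> polys L" "h = e * d" using polys_dvd_quotient[OF L h(1) d(1,3)] .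
          have "degree d \<le> degree (pderiv h)"
            using d False by (intro dvd_imp_degree_le)
          also have "\<dots> < degree h"
          proof -
            have "degree (pderiv h) \<le> degree h - 1"
              by (rule degree_le) (auto simp: coeff_pderiv coeff_eq_0)
            then show ?thesis using d2 by simp
          qed
          finally have dh: "degree d < degree h" .
          have "degree h = degree e + degree d"
            unfolding e(2) using h(2) e(2) by (intro degree_mult_eq) auto
          then show ?thesis using mult[of e d] e d h dh by auto
        next
          case True
          show ?thesis
          proof (cases "L \<subseteq> V")
            \<comment> \<open>If the valuation is trivial on \<open>L\<close>, there is no
              \<epsilon> of larger value for a perturbation; but then all nonzero elements are units
              and e = 1 works.\<close>
            case triv: True
            have unit: "veq 1 u" if u: "u \<noteq> 0" for u
            proof -
              obtain l where l: "l \<in> L" "veq u l" using val[OF u] by (auto simp: has_value_in_def)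
              have "l \<noteq> 0" using l u by auto
              moreover have "l \<in> V" "inverse l \<in> V" using l triv subfield_inverse[OF L] by auto
              ultimately have "veq 1 l" by (auto simp: veq_def vle_iff_divide inverse_eq_divide)
              then show ?thesis using l veq_trans veq_sym by blast
            qed
            have "?Q {} h"
            proof (intro ballI impI)
              fix a c assume ac: "a \<in> V \<inter> L" "c \<in> V \<inter> L" "c \<noteq> 0"
              have VL: "V \<inter> L = L" using triv by auto
              have "pcompose h [:a, c:] \<in> polys L"
                using ac by (intro polys_pcompose LR h) (use LR in auto)
              moreover have "poly (pcompose h [:a, c:]) ((z - a) / c) = poly h z"
                using ac by (simp add: poly_pcompose)
              ultimately have "poly h z \<in> ?A a c" unfolding VL by (intro adjoinI) auto
              then show "\<exists>e\<in>L. e \<noteq> 0 \<and> veq e (poly h z) \<and> poly h z / e \<in> ?A a c"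
                using unit nz[OF h] subring_1[OF LR] by (intro bexI[of _ 1]) auto
            qed
            then show ?thesis by (intro exI[of _ "{}"]) auto
          next
            case False
            then obtain l where l: "l \<in> L" "l \<notin> V" by blast
            then have l0: "l \<noteq> 0" using V_0 by auto
            have lm: "inverse l \<in> maximal_ideal" by (rule inverse_in_maximal_ideal[OF l(2)])
            obtain e' where e': "e' \<in> L" "veq (poly h z) e'"
              using val[OF nz[OF h]] by (auto simp: has_value_in_def)
            have e'0: "e' \<noteq> 0" using e' nz[OF h] by auto
            \<comment> \<open>As \<open>l\<close> is outside \<open>V\<close>, \<epsilon> has value
              above that of h(z). Adding \<epsilon> X keeps the value at \<open>z\<close>, and since
              h' = 0 it makes the derivative the nonzero constant \<epsilon>.\<close>
            define \<epsilon> where "\<epsilon> = e' * inverse l"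
            have \<epsilon>: "\<epsilon> \<in> L" "\<epsilon> \<noteq> 0" using e' e'0 l l0 subfield_inverse[OF L] subring_mult[OF LR]
              by (auto simp: \<epsilon>_def)
            define g where "g = h + [:0, \<epsilon>:]"
            have gL: "g \<in> polys L" unfolding g_def using h \<epsilon> LR subring_0[OF LR]
              by (intro subring_add[OF is_subring_polys]) auto
            have degg: "degree g = degree h"
              unfolding g_def using d2 by (intro degree_add_eq_left) auto
            have "pderiv g = [:\<epsilon>:]" using True by (simp add: g_def pderiv_add pderiv_pCons)
            then have "separable_poly g" using \<epsilon>
              by (simp add: separable_poly_def is_unit_pCons_iff is_unit_right_imp_coprime)
            moreover have g0: "g \<noteq> 0" using degg d2 by auto
            ultimately obtain h1 h2 where h12: "g = h1 * h2" "h1 \<in> polys L" "h2 \<in> polys L"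
                "degree h1 < degree h" "degree h2 < degree h"
              using separable_factor[OF gL] degg by blast
            have "\<exists>Y\<subseteq>L. finite Y \<and> ?Q Y g" unfolding h12(1) using h12 g0 by (intro mult) auto
            then obtain Y where Y: "Y \<subseteq> L" "finite Y" "?Q Y g" by blast
            have gz: "poly g z = poly h z + \<epsilon> * z" by (simp add: g_def mult.commute)
            have "\<not> vle \<epsilon> e'" unfolding \<epsilon>_def using lm e'0 by (simp add: not_vle_iff)
            then have "\<not> vle \<epsilon> (poly h z)" using e' vle_trans unfolding veq_def by blast
            moreover have "vle \<epsilon> (\<epsilon> * z)" using z(1) by (subst mult.commute) (simp add: vle_multV)
            ultimately have "\<not> vle (\<epsilon> * z) (poly h z)" using vle_trans by blast
            then have hg: "veq (poly h z) (poly g z)"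
              unfolding gz by (rule veq_add_small[OF nz[OF h]])
            have "?Q Y h"
            proof (intro ballI impI)
              fix a c assume ac: "a \<in> V \<inter> L" "c \<in> V \<inter> L" "c \<noteq> 0" "(z - a) / c \<in> V"
                "\<forall>y\<in>Y. vle (z - y) c"
              then obtain e where e: "e \<in> L" "e \<noteq> 0" "veq e (poly g z)" "poly g z / e \<in> ?A a c"
                using Y(3) by blast
              have eh: "veq e (poly h z)" using e(3) hg veq_sym veq_trans by blast
              have "vle (poly h z) \<epsilon>" using \<open>\<not> vle \<epsilon> (poly h z)\<close> vle_total by blast
              then have "vle e \<epsilon>" using eh vle_trans unfolding veq_def by blast
              then have "\<epsilon> / e \<in> V \<inter> L" using e \<epsilon>
                by (simp add: vle_iff_divide subfield_divide[OF L])
              \<comment> \<open>The perturbation \<epsilon> z is subtracted again, with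
                \<open>z\<close> written as a + c ((z-a)/c).\<close>
              then have "poly g z / e - \<epsilon> / e * (a + c * ((z - a) / c)) \<in> ?A a c"
                using ac e(4)
                by (intro subring_diff[OF A e(4)] subring_mult[OF A] subring_mult[OF A _
                  gen_in_adjoin[OF O]]
                    subring_add[OF A] subsetD[OF subset_adjoin[OF O]])
              also have "poly g z / e - \<epsilon> / e * (a + c * ((z - a) / c)) = poly h z / e"
                using e ac by (simp add: gz field_simps)
              finally show "\<exists>e\<in>L. e \<noteq> 0 \<and> veq e (poly h z) \<and> poly h z / e \<in> ?A a c"
                using e eh by blast
            qed
            then show ?thesis using Y by blast
          qed
        qed
      qed
    qed
  qed
qed

text \<open>An element outside \<open>L\<close> of least degree over \<open>L\<close> generates the
  step: polynomials of smaller degree are governed by \<open>value_at_approximated\<close>, and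
  finitely many of them share one good approximation.\<close>

lemma immediate_or_residue_extension_step:
  assumes val: "\<And>u. u \<noteq> 0 \<Longrightarrow> has_value_in L u" and "L \<noteq> UNIV"
  shows "\<exists>L'. is_subfield L' \<and> L \<subset> L' \<and>
    (\<forall>Y. finite Y \<longrightarrow> Y \<subseteq> V \<inter> L' \<longrightarrow> (\<exists>z\<in>V. Y \<subseteq> adjoin (V \<inter> L) z))"
proof -
  let ?P = "\<lambda>(x, q). q \<in> polys L \<and> q \<noteq> 0 \<and> poly q x = 0 \<and> x \<notin> L"
  obtain x where x: "x \<notin> L" using assms by blast
  obtain q where "minpoly L x q" using sep_alg by blast
  with x have "?P (x, q)" by (auto simp: minpoly_def)
  then have "\<exists>xq. ?P xq \<and> (\<forall>yq. ?P yq \<longrightarrow> degree (snd xq) \<le> degree (snd yq))"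
    by (rule ex_has_least_nat)
  then obtain x p where p: "p \<in> polys L" "p \<noteq> 0" "poly p x = 0" "x \<notin> L"
    and least: "\<And>y q. q \<in> polys L \<Longrightarrow> q \<noteq> 0 \<Longrightarrow> poly q y = 0 \<Longrightarrow> y \<notin> L \<Longrightarrow>
      degree p \<le> degree q" by force
  have "x \<noteq> 0" using p subring_0[OF LR] by auto
  then obtain l where l: "l \<in> L" "veq x l" using val[OF \<open>x \<noteq> 0\<close>] unfolding has_value_in_def by blast
  have l0: "l \<noteq> 0" using l \<open>x \<noteq> 0\<close> by auto
  define z where "z = x / l"
  have zV: "z \<in> V" using l l0 by (simp add: z_def veq_def vle_iff_divide)
  have zL: "z \<notin> L" using subring_mult[OF LR, of z l] l l0 p by (auto simp: z_def)
  define f where "f = pcompose p [:0, l:]"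
  have f: "f \<in> polys L" "f \<noteq> 0" "poly f z = 0" "degree f = degree p"
    using p l l0 LR subring_0[OF LR] by (auto simp: f_def z_def poly_pcompose degree_pcompose
        intro!: polys_pcompose dest: pcompose_eq_0)
  have small: "y \<in> L" if "q \<in> polys L" "q \<noteq> 0" "poly q y = 0" "degree q < degree p" for q y
    using least[of q y] that by linarith
  have step: "\<exists>z'\<in>V. Y \<subseteq> adjoin (V \<inter> L) z'" if Y: "finite Y" "Y \<subseteq> V \<inter> adjoin L z" for Y
  proof -
    have "\<exists>h. h \<in> polys L \<and> y = poly h z \<and> (h = 0 \<or> degree h < degree p)"
      if y: "y \<in> Y" for y
    proof -
      obtain h' where h': "h' \<in> polys L" "y = poly h' z" using Y y by (auto simp: adjoin_def)
      then show ?thesis using poly_in_adjoin_reduce[OF L f(1-3) h'(1)] f(4) by metis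
    qed
    then obtain h where h: "\<And>y. y \<in> Y \<Longrightarrow> h y \<in> polys L" "\<And>y. y \<in> Y \<Longrightarrow> y = poly (h y) z"
      "\<And>y. y \<in> Y \<Longrightarrow> h y = 0 \<or> degree (h y) < degree p" by metis
    define Q where "Q y T \<longleftrightarrow> (\<forall>a\<in>V\<inter>L. \<forall>c\<in>V\<inter>L. c \<noteq> 0 \<longrightarrow> (z - a) / c \<in> V \<longrightarrow> (\<forall>t\<in>T. vle (z - t) c) \<longrightarrow>
      (\<exists>e\<in>L. e \<noteq> 0 \<and> veq e y \<and> y / e \<in> adjoin (V \<inter> L) ((z - a) / c)))" for y T
    have "\<exists>T\<subseteq>L. finite T \<and> Q y T" if y: "y \<in> Y" "y \<noteq> 0" for y
    proof -
      have hy: "h y \<in> polys L" "y = poly (h y) z" using h y by auto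
      then have "h y \<noteq> 0" using y by auto
      then have "degree (h y) < degree p" using h(3)[OF y(1)] by auto
      from value_at_approximated[OF val zV zL small hy(1) \<open>h y \<noteq> 0\<close> this]
      show ?thesis unfolding Q_def hy(2)[symmetric] .
    qed
    then have "\<forall>y\<in>Y - {0}. \<exists>T\<subseteq>L. finite T \<and> Q y T" by blast
    then obtain T where T: "\<And>y. y \<in> Y - {0} \<Longrightarrow> T y \<subseteq> L" "\<And>y. y \<in> Y - {0} \<Longrightarrow> finite (T y)"
      "\<And>y. y \<in> Y - {0} \<Longrightarrow> Q y (T y)" by metis
    \<comment> \<open>Including 0 ensures that for the best approximation \<open>z - a\<close>, and
      hence \<open>a\<close>, lies in \<open>V\<close>.\<close>
    define W where "W = insert 0 (\<Union>y\<in>Y - {0}. T y)"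
    have W: "finite W" "W \<noteq> {}" "W \<subseteq> L" using T Y subring_0[OF LR] by (auto simp: W_def)
    obtain a where a: "a \<in> W" "\<And>t. t \<in> W \<Longrightarrow> vle (z - t) (z - a)"
      using vle_max[OF W(1,2), of "\<lambda>t. z - t"] by blast
    have aL: "a \<in> L" using a W by blast
    have za: "z - a \<noteq> 0" using aL zL by auto
    \<comment> \<open>Scaling by the exact value of \<open>z - a\<close> gives an integral generator
      and keeps \<open>vle (z - t) c\<close> for all \<open>t\<close> in \<open>W\<close>.\<close>
    then obtain c where c: "c \<in> L" "veq (z - a) c"
      using val[OF za] unfolding has_value_in_def by blast
    have c0: "c \<noteq> 0" using c(2) za by (metis veq_0_iff(2))
    have "vle z (z - a)" using a(2)[of 0] by (simp add: W_def)
    then have zaV: "z - a \<in> V" using zV in_V_vle by blast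
    have aV: "a \<in> V" using V_diff[OF zV zaV] by simp
    have cV: "c \<in> V" using zaV c in_V_vle unfolding veq_def by blast
    have z'V: "(z - a) / c \<in> V" using c c0 by (simp add: veq_def vle_iff_divide)
    have Wc: "vle (z - t) c" if "t \<in> W" for t using a(2)[OF that] c vle_trans unfolding veq_def
      by blast
    have "y \<in> adjoin (V \<inter> L) ((z - a) / c)" if y: "y \<in> Y" for y
    proof (cases "y = 0")
      case True
      then show ?thesis using subring_0[OF is_subring_adjoin[OF O]] by simp
    next
      case False
      then have "Q y (T y)" using T y by blast
      moreover have "\<forall>t\<in>T y. vle (z - t) c" using Wc y False by (auto simp: W_def)
      ultimately obtain e where e: "e \<in> L" "e \<noteq> 0" "veq e y" "y / e \<in> adjoin (V \<inter> L) ((z - a) / c)"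
        unfolding Q_def using aV aL cV c c0 z'V by blast
      have "e \<in> V \<inter> L" using e y Y in_V_vle unfolding veq_def by blast
      then have "e \<in> adjoin (V \<inter> L) ((z - a) / c)" using subset_adjoin[OF O] by blast
      from subring_mult[OF is_subring_adjoin[OF O] this e(4)] show ?thesis using e by simp
    qed
    then show ?thesis using z'V by blast
  qed
  have "L \<subset> adjoin L z" using subset_adjoin[OF LR] gen_in_adjoin[OF LR] zL by blast
  then show ?thesis using is_subfield_adjoin[OF L f(1-3)] step by blast
qed

text \<open>A relation over \<open>V \<inter> L'\<close> involves a finite set \<open>Y\<close>,
  which lies in a ring generated by one separable element; there
  \<open>simple_extension_injective\<close> applies.\<close>

lemma extension_step:
  assumes "L \<noteq> UNIV"
  shows "\<exists>L'. is_subfield L' \<and> L \<subset> L' \<and> (\<forall>A\<subseteq>V\<inter>L. \<forall>x\<in>V\<inter>L.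
    single x 1 \<in> kaehler_relations (V \<inter> L') A \<longrightarrow>
    single x 1 \<in> kaehler_relations (V \<inter> L) A)"
proof -
  have "\<exists>L'. is_subfield L' \<and> L \<subset> L' \<and>
    (\<forall>Y. finite Y \<longrightarrow> Y \<subseteq> V \<inter> L' \<longrightarrow> (\<exists>z\<in>V. Y \<subseteq> adjoin (V \<inter> L) z))"
  proof (cases "\<forall>u. u \<noteq> 0 \<longrightarrow> has_value_in L u")
    case True
    then show ?thesis by (intro immediate_or_residue_extension_step assms) blast
  next
    case False
    then obtain u where "u \<noteq> 0" "\<not> has_value_in L u" by blast
    then show ?thesis by (rule value_extension_step)
  qed
  then obtain L' where L': "is_subfield L'" "L \<subset> L'"
    "\<forall>Y. finite Y \<longrightarrow> Y \<subseteq> V \<inter> L' \<longrightarrow> (\<exists>z\<in>V. Y \<subseteq> adjoin (V \<inter> L) z)" by (elim exE conjE)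
  have "single x 1 \<in> kaehler_relations (V \<inter> L) A"
    if A: "A \<subseteq> V \<inter> L" and x: "x \<in> V \<inter> L"
      and d: "single x 1 \<in> kaehler_relations (V \<inter> L') A" for A x
  proof -
    obtain Y where Y: "Y \<subseteq> V \<inter> L'" "finite Y"
      "\<And>B. Y \<subseteq> B \<Longrightarrow> single x 1 \<in> kaehler_relations B A"
      using kaehler_relations_finitary[OF d] by blast
    obtain z where z: "z \<in> V" "Y \<subseteq> adjoin (V \<inter> L) z" using L'(3)[rule_format, OF Y(2,1)] by blast
    obtain p where p: "minpoly L z p" "poly (pderiv p) z \<noteq> 0" using sep_alg by blast
    show ?thesis by (rule simple_extension_injective[OF L z(1) p A x Y(3)[OF z(2)]])
  qed
  then show ?thesis using L'(1,2) by (intro exI[of _ L'] conjI ballI allI impI)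
qed

end

text \<open>By Zorn's lemma the steps reach the separable closure, since a relation involves only finitely
  many elements.\<close>

context valuation_subring
begin

lemma separable_closure_injective:
  assumes sep_closed: "\<And>p :: 'a poly. degree p > 0 \<Longrightarrow> separable_poly p \<Longrightarrow> \<exists>x. poly p x = 0"
    and sep_alg: "\<And>z. \<exists>p\<in>polys E. p \<noteq> 0 \<and> separable_poly p \<and> poly p z = 0"
    and E: "is_subfield E" and A: "A \<subseteq> V \<inter> E" and x: "x \<in> V \<inter> E"
    and d: "single x 1 \<in> kaehler_relations V A"
  shows "single x 1 \<in> kaehler_relations (V \<inter> E) A"
proof (rule ccontr)
  assume n: "single x 1 \<notin> kaehler_relations (V \<inter> E) A"
  \<comment> \<open>The fields over which dx does not vanish. By \<open>d\<close> the whole field is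
    not among them, so a maximal one could still be enlarged.\<close>
  define Ls where "Ls = {L. is_subfield L \<and> E \<subseteq> L \<and> single x 1 \<notin> kaehler_relations (V \<inter> L) A}"
  have "\<exists>L\<in>Ls. \<forall>L'\<in>Ls. L \<subseteq> L' \<longrightarrow> L' = L"
  proof (rule subset_Zorn_nonempty)
    show "Ls \<noteq> {}" using E n by (auto simp: Ls_def)
  next
    fix Cs assume Cs: "Cs \<noteq> {}" "subset.chain Ls Cs"
    then have CL: "Cs \<subseteq> Ls" and tot: "\<And>M Y. M \<in> Cs \<Longrightarrow> Y \<in> Cs \<Longrightarrow> M \<subseteq> Y \<or> Y \<subseteq> M"
      by (auto simp: subset_chain_def)
    have common: "\<exists>M\<in>Cs. a \<in> M \<and> b \<in> M" if "a \<in> \<Union>Cs" "b \<in> \<Union>Cs" for a b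
      using that tot by (metis UnionE subsetD)
    have sf: "is_subring M" "\<forall>x\<in>M. inverse x \<in> M" if "M \<in> Cs" for M
      using that CL by (auto simp: Ls_def is_subfield_iff)
    have "is_subring (\<Union>Cs)"
    proof -
      have "0 \<in> \<Union>Cs" "1 \<in> \<Union>Cs" using Cs(1) sf(1) subring_0 subring_1 by blast+
      moreover have "a + b \<in> \<Union>Cs \<and> a - b \<in> \<Union>Cs \<and> a * b \<in> \<Union>Cs" if "a \<in> \<Union>Cs" "b \<in> \<Union>Cs" for a b
        using common[OF that] sf(1) subring_add subring_diff subring_mult by (metis UnionI)
      ultimately show ?thesis by (simp add: is_subring_def)
    qed
    then have "is_subfield (\<Union>Cs)" using sf by (auto simp: is_subfield_iff)
    moreover have "E \<subseteq> \<Union>Cs" using Cs(1) CL by (auto simp: Ls_def)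
    moreover have "single x 1 \<notin> kaehler_relations (V \<inter> \<Union>Cs) A"
    proof
      assume "single x 1 \<in> kaehler_relations (V \<inter> \<Union>Cs) A"
      from kaehler_relations_finitary[OF this]
      obtain Y where Y: "Y \<subseteq> V \<inter> \<Union>Cs" "finite Y"
        "\<And>B. Y \<subseteq> B \<Longrightarrow> single x 1 \<in> kaehler_relations B A" by blast
      have "\<exists>M\<in>Cs. Y' \<subseteq> M" if "finite Y'" "Y' \<subseteq> \<Union>Cs" for Y'
        using that Cs(1)
      proof (induction Y')
        case (insert y Y')
        then obtain M M' where "M \<in> Cs" "Y' \<subseteq> M" "M' \<in> Cs" "y \<in> M'" by auto
        then show ?case using tot[of M M'] by blast
      qed auto
      then obtain M where "M \<in> Cs" "Y \<subseteq> M" using Y by blast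
      then show False using Y CL by (auto simp: Ls_def)
    qed
    ultimately show "\<Union>Cs \<in> Ls" by (simp add: Ls_def)
  qed
  then obtain L where Lm: "is_subfield L" "E \<subseteq> L" "single x 1 \<notin> kaehler_relations (V \<inter> L) A"
    and max: "\<And>M. M \<in> Ls \<Longrightarrow> L \<subseteq> M \<Longrightarrow> M = L" by (auto simp: Ls_def)
  interpret separably_closed_extension V L
  proof (intro separably_closed_extension.intro separably_closed_extension_axioms.intro)
    show "valuation_subring V" by unfold_locales
  next
    \<comment> \<open>The minimal polynomial over \<open>L\<close> divides the separable one over
      \<open>E\<close>, and a simple root of a product is a simple root of the factor it
      annihilates.\<close>
    fix z
    obtain P where P: "P \<in> polys E" "P \<noteq> 0" "separable_poly P" "poly P z = 0" using sep_alg by blast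
    have PL: "P \<in> polys L" using P Lm polys_mono by blast
    obtain p where p: "minpoly L z p" using minpoly_exists[OF PL P(2,4)] .
    obtain s where s: "P = s * p" using minpoly_dvd[OF Lm(1) p PL P(4)] .
    have "poly p z = 0" using p by (simp add: minpoly_def)
    then have "poly (pderiv p) z \<noteq> 0"
      using separable_poly_simple_root[OF P(3,4)] by (auto simp: s pderiv_mult)
    with p show "\<exists>p. minpoly L z p \<and> poly (pderiv p) z \<noteq> 0" by blast
  qed (use Lm sep_closed in auto)
  have "L \<noteq> UNIV" using Lm(3) d by auto
  from extension_step[OF this] obtain L' where L': "is_subfield L'" "L \<subset> L'"
    "\<forall>A\<subseteq>V\<inter>L. \<forall>x\<in>V\<inter>L. single x 1 \<in> kaehler_relations (V \<inter> L') A \<longrightarrow>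
      single x 1 \<in> kaehler_relations (V \<inter> L) A" by (elim exE conjE)
  have "A \<subseteq> V \<inter> L" "x \<in> V \<inter> L" using A x Lm by auto
  then have "L' \<in> Ls" using L' Lm by (auto simp: Ls_def)
  then show False using max L' by blast
qed

end

section \<open>Homomorphisms of subfields\<close>

text \<open>An embedding of \<open>E\<close> into the ambient field, as a total function with
  arbitrary values off \<open>E\<close>; extending it then means agreement on
  \<open>E\<close>.\<close>

definition field_hom :: "'a::field set \<Rightarrow> ('a \<Rightarrow> 'a) \<Rightarrow> bool"
  where "field_hom E \<phi> \<longleftrightarrow> \<phi> 1 = 1 \<and> (\<forall>x\<in>E. \<forall>y\<in>E. \<phi> (x + y) = \<phi> x + \<phi> y \<and> \<phi> (x * y) = \<phi> x * \<phi> y)"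

lemma
  assumes "field_hom E \<phi>"
  shows field_hom_1: "\<phi> 1 = 1"
    and field_hom_add: "x \<in> E \<Longrightarrow> y \<in> E \<Longrightarrow> \<phi> (x + y) = \<phi> x + \<phi> y"
    and field_hom_mult: "x \<in> E \<Longrightarrow> y \<in> E \<Longrightarrow> \<phi> (x * y) = \<phi> x * \<phi> y"
  using assms unfolding field_hom_def by auto

lemma field_hom_0: "is_subring E \<Longrightarrow> field_hom E \<phi> \<Longrightarrow> \<phi> 0 = 0"
  using field_hom_add[of E \<phi> 0 0] subring_0[of E] by (metis add_0 add_right_imp_eq)

lemma field_hom_uminus: "is_subring E \<Longrightarrow> field_hom E \<phi> \<Longrightarrow> x \<in> E \<Longrightarrow> \<phi> (- x) = - \<phi> x"
  using field_hom_add[of E \<phi> x "- x"] field_hom_0[of E \<phi>] subring_uminus[of E x]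
  by (simp add: eq_neg_iff_add_eq_0 add.commute)

lemma field_hom_diff: "is_subring E \<Longrightarrow> field_hom E \<phi> \<Longrightarrow> x \<in> E \<Longrightarrow> y \<in> E \<Longrightarrow> \<phi> (x - y) = \<phi> x - \<phi> y"
  using field_hom_add[of E \<phi> x "- y"] field_hom_uminus[of E \<phi> y] subring_uminus[of E y] by simp

lemma field_hom_sum:
  "is_subring E \<Longrightarrow> field_hom E \<phi> \<Longrightarrow> (\<And>i. i \<in> I \<Longrightarrow> f i \<in> E) \<Longrightarrow> \<phi> (sum f I) = (\<Sum>i\<in>I. \<phi> (f i))"
  by (induction I rule: infinite_finite_induct) (auto simp: field_hom_0 field_hom_add subring_sum)

lemma field_hom_eq_0:
  assumes E: "is_subfield E" and \<phi>: "field_hom E \<phi>" and x: "x \<in> E" "\<phi> x = 0"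
  shows "x = 0"
proof (rule ccontr)
  assume "x \<noteq> 0"
  then have "\<phi> x * \<phi> (inverse x) = 1"
    using field_hom_mult[OF \<phi> x(1) subfield_inverse[OF E x(1)]] field_hom_1[OF \<phi>] by simp
  then show False using x by simp
qed

lemma field_hom_inj_on:
  assumes E: "is_subfield E" and \<phi>: "field_hom E \<phi>"
  shows "inj_on \<phi> E"
proof (rule inj_onI)
  fix x y assume xy: "x \<in> E" "y \<in> E" "\<phi> x = \<phi> y"
  have "\<phi> (x - y) = 0" using field_hom_diff[OF subfield_subring[OF E] \<phi> xy(1,2)] xy by simp
  from field_hom_eq_0[OF E \<phi> subring_diff[OF subfield_subring[OF E] xy(1,2)] this]
  show "x = y" by simp
qed

lemma field_hom_subset: "field_hom E \<phi> \<Longrightarrow> F \<subseteq> E \<Longrightarrow> field_hom F \<phi>"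
  unfolding field_hom_def by blast

lemma field_hom_cong: "is_subring E \<Longrightarrow> field_hom E \<phi> \<Longrightarrow> (\<And>x. x \<in> E \<Longrightarrow> \<psi> x = \<phi> x) \<Longrightarrow> field_hom E \<psi>"
  unfolding field_hom_def by (auto simp: subring_1 subring_add subring_mult)

lemma map_poly_field_hom:
  assumes E: "is_subring E" and \<phi>: "field_hom E \<phi>" and p: "p \<in> polys E" and q: "q \<in> polys E"
  shows "map_poly \<phi> (p + q) = map_poly \<phi> p + map_poly \<phi> q"
    and "map_poly \<phi> (p * q) = map_poly \<phi> p * map_poly \<phi> q"
  using coeff_in_polys[OF p] coeff_in_polys[OF q] field_hom_0[OF E \<phi>]
  by (auto intro!: poly_eqI sum.cong simp: coeff_map_poly coeff_mult field_hom_add[OF \<phi>]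
    field_hom_mult[OF \<phi>]
      field_hom_sum[OF E \<phi>] subring_mult[OF E])

lemma field_hom_poly:
  assumes E: "is_subring E" and \<phi>: "field_hom E \<phi>" and p: "p \<in> polys E" and x: "x \<in> E"
  shows "\<phi> (poly p x) = poly (map_poly \<phi> p) (\<phi> x)"
  using p
proof (induction p)
  case 0
  then show ?case by (simp add: field_hom_0[OF E \<phi>])
next
  case (pCons a p)
  then have "a \<in> E" "p \<in> polys E" by auto
  then show ?case using x pCons
    by (simp add: map_poly_pCons field_hom_0[OF E \<phi>] field_hom_add[OF \<phi>] field_hom_mult[OF \<phi>]
        subring_mult[OF E] polys_poly[OF E])
qed

lemma map_poly_fixed: "\<phi> 0 = 0 \<Longrightarrow> (\<And>x. x \<in> K \<Longrightarrow> \<phi> x = x) \<Longrightarrow> p \<in> polys K \<Longrightarrow> map_poly \<phi> p = p"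
  by (intro poly_eqI) (auto simp: coeff_map_poly coeff_in_polys)

lemma field_hom_root:
  assumes E: "is_subring E" and \<phi>: "field_hom E \<phi>" "\<And>x. x \<in> K \<Longrightarrow> \<phi> x = x"
    and p: "p \<in> polys K" "K \<subseteq> E" and x: "x \<in> E" "poly p x = 0"
  shows "poly p (\<phi> x) = 0"
  using field_hom_poly[OF E \<phi>(1) _ x(1), of p] polys_mono[OF p(2)] p x
    map_poly_fixed[of \<phi> K p] \<phi> field_hom_0[OF E \<phi>(1)] by auto

text \<open>The value at q(z) is the image of \<open>q\<close> evaluated at \<open>y\<close>. Two
  choices of \<open>q\<close> differ by a multiple of \<open>p\<close>, whose image vanishes at
  \<open>y\<close>.\<close>

lemma extend_field_hom:
  assumes E: "is_subfield E" and \<phi>: "field_hom E \<phi>" and p: "minpoly E z p"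
    and y: "poly (map_poly \<phi> p) y = 0"
  obtains \<psi> where "field_hom (adjoin E z) \<psi>" "\<And>x. x \<in> E \<Longrightarrow> \<psi> x = \<phi> x" "\<psi> z = y"
proof -
  note R = subfield_subring[OF E]
  note P = is_subring_polys[OF R]
  define \<psi> where "\<psi> u = poly (map_poly \<phi> (SOME q. q \<in> polys E \<and> poly q z = u)) y" for u
  have pE: "p \<in> polys E" using p by (simp add: minpoly_def)
  have \<psi>: "\<psi> (poly q z) = poly (map_poly \<phi> q) y" if q: "q \<in> polys E" for q
  proof -
    define q' where "q' = (SOME q'. q' \<in> polys E \<and> poly q' z = poly q z)"
    have "q' \<in> polys E \<and> poly q' z = poly q z" unfolding q'_def
      by (rule someI[of _ q]) (simp add: q)
    then have q': "q' \<in> polys E" "poly (q' - q) z = 0" by auto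
    then obtain s where s: "s \<in> polys E" "q' - q = s * p"
      using minpoly_dvd[OF E p subring_diff[OF P q'(1) q]] by blast
    have "q' = s * p + q" using s by (simp add: algebra_simps)
    then have "map_poly \<phi> q' = map_poly \<phi> s * map_poly \<phi> p + map_poly \<phi> q"
      using s pE q subring_mult[OF P] by (simp add: map_poly_field_hom[OF R \<phi>])
    then show ?thesis using y by (simp add: \<psi>_def q'_def)
  qed
  have base: "\<psi> x = \<phi> x" if "x \<in> E" for x
    using \<psi>[of "[:x:]"] that R by (simp add: map_poly_pCons field_hom_0[OF R \<phi>])
  show ?thesis
  proof
    show "field_hom (adjoin E z) \<psi>"
      unfolding field_hom_def
    proof (intro conjI ballI)
      show "\<psi> 1 = 1" using base[OF subring_1[OF R]] field_hom_1[OF \<phi>] by simp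
      fix x x' assume "x \<in> adjoin E z" "x' \<in> adjoin E z"
      then obtain q q' where q: "q \<in> polys E" "x = poly q z" "q' \<in> polys E" "x' = poly q' z"
        by (auto simp: adjoin_def)
      show "\<psi> (x + x') = \<psi> x + \<psi> x'"
        using \<psi>[OF subring_add[OF P q(1,3)]] \<psi>[OF q(1)] \<psi>[OF q(3)] q
        by (simp add: map_poly_field_hom[OF R \<phi>])
      show "\<psi> (x * x') = \<psi> x * \<psi> x'"
        using \<psi>[OF subring_mult[OF P q(1,3)]] \<psi>[OF q(1)] \<psi>[OF q(3)] q
        by (simp add: map_poly_field_hom[OF R \<phi>])
    qed
    show "\<psi> z = y"
      using \<psi>[of "[:0,1:]"] R subring_0[OF R] subring_1[OF R]
      by (simp add: map_poly_pCons field_hom_0[OF R \<phi>] field_hom_1[OF \<phi>])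
  qed (rule base)
qed

lemma split_poly_root: "poly (smult c (\<Prod>r\<leftarrow>rs. [:- r, 1:])) x = 0 \<longleftrightarrow> c = (0::'a::field) \<or> x \<in> set rs"
  by (induction rs) auto

lemma splits_over_roots:
  assumes "splits_over UNIV p" "p \<noteq> 0" "\<And>r. poly p r = 0 \<Longrightarrow> r \<in> L"
  shows "splits_over L p"
proof -
  obtain c rs where rs: "p = smult c (\<Prod>r\<leftarrow>rs. [:- r, 1:])" using assms(1)
    by (auto simp: splits_over_def)
  have "poly p r = 0" if "r \<in> set rs" for r
    using that unfolding rs split_poly_root by simp
  then have "set rs \<subseteq> L" using assms(3) by blast
  then show ?thesis using rs by (auto simp: splits_over_def)
qed

lemma separable_poly_divisor:
  assumes "separable_poly (f * g)" shows "separable_poly (f::'a::field poly)"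
  unfolding separable_poly_def
proof (rule coprimeI)
  fix d assume d: "d dvd f" "d dvd pderiv f"
  then have "d dvd f * g" "d dvd pderiv (f * g)" by (simp_all add: pderiv_mult)
  then show "is_unit d" using assms unfolding separable_poly_def
    by (rule coprime_common_divisor[rotated])
qed

lemma separable_poly_splits:
  assumes "\<And>p :: 'a::field poly. degree p > 0 \<Longrightarrow> separable_poly p \<Longrightarrow> \<exists>x. poly p x = 0"
    and "separable_poly (p :: 'a poly)"
  shows "splits_over UNIV p"
  using assms(2)
proof (induction "degree p" arbitrary: p)
  case 0
  then obtain c where "p = [:c:]" using degree_eq_zeroE by metis
  then have "p = smult c (\<Prod>r\<leftarrow>[]. [:- r, 1:])" by simp
  then show ?case unfolding splits_over_def by blast
next
  case (Suc n)
  obtain x where "poly p x = 0" using assms(1)[of p] Suc by auto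
  then obtain s where s: "p = s * [:- x, 1:]" by (metis poly_eq_0_iff_dvd dvdE mult.commute)
  have "s \<noteq> 0" using s Suc by auto
  then have "degree p = degree s + 1" unfolding s by (subst degree_mult_eq) auto
  then have "splits_over UNIV s" using Suc s separable_poly_divisor
    by (metis Suc_eq_plus1 Suc_inject)
  then obtain c rs where "s = smult c (\<Prod>r\<leftarrow>rs. [:- r, 1:])" by (auto simp: splits_over_def)
  then have "p = smult c (\<Prod>r\<leftarrow>x # rs. [:- r, 1:])" unfolding s
    by (simp only: list.simps prod_list.Cons mult_smult_left mult_smult_right mult.commute)
  then show ?case unfolding splits_over_def by blast
qed

lemma minimal_polynomial_iff:
  "is_subring K \<Longrightarrow> minimal_polynomial K x p \<longleftrightarrow> lead_coeff p = 1 \<and> minpoly K x p"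
  by (auto simp: minimal_polynomial_def minpoly_def coeffs_subset_iff)

lemma finite_galois_extensionD:
  assumes "finite_galois_extension K L"
  shows "is_subfield L" "K \<subseteq> L"
  using assms by (auto simp: finite_galois_extension_def galois_extension_def
    separable_extension_def)

section \<open>Galois theory inside a separable closure\<close>

lemma subalgebra_of_subring:
  assumes "is_subring W" "K \<subseteq> W"
  shows "subalgebra K W ring_of_type_algebra"
proof (intro subalgebra.intro subalgebra_axioms.intro)
  show "subgroup W (add_monoid ring_of_type_algebra)"
    using assms(1) unfolding subring_type_algebra_iff[symmetric] by (rule subring.axioms(1))
  show "k \<otimes>\<^bsub>ring_of_type_algebra\<^esub> v \<in> W" if "k \<in> K" "v \<in> W" for k v
    using subring_mult[OF assms(1), of k v] assms(2) that by (auto simp: ring_of_type_algebra_def)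
qed

locale separable_closure_base =
  fixes K :: "'a::field set"
  assumes K: "is_subfield K" and closure: "separable_closure K UNIV"
begin

lemmas KR = subfield_subring[OF K]

lemma sep_closed: "degree p > 0 \<Longrightarrow> separable_poly p \<Longrightarrow> \<exists>x::'a. poly p x = 0"
  using closure by (auto simp: separable_closure_def)

lemma separable_minpoly:
  obtains p where "minimal_polynomial K x p" "minpoly K x p" "separable_poly p" "splits_over UNIV p"
proof -
  obtain p where p: "minimal_polynomial K x p" "separable_poly p"
    using closure by (auto simp: separable_closure_def separable_extension_def separable_over_def)
  then show ?thesis using that[of p] minimal_polynomial_iff[OF KR] separable_poly_splits sep_closed
    by metis
qed

text \<open>The minimal polynomial over \<open>E\<close> divides the one over \<open>K\<close>,
  whose coefficients are fixed; so its image divides a separable polynomial and has a root.\<close>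

lemma extend_field_hom_element:
  assumes E: "is_subfield E" "K \<subseteq> E" and \<phi>: "field_hom E \<phi>" "\<And>x. x \<in> K \<Longrightarrow> \<phi> x = x"
  obtains F \<psi> where "is_subfield F" "E \<subseteq> F" "z \<in> F" "field_hom F \<psi>" "\<And>x. x \<in> E \<Longrightarrow> \<psi> x = \<phi> x"
proof -
  note R = subfield_subring[OF E(1)]
  obtain P where P: "minpoly K z P" "separable_poly P" using separable_minpoly by metis
  have PK: "P \<in> polys K" "P \<noteq> 0" "poly P z = 0" using P by (auto simp: minpoly_def)
  have PE: "P \<in> polys E" using PK polys_mono[OF E(2)] by blast
  obtain p where p: "minpoly E z p" using minpoly_exists[OF PE PK(2,3)] .
  have pE: "p \<in> polys E" "p \<noteq> 0" "poly p z = 0" using p by (auto simp: minpoly_def)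
  obtain s where s: "s \<in> polys E" "P = s * p" using minpoly_dvd[OF E(1) p PE PK(3)] .
  have "P = map_poly \<phi> P" using map_poly_fixed[of \<phi> K P] field_hom_0[OF R \<phi>(1)] \<phi>(2) PK by simp
  also have "\<dots> = map_poly \<phi> p * map_poly \<phi> s"
    unfolding s using map_poly_field_hom(2)[OF R \<phi>(1)] s pE by simp
  finally have "separable_poly (map_poly \<phi> p)" using P(2) separable_poly_divisor by metis
  moreover have "degree (map_poly \<phi> p) = degree p"
  proof (rule map_poly_degree_eq)
    show "\<phi> (lead_coeff p) \<noteq> 0"
      using field_hom_eq_0[OF E(1) \<phi>(1) coeff_in_polys[OF pE(1)]] pE(2) leading_coeff_0_iff by blast
  qed
  ultimately obtain y where y: "poly (map_poly \<phi> p) y = 0"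
    using sep_closed minpoly_degree_pos[OF p] by metis
  obtain \<psi> where \<psi>: "field_hom (adjoin E z) \<psi>" "\<And>x. x \<in> E \<Longrightarrow> \<psi> x = \<phi> x"
    using extend_field_hom[OF E(1) \<phi>(1) p y] by blast
  show ?thesis
    using that[OF is_subfield_adjoin[OF E(1) pE] subset_adjoin[OF R] gen_in_adjoin[OF R] \<psi>] .
qed

lemma extend_field_hom_finite:
  assumes "finite Z" and E: "is_subfield E" "K \<subseteq> E" and \<phi>: "field_hom E \<phi>" "\<And>x. x \<in> K \<Longrightarrow> \<phi> x = x"
  shows "\<exists>F \<psi>. is_subfield F \<and> E \<subseteq> F \<and> Z \<subseteq> F \<and> field_hom F \<psi> \<and> (\<forall>x\<in>E. \<psi> x = \<phi> x)"
  using assms(1)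
proof (induction Z)
  case empty
  then show ?case using E \<phi> by blast
next
  case (insert z Z)
  then obtain F \<psi> where F: "is_subfield F" "E \<subseteq> F" "Z \<subseteq> F" "field_hom F \<psi>" "\<forall>x\<in>E. \<psi> x = \<phi> x"
    by blast
  have "K \<subseteq> F" "\<And>x. x \<in> K \<Longrightarrow> \<psi> x = x" using E F \<phi>(2) by auto
  from extend_field_hom_element[OF F(1) this(1) F(4) this(2), of z]
  obtain F' \<psi>' where "is_subfield F'" "F \<subseteq> F'" "z \<in> F'" "field_hom F' \<psi>'" "\<And>x. x \<in> F \<Longrightarrow> \<psi>' x = \<psi> x"
    by metis
  then show ?case using F by (intro exI[of _ F'] exI[of _ \<psi>']) auto
qed

text \<open>Reaching a finite set \<open>Z\<close> is enough, since \<open>Z\<close> will generate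
  the finite extension in question; no automorphism of the whole closure is constructed.\<close>

lemma conjugation_hom:
  assumes x: "minpoly K x p" "poly p y = 0" and Z: "finite Z"
  obtains F \<psi> where "is_subfield F" "K \<subseteq> F" "x \<in> F" "Z \<subseteq> F" "field_hom F \<psi>" "\<forall>u\<in>K. \<psi> u = u"
    "\<psi> x = y"
proof -
  have id: "field_hom K (\<lambda>u. u)" "map_poly (\<lambda>u. u) p = p" by (simp_all add: field_hom_def map_poly_def)
  then obtain \<phi> where \<phi>: "field_hom (adjoin K x) \<phi>" "\<And>u. u \<in> K \<Longrightarrow> \<phi> u = u" "\<phi> x = y"
    using extend_field_hom[OF K id(1) x(1), of y] x(2) by auto
  have Kx: "is_subfield (adjoin K x)" using x(1)
    by (intro is_subfield_adjoin[OF K]) (auto simp: minpoly_def)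
  obtain F \<psi> where "is_subfield F" "adjoin K x \<subseteq> F" "Z \<subseteq> F" "field_hom F \<psi>"
    "\<forall>u\<in>adjoin K x. \<psi> u = \<phi> u"
    using extend_field_hom_finite[OF Z Kx subset_adjoin[OF KR] \<phi>(1,2)] by metis
  then show ?thesis using that[of F \<psi>] \<phi> gen_in_adjoin[OF KR, of x] subset_adjoin[OF KR, of x]
    by (auto simp: subset_iff)
qed

lemma galois_group_iff:
  assumes "is_subring L"
  shows "\<sigma> \<in> galois_group K L \<longleftrightarrow>
    \<sigma> \<in> extensional L \<and> field_hom L \<sigma> \<and> bij_betw \<sigma> L L \<and> (\<forall>x\<in>K. \<sigma> x = x)"
proof -
  have "ring_hom (subring_of L) (subring_of L) = {\<sigma>. \<sigma> \<in> L \<rightarrow> L \<and> field_hom L \<sigma>}"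
    by (auto simp: ring_hom_def subring_of_def ring_of_type_algebra_def field_hom_def)
  then show ?thesis
    by (auto simp: galois_group_def ring_iso_def subring_of_def bij_betw_def
      ring_of_type_algebra_def)
qed

text \<open>Normality puts each element of \<open>L\<close> into a finite set of conjugates inside
  \<open>L\<close>. An injective map of this set to itself is onto, so \<open>L\<close> is mapped
  onto \<open>L\<close>.\<close>

lemma restrict_in_galois_group:
  assumes L: "galois_extension K L" and F: "is_subfield F" "L \<subseteq> F" and \<psi>: "field_hom F \<psi>"
    "\<And>u. u \<in> K \<Longrightarrow> \<psi> u = u"
  shows "restrict \<psi> L \<in> galois_group K L"
proof -
  have Ls: "is_subfield L" "K \<subseteq> L" using L by (auto simp: galois_extension_def
    separable_extension_def)
  note LR = subfield_subring[OF Ls(1)]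
  have \<psi>L: "field_hom L \<psi>" using \<psi>(1) F(2) by (rule field_hom_subset)
  have "\<exists>R\<subseteq>L. finite R \<and> u \<in> R \<and> \<psi> ` R \<subseteq> R" if u: "u \<in> L" for u
  proof -
    obtain p where p: "minimal_polynomial K u p" "minpoly K u p" using separable_minpoly by metis
    then have pK: "p \<in> polys K" "p \<noteq> 0" "poly p u = 0" by (auto simp: minpoly_def)
    have "splits_over L p" using L p u by (auto simp: galois_extension_def)
    then obtain c rs where rs: "set rs \<subseteq> L" "p = smult c (\<Prod>r\<leftarrow>rs. [:- r, 1:])"
      by (auto simp: splits_over_def)
    have "c \<noteq> 0" using rs pK by auto
    then have roots: "{r. poly p r = 0} = set rs"
      unfolding rs(2) split_poly_root by simp
    then have "\<psi> ` set rs \<subseteq> set rs"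
      using field_hom_root[OF LR \<psi>L \<psi>(2) pK(1) Ls(2)] rs(1) by blast
    then show ?thesis using rs(1) roots pK by (intro exI[of _ "set rs"]) auto
  qed
  then obtain R where R: "\<And>u. u \<in> L \<Longrightarrow> R u \<subseteq> L \<and> finite (R u) \<and> u \<in> R u \<and> \<psi> ` R u \<subseteq> R u" by metis
  have inj: "inj_on \<psi> L" by (rule field_hom_inj_on[OF Ls(1) \<psi>L])
  have "\<psi> ` L = L"
  proof
    show "\<psi> ` L \<subseteq> L" using R by blast
    show "L \<subseteq> \<psi> ` L"
    proof
      fix u assume u: "u \<in> L"
      have "\<psi> ` R u = R u" using R[OF u] inj by (intro endo_inj_surj) (auto intro: inj_on_subset)
      then show "u \<in> \<psi> ` L" using R[OF u] by blast
    qed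
  qed
  with inj have "bij_betw (restrict \<psi> L) L L" by (simp add: bij_betw_def inj_on_restrict_eq)
  moreover have "field_hom L (restrict \<psi> L)" by (rule field_hom_cong[OF LR \<psi>L]) simp
  ultimately show ?thesis using Ls \<psi>(2) by (auto simp: galois_group_iff[OF LR])
qed

text \<open>Finite dimension is used as finite generation, phrased by subrings so that it can be
  tested on sets such as the locus where two automorphisms agree.\<close>

lemma finite_dimension_generators:
  assumes "ring.finite_dimension ring_of_type_algebra K L"
  obtains Z where "finite Z" "Z \<subseteq> L" "\<forall>W. is_subring W \<longrightarrow> K \<subseteq> W \<longrightarrow> Z \<subseteq> W \<longrightarrow> L \<subseteq> W"
proof -
  interpret U: field "ring_of_type_algebra :: 'a ring" by (rule field_from_type_algebra)
  obtain Vs where "U.Span K Vs = L" "set Vs \<subseteq> carrier ring_of_type_algebra"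
    using assms U.exists_base[OF K] by (auto simp: U.finite_dimension_def)
  then show ?thesis
    using that[of "set Vs"] U.Span_base_incl[OF K] U.subalgebra_Span_incl[OF K subalgebra_of_subring] by auto
qed

text \<open>If \<open>x\<close> is not in \<open>K\<close>, separability gives its minimal
  polynomial a root \<open>y\<close> different from \<open>x\<close>, and a homomorphism taking
  \<open>x\<close> to \<open>y\<close>, restricted to \<open>L\<close>, moves
  \<open>x\<close>.\<close>

lemma galois_fixed_field:
  assumes L: "finite_galois_extension K L" and x: "x \<in> L" "\<And>\<sigma>. \<sigma> \<in> galois_group K L \<Longrightarrow> \<sigma> x = x"
  shows "x \<in> K"
proof (rule ccontr)
  assume xK: "x \<notin> K"
  have Lg: "galois_extension K L" and Ls: "is_subfield L" "K \<subseteq> L"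
    using L by (auto simp: finite_galois_extension_def galois_extension_def separable_extension_def)
  obtain p where p: "minimal_polynomial K x p" "minpoly K x p" "separable_poly p"
    using separable_minpoly by metis
  have pK: "p \<in> polys K" "p \<noteq> 0" "poly p x = 0" "lead_coeff p = 1"
    using p minimal_polynomial_iff[OF KR] by (auto simp: minpoly_def)
  obtain s where s: "p = [:- x, 1:] * s" using pK(3) by (auto simp: poly_eq_0_iff_dvd elim: dvdE)
  have s0: "s \<noteq> 0" using s pK by auto
  have "degree s > 0"
  proof (rule ccontr)
    assume "\<not> ?thesis"
    then obtain c where c: "s = [:c:]" using degree_eq_zeroE by blast
    then have "c = 1" using pK(4) s s0 by (auto simp: lead_coeff_mult)
    then have "coeff p 0 = - x" using s c by simp
    then have "- (- x) \<in> K" using coeff_in_polys[OF pK(1), of 0] subring_uminus[OF KR] by metis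
    then show False using xK by simp
  qed
  moreover have "separable_poly s"
    using p(3) separable_poly_divisor[of s "[:- x, 1:]"] s by (simp only: mult.commute)
  ultimately obtain y where y: "poly s y = 0" using sep_closed by blast
  have "poly (pderiv p) x = poly s x" unfolding s pderiv_mult by (simp add: pderiv_pCons)
  then have "poly s x \<noteq> 0" using separable_poly_simple_root[OF p(3) pK(3)] by simp
  then have yx: "y \<noteq> x" using y by auto
  have "ring.finite_dimension ring_of_type_algebra K L" using L
    by (simp add: finite_galois_extension_def)
  then obtain Z where Z: "finite Z" "Z \<subseteq> L" "\<forall>W. is_subring W \<longrightarrow> K \<subseteq> W \<longrightarrow> Z \<subseteq> W \<longrightarrow> L \<subseteq> W"
    by (rule finite_dimension_generators)
  have "poly p y = 0" using y s by simp
  from conjugation_hom[OF p(2) this Z(1)]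
  obtain F \<psi> where F: "is_subfield F" "K \<subseteq> F" "x \<in> F" "Z \<subseteq> F" "field_hom F \<psi>"
    "\<forall>u\<in>K. \<psi> u = u" "\<psi> x = y" .
  note FR = subfield_subring[OF F(1)]
  have "L \<subseteq> F" using Z(3) FR F(2,4) by blast
  from restrict_in_galois_group[OF Lg F(1) this F(5) F(6)[rule_format]] have "restrict \<psi> L x = x"
    by (rule x(2))
  then show False using x(1) F(7) yx by simp
qed

lemma finite_galois_group:
  assumes L: "finite_galois_extension K L"
  shows "finite (galois_group K L)"
proof -
  note Ls = finite_galois_extensionD[OF L]
  note LR = subfield_subring[OF Ls(1)]
  have "ring.finite_dimension ring_of_type_algebra K L" using L
    by (simp add: finite_galois_extension_def)
  then obtain Z where Z: "finite Z" "Z \<subseteq> L" "\<forall>W. is_subring W \<longrightarrow> K \<subseteq> W \<longrightarrow> Z \<subseteq> W \<longrightarrow> L \<subseteq> W"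
    by (rule finite_dimension_generators)
  have "\<exists>R. finite R \<and> (\<forall>\<sigma>\<in>galois_group K L. \<sigma> z \<in> R)" if z: "z \<in> Z" for z
  proof -
    obtain p where p: "minpoly K z p" using separable_minpoly by metis
    then have p': "p \<in> polys K" "p \<noteq> 0" "poly p z = 0" by (auto simp: minpoly_def)
    have "poly p (\<sigma> z) = 0" if "\<sigma> \<in> galois_group K L" for \<sigma>
      using that z Z(2) p' Ls(2)
      by (intro field_hom_root[OF LR, of \<sigma> K]) (auto simp: galois_group_iff[OF LR])
    then show ?thesis using p'(2) poly_roots_finite by (intro exI[of _ "{r. poly p r = 0}"]) auto
  qed
  then obtain R where R: "\<And>z. z \<in> Z \<Longrightarrow> finite (R z) \<and> (\<forall>\<sigma>\<in>galois_group K L. \<sigma> z \<in> R z)" by metis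
  have "inj_on (\<lambda>\<sigma>. restrict \<sigma> Z) (galois_group K L)"
  proof (rule inj_onI)
    fix \<sigma> \<tau> assume st: "\<sigma> \<in> galois_group K L" "\<tau> \<in> galois_group K L" "restrict \<sigma> Z = restrict \<tau> Z"
    have h: "field_hom L \<sigma>" "field_hom L \<tau>" "\<And>x. x \<in> K \<Longrightarrow> \<sigma> x = x" "\<And>x. x \<in> K \<Longrightarrow> \<tau> x = x"
      "\<sigma> \<in> extensional L" "\<tau> \<in> extensional L"
      using st by (auto simp: galois_group_iff[OF LR])
    have "L \<subseteq> {u \<in> L. \<sigma> u = \<tau> u}"
    proof (intro Z(3)[rule_format] is_subringI)
      show "x + y \<in> {u \<in> L. \<sigma> u = \<tau> u}" "x * y \<in> {u \<in> L. \<sigma> u = \<tau> u}"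
        if "x \<in> {u \<in> L. \<sigma> u = \<tau> u}" "y \<in> {u \<in> L. \<sigma> u = \<tau> u}" for x y
        using that h(1,2) by (simp_all add: field_hom_add field_hom_mult subring_add[OF LR] subring_mult[OF LR])
      show "Z \<subseteq> {u \<in> L. \<sigma> u = \<tau> u}"
      proof
        fix z assume z: "z \<in> Z"
        have "restrict \<sigma> Z z = restrict \<tau> Z z" using st(3) by simp
        then show "z \<in> {u \<in> L. \<sigma> u = \<tau> u}" using z Z(2) by auto
      qed
    qed (use h(1,2) in \<open>auto simp: field_hom_0[OF LR] field_hom_1 field_hom_uminus[OF LR] h(3,4)
        subring_0[OF LR] subring_1[OF LR] subring_uminus[OF LR] subsetD[OF Ls(2)]\<close>)
    then show "\<sigma> = \<tau>" using extensionalityI[OF h(5,6)] by blast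
  qed
  moreover have "finite (PiE Z R)" using Z R by (intro finite_PiE) auto
  moreover have "(\<lambda>\<sigma>. restrict \<sigma> Z) ` galois_group K L \<subseteq> PiE Z R"
    using R by auto
  ultimately show ?thesis by (meson finite_imageD finite_subset)
qed

lemma identity_in_galois_group: "is_subfield L \<Longrightarrow> K \<subseteq> L \<Longrightarrow> restrict (\<lambda>x. x) L \<in> galois_group K L"
  by (auto simp: galois_group_iff subfield_subring field_hom_def bij_betw_def inj_on_def
      subring_add subring_mult subring_1)

text \<open>Here \<rho> is the inverse of \<tau> composed with \<sigma>. In this form, applying
  \<tau> to a relation at \<rho> gives one at \<sigma>.\<close>

lemma galois_group_inverse_comp:
  assumes L: "is_subfield L" "K \<subseteq> L" and \<sigma>: "\<sigma> \<in> galois_group K L" and \<tau>: "\<tau> \<in> galois_group K L"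
  shows "\<exists>\<rho>\<in>galois_group K L. \<forall>x\<in>L. \<tau> (\<rho> x) = \<sigma> x"
proof -
  let ?R = "subring_of L"
  have iso: "\<sigma> \<in> ring_iso ?R ?R" "\<tau> \<in> ring_iso ?R ?R" and fx: "\<And>x. x \<in> K \<Longrightarrow> \<sigma> x = x" "\<And>x. x \<in> K \<Longrightarrow> \<tau> x = x"
    using \<sigma> \<tau> by (auto simp: galois_group_def)
  have carr: "carrier ?R = L" by (simp add: subring_of_def)
  interpret U: cring "ring_of_type_algebra :: 'a ring" by (rule cring_from_type_algebra)
  interpret R: ring ?R unfolding subring_of_def
    by (rule U.subring_is_ring) (simp add: subring_type_algebra_iff subfield_subring[OF L(1)])
  define \<rho> where "\<rho> = restrict (inv_into L \<tau> \<circ> \<sigma>) L"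
  have bij: "bij_betw \<sigma> L L" "bij_betw \<tau> L L" using iso by (auto simp: ring_iso_def carr)
  have "\<rho> \<in> ring_iso ?R ?R"
    by (rule R.ring_iso_restrict[OF ring_iso_set_trans[OF iso(1) ring_iso_set_sym[OF R.ring_axioms iso(2)]]])
      (simp add: \<rho>_def carr)
  moreover have "\<rho> x = x" if "x \<in> K" for x
    using that L(2) fx bij_betw_inv_into_left[OF bij(2), of x] by (auto simp: \<rho>_def)
  ultimately have "\<rho> \<in> galois_group K L" by (auto simp: galois_group_def \<rho>_def)
  moreover have "\<tau> (\<rho> x) = \<sigma> x" if "x \<in> L" for x
    using that bij bij_betw_inv_into_right[OF bij(2), of "\<sigma> x"] by (auto simp: \<rho>_def bij_betw_def)
  ultimately show ?thesis by blast
qed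

lemma splitting_field:
  obtains L where "is_subfield L" "K \<subseteq> L" "set rs \<subseteq> L"
    "ring.finite_dimension ring_of_type_algebra K L"
    "\<forall>W. is_subring W \<longrightarrow> K \<subseteq> W \<longrightarrow> set rs \<subseteq> W \<longrightarrow> L \<subseteq> W"
proof -
  interpret U: field "ring_of_type_algebra :: 'a ring" by (rule field_from_type_algebra)
  have sel: "carrier ring_of_type_algebra = (UNIV :: 'a set)" "monoid.mult ring_of_type_algebra = ((*) :: 'a \<Rightarrow> _)"
    "add ring_of_type_algebra = ((+) :: 'a \<Rightarrow> _)" "\<zero>\<^bsub>ring_of_type_algebra\<^esub> = (0 :: 'a)"
    by (simp_all add: ring_of_type_algebra_def)
  have carr: "B \<subseteq> carrier ring_of_type_algebra" for B :: "'a set"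
    by (simp add: sel)
  have Ks: "subring K ring_of_type_algebra" using KR by (simp add: subring_type_algebra_iff)
  have algebraic: "(U.algebraic over K) r" for r
  proof -
    obtain p where p: "minpoly K r p" using separable_minpoly by metis
    have "U.eval (rev (coeffs q)) r = poly q r" for q
    proof (induction q)
      case (pCons a q)
      have "coeffs (pCons a q) = a # coeffs q" using pCons.hyps by (auto simp: cCons_def)
      then show ?case using U.eval_append_aux[of "rev (coeffs q)" a r] pCons.IH
        by (simp add: sel algebra_simps)
    qed (simp add: sel)
    moreover have "set (rev (coeffs p)) \<subseteq> K" "lead_coeff p \<noteq> 0" "coeffs p \<noteq> []"
      using p coeffs_subset_iff[OF KR] by (auto simp: minpoly_def)
    ultimately show ?thesis using p
      by (intro U.algebraicI[of "rev (coeffs p)"])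
        (auto simp: minpoly_def univ_poly_def polynomial_def hd_rev last_coeffs_eq_coeff_degree sel)
  qed
  let ?L = "U.finite_extension K rs"
  have "?L \<subseteq> W" if "is_subring W" "K \<subseteq> W" "set rs \<subseteq> W" for W
    using that by (intro U.finite_extension_subring_incl) (simp_all add: subring_type_algebra_iff)
  then show ?thesis
    using U.finite_extension_is_subfield[OF K carr algebraic]
      U.finite_extension_finite_dimension(1)[OF K carr algebraic]
    by (intro that[of ?L] U.finite_extension_incl U.finite_extension_mem Ks carr) blast+
qed

lemma finite_galois_extension_containing:
  obtains L where "finite_galois_extension K L" "x \<in> L"
proof -
  obtain P where P: "minpoly K x P" "splits_over UNIV P" using separable_minpoly by metis
  have PK: "P \<in> polys K" "P \<noteq> 0" "poly P x = 0" using P by (auto simp: minpoly_def)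
  obtain c rs where rs: "P = smult c (\<Prod>r\<leftarrow>rs. [:- r, 1:])" using P(2) by (auto simp: splits_over_def)
  have "c \<noteq> 0" using rs PK by auto
  then have roots: "poly P r = 0 \<longleftrightarrow> r \<in> set rs" for r
    unfolding rs split_poly_root by simp
  obtain L where L: "is_subfield L" "K \<subseteq> L" "set rs \<subseteq> L"
    "ring.finite_dimension ring_of_type_algebra K L"
    "\<forall>W. is_subring W \<longrightarrow> K \<subseteq> W \<longrightarrow> set rs \<subseteq> W \<longrightarrow> L \<subseteq> W"
    by (rule splitting_field)
  note LR = subfield_subring[OF L(1)]
  have "splits_over L p" if y: "y \<in> L" and p: "minimal_polynomial K y p" for y p
  proof (rule splits_over_roots)
    have pm: "minpoly K y p" using p minimal_polynomial_iff[OF KR] by simp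
    then show p0: "p \<noteq> 0" by (simp add: minpoly_def)
    obtain q where q: "minpoly K y q" "separable_poly q" using separable_minpoly by metis
    then obtain t where "q = t * p" using minpoly_dvd[OF K pm] unfolding minpoly_def by metis
    then have "separable_poly p" using q(2) separable_poly_divisor[of p t]
      by (simp add: mult.commute)
    then show "splits_over UNIV p" using separable_poly_splits sep_closed by blast
    show "r \<in> L" if r: "poly p r = 0" for r
    proof -
      obtain F \<psi> where F: "is_subfield F" "K \<subseteq> F" "y \<in> F" "set rs \<subseteq> F" "field_hom F \<psi>"
        "\<forall>u\<in>K. \<psi> u = u" "\<psi> y = r"
        using conjugation_hom[OF pm r finite_set[of rs]] .
      note FR = subfield_subring[OF F(1)]
      \<comment> \<open>Normality: the part of \<open>F\<close> mapped into \<open>L\<close> is a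
        ring containing \<open>K\<close> and the roots of \<open>P\<close>, which go to roots again.
        So it contains \<open>L\<close>, and in particular \<open>y\<close>.\<close>
      define W where "W = {u \<in> F. \<psi> u \<in> L}"
      have "is_subring W"
      proof (rule is_subringI)
        show "0 \<in> W" "1 \<in> W" using subring_0[OF FR] subring_1[OF FR] subring_0[OF LR] subring_1[OF
          LR]
            field_hom_0[OF FR F(5)] field_hom_1[OF F(5)] by (auto simp: W_def)
        show "u + v \<in> W" "u * v \<in> W" if "u \<in> W" "v \<in> W" for u v
          using that subring_add[OF FR] subring_add[OF LR] subring_mult[OF FR] subring_mult[OF LR]
            field_hom_add[OF F(5)] field_hom_mult[OF F(5)] by (auto simp: W_def)
        show "- u \<in> W" if "u \<in> W" for u
          using that subring_uminus[OF FR] subring_uminus[OF LR] field_hom_uminus[OF FR F(5)]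
          by (auto simp: W_def)
      qed
      moreover have "K \<subseteq> W" using F(2,6) L(2) by (auto simp: W_def)
      moreover have "set rs \<subseteq> W"
        using field_hom_root[OF FR F(5) F(6)[rule_format] PK(1) F(2)] roots F(4) L(3)
          by (auto simp: W_def)
      ultimately have "y \<in> W" using L(5) y by blast
      then show ?thesis using F(7) by (simp add: W_def)
    qed
  qed
  moreover have "separable_over K y" for y
    using closure by (auto simp: separable_closure_def separable_extension_def)
  ultimately have "finite_galois_extension K L"
    using L K by (auto simp: finite_galois_extension_def galois_extension_def
      separable_extension_def)
  moreover have "x \<in> L" using roots[of x] PK L(3) by auto
  ultimately show ?thesis using that by blast
qed

end

section \<open>The inertia field is unramified\<close>

text \<open>A function in this set is read in two ways: as the sum of the c_b db, and as the tensor
  given by the sum of the c_b \<otimes> b. Under the second reading \<open>lin_ext\<close> with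
  multiplication and \<sigma> is 1 \<otimes> \<sigma> followed by multiplication.\<close>

definition kaehler_carrier :: "'a::comm_ring_1 set \<Rightarrow> ('a \<Rightarrow>\<^sub>0 'a) set"
  where "kaehler_carrier B = {f. keys f \<subseteq> B \<and> (\<forall>b. lookup f b \<in> B)}"

lemma single_in_kaehler_carrier:
  "is_subring B \<Longrightarrow> b \<in> B \<Longrightarrow> c \<in> B \<Longrightarrow> single b c \<in> kaehler_carrier B"
  by (auto simp: kaehler_carrier_def lookup_single when_def subring_0 split: if_splits)

lemma is_submodule_kaehler_carrier:
  assumes B: "is_subring B"
  shows "is_submodule B (kaehler_carrier B)"
  unfolding is_submodule_def
proof (intro conjI ballI)
  show "0 \<in> kaehler_carrier B" by (simp add: kaehler_carrier_def subring_0[OF B])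
  show "f + g \<in> kaehler_carrier B" if "f \<in> kaehler_carrier B" "g \<in> kaehler_carrier B" for f g
    using that Poly_Mapping.keys_add[of f g]
      by (auto simp: kaehler_carrier_def lookup_add subring_add[OF B])
  show "pscale c f \<in> kaehler_carrier B" if "c \<in> B" "f \<in> kaehler_carrier B" for c f
  proof -
    have "keys (pscale c f) \<subseteq> keys f" by (auto simp: in_keys_iff)
    then show ?thesis using that by (auto simp: kaehler_carrier_def subring_mult[OF B])
  qed
qed

text \<open>The differential is \<open>A\<close>-linear modulo relations, so a linear dependence
  over \<open>A\<close> becomes a relation among differentials.\<close>

lemma d_linear_combination:
  assumes B: "is_subring B" and A: "is_subring A" "A \<subseteq> B" and "finite T" "T \<subseteq> B"
    "\<And>b. b \<in> T \<Longrightarrow> e b \<in> A"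
  shows "single (\<Sum>b\<in>T. e b * b) 1 - (\<Sum>b\<in>T. single b (e b)) \<in> kaehler_relations B A"
  using assms(4-6)
proof (induction T)
  case empty
  then show ?case using d_0[OF B] by simp
next
  case (insert b T)
  let ?N = "kaehler_relations B A" and ?s = "\<Sum>b\<in>T. e b * b"
  note N = is_submodule_kaehler[of B A]
  have mem: "e b \<in> B" "b \<in> B" "?s \<in> B"
    using insert A by (auto intro!: subring_sum[OF B] subring_mult[OF B])
  have "single (e b) b = pscale b (single (e b) 1)" by simp
  also have "\<dots> \<in> ?N" using insert mem by (intro submodule_pscale[OF N] kaehler_relations.const) auto
  finally have "(single (e b * b + ?s) 1 - single (e b * b) 1 - single ?s 1) +
      ((single (e b * b) 1 - single b (e b) - single (e b) b) +
      (single (e b) b + (single ?s 1 - (\<Sum>b\<in>T. single b (e b))))) \<in> ?N"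
    using insert mem
    by (intro submodule_add[OF N] kaehler_relations.sum kaehler_relations.leibniz subring_mult[OF
      B]) auto
  then show ?case using insert.hyps by (simp add: algebra_simps)
qed

locale valued_separable_closure = valuation_subring V + separable_closure_base K
  for V K :: "'a::field set"
begin

text \<open>Elements of \<open>V\<^sub>L \<otimes> V\<^sub>L\<close> are determined by their images under all \<open>1 \<otimes> \<sigma>\<close>: as in Artin's
  independence argument, a shortest relation has coefficients in \<open>K\<close>.\<close>

lemma galois_relation_elimination:
  assumes L: "finite_galois_extension K L" and T: "finite T" "T \<subseteq> L"
    and g: "\<And>b. g b \<in> L" "\<And>b. b \<notin> T \<Longrightarrow> g b = 0" "g b' \<noteq> 0"
      "\<And>\<sigma>. \<sigma> \<in> galois_group K L \<Longrightarrow> (\<Sum>b\<in>T. g b * \<sigma> b) = 0"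
  obtains h c where "\<forall>b. h b \<in> K" "c \<in> T" "h c \<noteq> 0" "(\<Sum>b\<in>T. h b * b) = 0"
    "\<forall>\<sigma>\<in>galois_group K L. (\<Sum>b\<in>T. h b * \<sigma> b) = 0"
proof -
  note Ls = finite_galois_extensionD[OF L]
  note LR = subfield_subring[OF Ls(1)]
  let ?G = "galois_group K L"
  define Q where "Q g \<longleftrightarrow> (\<forall>b. g b \<in> L) \<and> (\<forall>b. b \<notin> T \<longrightarrow> g b = 0) \<and> (\<exists>b. g b \<noteq> 0) \<and>
    (\<forall>\<sigma>\<in>?G. (\<Sum>b\<in>T. g b * \<sigma> b) = 0)" for g
  have "Q g" using g by (auto simp: Q_def)
  then obtain g where g: "Q g" and least: "\<And>h. Q h \<Longrightarrow> card {b. g b \<noteq> 0} \<le> card {b. h b \<noteq> 0}"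
    using ex_has_least_nat[of Q g "\<lambda>g. card {b. g b \<noteq> 0}"] by blast
  obtain c where c: "g c \<noteq> 0" using g by (auto simp: Q_def)
  have cT: "c \<in> T" using g c by (auto simp: Q_def)
  define h where "h b = g b / g c" for b
  have hL: "h b \<in> L" for b using g by (auto simp: h_def Q_def intro: subfield_divide[OF Ls(1)])
  have hc: "h c = 1" using c by (simp add: h_def)
  have hT: "h b = 0" if "b \<notin> T" for b using g that by (auto simp: h_def Q_def)
  have hrel: "(\<Sum>b\<in>T. h b * \<sigma> b) = 0" if "\<sigma> \<in> ?G" for \<sigma>
  proof -
    have "(\<Sum>b\<in>T. h b * \<sigma> b) = (\<Sum>b\<in>T. g b * \<sigma> b) / g c" by (simp add: h_def sum_divide_distrib)
    then show ?thesis using g that by (simp add: Q_def)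
  qed
  have fixed: "\<tau> (h b) = h b" if \<tau>: "\<tau> \<in> ?G" for \<tau> b
  proof (rule ccontr)
    assume ne: "\<tau> (h b) \<noteq> h b"
    have th: "field_hom L \<tau>" "bij_betw \<tau> L L" using \<tau> by (auto simp: galois_group_iff[OF LR])
    have \<tau>L: "\<tau> x \<in> L" if "x \<in> L" for x using that th(2) by (auto simp: bij_betw_def)
    \<comment> \<open>Applying \<tau> to the relation normalised by \<open>h c = 1\<close> and
      subtracting it kills the coefficient at \<open>c\<close>, so a nonzero difference contradicts
      minimality.\<close>
    define k where "k b = \<tau> (h b) - h b" for b
    have "(\<Sum>b\<in>T. k b * \<sigma> b) = 0" if \<sigma>: "\<sigma> \<in> ?G" for \<sigma>
    proof -
      obtain \<rho> where \<rho>: "\<rho> \<in> ?G" "\<forall>x\<in>L. \<tau> (\<rho> x) = \<sigma> x"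
        using galois_group_inverse_comp[OF Ls \<sigma> \<tau>] by blast
      have \<rho>L: "\<rho> x \<in> L" if "x \<in> L" for x
        using that \<rho>(1) by (auto simp: galois_group_iff[OF LR] bij_betw_def)
      have "0 = \<tau> (\<Sum>b\<in>T. h b * \<rho> b)" using hrel[OF \<rho>(1)] field_hom_0[OF LR th(1)] by simp
      also have "\<dots> = (\<Sum>b\<in>T. \<tau> (h b * \<rho> b))"
        using hL \<rho>L T(2) by (intro field_hom_sum[OF LR th(1)] subring_mult[OF LR]) auto
      also have "\<dots> = (\<Sum>b\<in>T. \<tau> (h b) * \<sigma> b)"
      proof (rule sum.cong[OF refl])
        fix b assume "b \<in> T"
        then have b: "b \<in> L" using T(2) by blast
        show "\<tau> (h b * \<rho> b) = \<tau> (h b) * \<sigma> b"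
          using field_hom_mult[OF th(1) hL \<rho>L[OF b]] \<rho>(2) b by simp
      qed
      finally show ?thesis using hrel[OF \<sigma>] by (simp add: k_def left_diff_distrib sum_subtractf)
    qed
    moreover have "k b \<in> L" for b using \<tau>L hL by (simp add: k_def subring_diff[OF LR])
    moreover have k0: "k b = 0" if "h b = 0" for b using that field_hom_0[OF LR th(1)]
      by (simp add: k_def)
    moreover have "k b \<noteq> 0" using ne by (simp add: k_def)
    ultimately have "Q k" using hT by (auto simp: Q_def)
    moreover have "card {b. k b \<noteq> 0} < card {b. g b \<noteq> 0}"
    proof (rule psubset_card_mono)
      show "finite {b. g b \<noteq> 0}" using g T(1) by (auto simp: Q_def intro: finite_subset[of _ T])
      have "k c = 0" using hc field_hom_1[OF th(1)] by (simp add: k_def)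
      moreover have "h b = 0" if "g b = 0" for b using that by (simp add: h_def)
      ultimately show "{b. k b \<noteq> 0} \<subset> {b. g b \<noteq> 0}" using k0 c by blast
    qed
    ultimately show False using least[of k] by simp
  qed
  have hK: "h b \<in> K" for b by (rule galois_fixed_field[OF L hL]) (rule fixed)
  have "(\<Sum>b\<in>T. h b * b) = (\<Sum>b\<in>T. h b * restrict (\<lambda>x. x) L b)" using T(2) by (intro sum.cong) auto
  also have "\<dots> = 0" by (rule hrel[OF identity_in_galois_group[OF Ls]])
  finally have "(\<Sum>b\<in>T. h b * b) = 0" .
  moreover have "h c \<noteq> 0" using hc by simp
  ultimately show ?thesis using that[of h c] hK cT hrel by blast
qed

text \<open>The elimination lemma supplies coefficients in \<open>K\<close>. Scaled so that all are
  integral and one of them, at \<open>m\<close>, is 1, they give a relation \<open>r\<close> among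
  differentials with zero evaluations; subtracting a multiple of \<open>r\<close> removes
  \<open>m\<close> from the support.\<close>

lemma galois_evaluations_faithful:
  assumes L: "finite_galois_extension K L"
    and f: "f \<in> kaehler_carrier (V \<inter> L)" "\<And>\<sigma>. \<sigma> \<in> galois_group K L \<Longrightarrow> lin_ext (*) \<sigma> f = 0"
  shows "f \<in> kaehler_relations (V \<inter> L) (V \<inter> K)"
  using f
proof (induction "card (keys f)" arbitrary: f rule: less_induct)
  case less
  note Ls = finite_galois_extensionD[OF L]
  note LR = subfield_subring[OF Ls(1)]
  note O = is_subring_Int[OF V_subring LR] and OK = is_subring_Int[OF V_subring KR]
  let ?N = "kaehler_relations (V \<inter> L) (V \<inter> K)" and ?T = "keys f"
  note N = is_submodule_kaehler[of "V \<inter> L" "V \<inter> K"]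
  have fO: "?T \<subseteq> V \<inter> L" "\<And>b. lookup f b \<in> V \<inter> L"
    using less.prems by (auto simp: kaehler_carrier_def)
  show ?case
  proof (cases "f = 0")
    case True
    then show ?thesis by (simp add: kaehler_relations.zero)
  next
    case False
    then obtain b' where b': "lookup f b' \<noteq> 0" by (metis lookup_zero poly_mapping_eqI)
    have TL: "?T \<subseteq> L" using fO by auto
    have rel: "(\<Sum>b\<in>?T. lookup f b * \<sigma> b) = 0" if "\<sigma> \<in> galois_group K L" for \<sigma>
      using less.prems(2)[OF that] by (simp add: lin_ext_def)
    have fL: "lookup f b \<in> L" for b using fO by auto
    have f0: "lookup f b = 0" if "b \<notin> ?T" for b using that by (simp add: in_keys_iff)
    obtain h c where h: "\<forall>b. h b \<in> K" "c \<in> ?T" "h c \<noteq> 0" "(\<Sum>b\<in>?T. h b * b) = 0"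
      "\<forall>\<sigma>\<in>galois_group K L. (\<Sum>b\<in>?T. h b * \<sigma> b) = 0"
      by (rule galois_relation_elimination[where g = "lookup f", OF L finite_keys TL fL f0 b' rel])
    obtain m where m: "m \<in> ?T" "\<And>b. b \<in> ?T \<Longrightarrow> vle (h m) (h b)"
      using vle_min[of ?T h] h(2) by (metis finite_keys empty_iff)
    have hm: "h m \<noteq> 0" using m(2)[OF h(2)] h(3) by auto
    define e where "e b = h b / h m" for b
    have e: "e b \<in> V \<inter> K" if "b \<in> ?T" for b
      using m(2)[OF that] hm h(1) by (simp add: e_def vle_iff_divide subfield_divide[OF K])
    have em: "e m = 1" using hm by (simp add: e_def)
    have esum: "(\<Sum>b\<in>?T. e b * \<sigma> b) = 0" if "(\<Sum>b\<in>?T. h b * \<sigma> b) = 0" for \<sigma>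
      using that by (simp add: e_def sum_divide_distrib[symmetric])
    define r where "r = (\<Sum>b\<in>?T. single b (e b))"
    have "single (\<Sum>b\<in>?T. e b * b) 1 - r \<in> ?N"
      unfolding r_def using fO(1) Ls(2) e
      by (intro d_linear_combination[OF O OK]) auto
    moreover have "(\<Sum>b\<in>?T. e b * b) = 0" using esum[OF h(4)] .
    ultimately have "single 0 1 - r \<in> ?N" by (simp del: single_one)
    from submodule_diff[OF N O d_0[OF O] this] have rN: "r \<in> ?N" by simp
    have rc: "r \<in> kaehler_carrier (V \<inter> L)"
      unfolding r_def using fO(1) e Ls(2)
      by (intro submodule_sum[OF is_submodule_kaehler_carrier[OF O]] single_in_kaehler_carrier[OF
        O]) auto
    have lr: "lookup r b = (if b \<in> ?T then e b else 0)" for b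
      by (simp add: r_def lookup_sum lookup_single when_def)
    define f' where "f' = f - pscale (lookup f m) r"
    have "f' \<in> ?N"
    proof (rule less.hyps)
      have "keys f' \<subseteq> ?T - {m}"
        using m(1) em by (auto simp: in_keys_iff f'_def lookup_minus lr split: if_splits)
      then have "card (keys f') \<le> card (?T - {m})" by (intro card_mono) auto
      also have "\<dots> < card ?T" using m(1) by (intro card_Diff1_less) auto
      finally show "card (keys f') < card ?T" .
      show "f' \<in> kaehler_carrier (V \<inter> L)" unfolding f'_def
        using less.prems(1) rc fO(2)
        by (intro submodule_diff[OF is_submodule_kaehler_carrier[OF O] O]
            submodule_pscale[OF is_submodule_kaehler_carrier[OF O]]) auto
      show "lin_ext (*) \<sigma> f' = 0" if \<sigma>: "\<sigma> \<in> galois_group K L" for \<sigma>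
        using less.prems(2)[OF \<sigma>] esum[OF h(5)[rule_format, OF \<sigma>]]
        by (simp add: f'_def r_def mult_action.lin_ext_diff mult_action.lin_ext_pscale
          mult_action.lin_ext_sum)
    qed
    moreover have "pscale (lookup f m) r \<in> ?N" using rN fO(2) by (intro submodule_pscale[OF N])
    ultimately have "f' + pscale (lookup f m) r \<in> ?N" by (rule submodule_add[OF N])
    then show ?thesis by (simp add: f'_def)
  qed
qed

text \<open>In \<open>V\<^sub>L \<otimes> V\<^sub>L\<close> the element \<open>x \<otimes> 1 - 1 \<otimes> x\<close> vanishes at the inertia group \<open>T\<close>.  For every other
  \<open>\<sigma>\<close> there is a factor \<open>c \<otimes> y - e \<otimes> 1\<close> that vanishes at \<open>\<sigma>\<close> and is a unit at the identity; the
  product of all of them is zero.\<close>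

lemma d_inertia_field:
  assumes L: "finite_galois_extension K L" and T: "T \<subseteq> galois_group K L" "restrict (\<lambda>x. x) L \<in> T"
    "\<And>\<sigma>. \<sigma> \<in> galois_group K L - T \<Longrightarrow> \<exists>y\<in>V \<inter> L. \<sigma> y - y \<notin> maximal_ideal"
    and x: "x \<in> V \<inter> L" "\<And>\<sigma>. \<sigma> \<in> T \<Longrightarrow> \<sigma> x = x"
  shows "single x 1 \<in> kaehler_relations (V \<inter> L) (V \<inter> K)"
proof -
  note Ls = finite_galois_extensionD[OF L]
  note LR = subfield_subring[OF Ls(1)]
  note O = is_subring_Int[OF V_subring LR]
  let ?G = "galois_group K L" and ?N = "kaehler_relations (V \<inter> L) (V \<inter> K)" and ?F =
    "kaehler_carrier (V \<inter> L)"
  note N = is_submodule_kaehler[of "V \<inter> L" "V \<inter> K"] and F = is_submodule_kaehler_carrier[OF O]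
  have hom: "field_hom L \<sigma>" if "\<sigma> \<in> ?G" for \<sigma> using that by (simp add: galois_group_iff[OF LR])
  have into: "\<sigma> y \<in> L" if "\<sigma> \<in> ?G" "y \<in> L" for \<sigma> y
    using that by (auto simp: galois_group_iff[OF LR] bij_betw_def)
  \<comment> \<open>Automorphisms need not preserve \<open>V\<close>. If \<sigma> y is not integral,
    its inverse \<open>c\<close> lies in the maximal ideal, so that c \<sigma> y = 1 while c y - 1
    is a unit.\<close>
  have factor: "\<exists>c\<in>V\<inter>L. \<exists>y\<in>V\<inter>L. \<exists>e\<in>V\<inter>L. c * \<sigma> y = e \<and> c * y - e \<notin> maximal_ideal"
    if \<sigma>: "\<sigma> \<in> ?G - T" for \<sigma>
  proof -
    obtain y where y: "y \<in> V \<inter> L" "\<sigma> y - y \<notin> maximal_ideal" using T(3)[OF \<sigma>] by blast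
    have \<sigma>yL: "\<sigma> y \<in> L" using into \<sigma> y by auto
    show ?thesis
    proof (cases "\<sigma> y \<in> V")
      case True
      have "y - \<sigma> y = (- 1) * (\<sigma> y - y)" by simp
      then have "y - \<sigma> y \<notin> maximal_ideal"
        using y(2) maximal_ideal_mult[of "- 1" "y - \<sigma> y"] V_1 V_uminus by auto
      then show ?thesis using True y \<sigma>yL subring_1[OF O]
        by (intro bexI[of _ 1] bexI[of _ y] bexI[of _ "\<sigma> y"]) auto
    next
      case False
      have m: "inverse (\<sigma> y) \<in> maximal_ideal" using inverse_in_maximal_ideal[OF False] .
      have "1 + (- y) * inverse (\<sigma> y) \<notin> maximal_ideal"
        using one_plus_maximal_ideal[OF maximal_ideal_mult[OF _ m, of "- y"]] y V_uminus by blast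
      then have "inverse (\<sigma> y) * y - 1 \<notin> maximal_ideal"
        using maximal_ideal_mult[of "- 1" "inverse (\<sigma> y) * y - 1"] V_1 V_uminus
        by (auto simp: algebra_simps)
      moreover have "inverse (\<sigma> y) \<in> V \<inter> L"
        using m \<sigma>yL subfield_inverse[OF Ls(1)] by (auto simp: maximal_ideal_def)
      moreover have "\<sigma> y \<noteq> 0" using False V_0 by auto
      ultimately show ?thesis using y subring_1[OF O]
        by (intro bexI[of _ "inverse (\<sigma> y)"] bexI[of _ y] bexI[of _ 1]) auto
    qed
  qed
  \<comment> \<open>Invariant: as a differential \<open>f\<close> is a unit multiple of dx, and as a
    tensor it vanishes at \<open>T\<close> and at the automorphisms treated so far.\<close>
  have product: "\<exists>f\<in>?F. \<exists>u\<in>V\<inter>L. u \<notin> maximal_ideal \<and> f - pscale u (single x 1) \<in> ?N \<and>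
      (\<forall>\<sigma>\<in>T \<union> Z. lin_ext (*) \<sigma> f = 0)" if "finite Z" "Z \<subseteq> ?G - T" for Z
    using that
  proof (induction Z)
    case empty
    \<comment> \<open>The tensor 1 \<otimes> x - x \<otimes> 1, congruent to dx because d1 =
      0.\<close>
    let ?f = "single x 1 - single 1 x :: 'a \<Rightarrow>\<^sub>0 'a"
    have "?f \<in> ?F"
      using x subring_1[OF O] by (intro submodule_diff[OF F O] single_in_kaehler_carrier[OF O]) auto
    moreover have "?f - pscale 1 (single x 1) = - pscale x (single 1 1)" by simp
    then have "?f - pscale 1 (single x 1) \<in> ?N"
      using x submodule_uminus[OF N O submodule_pscale[OF N _ d_1[OF O]]] by metis
    moreover have "lin_ext (*) \<sigma> ?f = 0" if "\<sigma> \<in> T" for \<sigma>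
      using x(2)[OF that] hom[of \<sigma>] T(1) that by (auto simp: mult_action.lin_ext_diff field_hom_1)
    ultimately show ?case using subring_1[OF O] one_notin_maximal_ideal
      by (intro bexI[of _ ?f] bexI[of _ 1]) auto
  next
    case (insert \<sigma> Z)
    then obtain f u where f: "f \<in> ?F" "u \<in> V \<inter> L" "u \<notin> maximal_ideal"
      "f - pscale u (single x 1) \<in> ?N" "\<forall>\<tau>\<in>T \<union> Z. lin_ext (*) \<tau> f = 0" by auto
    obtain c y e where cye: "c \<in> V \<inter> L" "y \<in> V \<inter> L" "e \<in> V \<inter> L" "c * \<sigma> y = e"
      "c * y - e \<notin> maximal_ideal"
      using factor[of \<sigma>] insert by blast
    have fk: "keys f \<subseteq> V \<inter> L" "\<And>b. lookup f b \<in> V \<inter> L"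
      using f(1) by (auto simp: kaehler_carrier_def)
    \<comment> \<open>The product of the tensor \<open>f\<close> with 1 \<otimes> y.\<close>
    define fy where "fy = lin_ext pscale (\<lambda>b. single (b * y) 1) f"
    have fyF: "fy \<in> ?F" unfolding fy_def lin_ext_def
      using fk cye(2) subring_1[OF O]
      by (intro submodule_sum[OF F] submodule_pscale[OF F] single_in_kaehler_carrier[OF O]
        subring_mult[OF O]) auto
    have ev_fy: "lin_ext (*) \<tau> fy = \<tau> y * lin_ext (*) \<tau> f" if \<tau>: "\<tau> \<in> ?G" for \<tau>
    proof -
      have "lin_ext (*) \<tau> fy = (\<Sum>b\<in>keys f. lookup f b * \<tau> (b * y))"
        unfolding fy_def lin_ext_def[of pscale] by (simp add: mult_action.lin_ext_sum)
      also have "\<dots> = (\<Sum>b\<in>keys f. \<tau> y * (lookup f b * \<tau> b))"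
        using fk(1) cye(2) by (intro sum.cong refl)
          (auto simp: field_hom_mult[OF hom[OF \<tau>]] subset_iff)
      finally show ?thesis by (simp add: lin_ext_def sum_distrib_left)
    qed
    have ev_id: "(\<Sum>b\<in>keys f. lookup f b * b) = 0"
    proof -
      have "lin_ext (*) (restrict (\<lambda>x. x) L) f = 0" using f(5) T(2) by blast
      moreover have "lin_ext (*) (restrict (\<lambda>x. x) L) f = (\<Sum>b\<in>keys f. lookup f b * b)"
        unfolding lin_ext_def using fk(1) by (intro sum.cong refl) (auto simp: subset_iff)
      ultimately show ?thesis by simp
    qed
    \<comment> \<open>On the class of a tensor in the kernel of multiplication, which
      \<open>ev_id\<close> guarantees, 1 \<otimes> y acts as the scalar \<open>y\<close>: in d(by) =
      y db + b dy the terms b dy add up to zero.\<close>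
    have fyN: "fy - pscale y f \<in> ?N"
    proof -
      have "(\<Sum>b\<in>keys f. pscale (lookup f b)
          (single (b * y) 1 - single y b - single b y)) \<in> ?N"
        using fk cye(2) by (intro submodule_sum[OF N] submodule_pscale[OF N]
          kaehler_relations.leibniz) auto
      moreover have "pscale y f = (\<Sum>b\<in>keys f. pscale (lookup f b) (single b y))"
      proof -
        have "pscale y f = pscale y (lin_ext pscale (\<lambda>b. single b 1) f)" by (simp add: lin_ext_id)
        then show ?thesis by (simp add: lin_ext_def pscale_sum mult.commute)
      qed
      moreover have "(\<Sum>b\<in>keys f. pscale (lookup f b) (single y b)) =
          pscale (\<Sum>b\<in>keys f. lookup f b * b) (single y 1)"
        unfolding pscale_action.act_sum_left by simp
      ultimately show ?thesis
        by (simp only: fy_def lin_ext_def pscale_distribs sum_subtractf ev_id pscale_simps) simp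
    qed
    \<comment> \<open>The factor c \<otimes> y - e \<otimes> 1 acts on the class as the unit c y - e
      and vanishes at \<sigma>.\<close>
    define f' where "f' = pscale c fy - pscale e f"
    have "f' \<in> ?F" unfolding f'_def
      using cye f(1) fyF by (intro submodule_diff[OF F O] submodule_pscale[OF F]) auto
    moreover have "(c * y - e) * u \<in> V \<inter> L"
      using cye f(2) by (intro subring_mult[OF O] subring_diff[OF O]) auto
    moreover have "(c * y - e) * u \<notin> maximal_ideal"
      using unit_mult[of "c * y - e" u] cye f(2,3) V_diff V_mult by auto
    moreover have "f' - pscale ((c * y - e) * u) (single x 1) \<in> ?N"
    proof -
      have "pscale c (fy - pscale y f) + pscale (c * y - e) (f - pscale u (single x 1)) \<in> ?N"
        using cye fyN f(4)
        by (intro submodule_add[OF N] submodule_pscale[OF N] subring_diff[OF O] subring_mult[OF O])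
          auto
      also have "pscale c (fy - pscale y f) + pscale (c * y - e) (f - pscale u (single x 1)) =
          f' - pscale ((c * y - e) * u) (single x 1)"
        by (simp only: f'_def pscale_distribs pscale_simps) (simp add: algebra_simps)
      finally show ?thesis .
    qed
    moreover have "lin_ext (*) \<tau> f' = 0" if \<tau>: "\<tau> \<in> T \<union> insert \<sigma> Z" for \<tau>
    proof -
      have G: "\<tau> \<in> ?G" using \<tau> T(1) insert.prems by auto
      have "lin_ext (*) \<tau> f' = (c * \<tau> y - e) * lin_ext (*) \<tau> f"
        by (simp add: f'_def mult_action.lin_ext_diff mult_action.lin_ext_pscale ev_fy[OF G]
          algebra_simps)
      then show ?thesis using \<tau> f(5) cye(4) by auto
    qed
    ultimately show ?case by blast
  qed
  have "finite (?G - T)" using finite_galois_group[OF L] by simp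
  from product[OF this subset_refl] obtain f u where f: "f \<in> ?F" "u \<in> V \<inter> L" "u \<notin> maximal_ideal"
    "f - pscale u (single x 1) \<in> ?N" "\<forall>\<sigma>\<in>T \<union> (?G - T). lin_ext (*) \<sigma> f = 0" by blast
  have "f \<in> ?N" using f(1,5) by (intro galois_evaluations_faithful[OF L]) auto
  from submodule_diff[OF N O this f(4)] have "pscale u (single x 1) \<in> ?N" by simp
  moreover have "u \<noteq> 0" "inverse u \<in> V \<inter> L"
    using f(2,3) subfield_inverse[OF Ls(1)] by (auto simp: maximal_ideal_def)
  ultimately show ?thesis using submodule_pscale[OF N, of "inverse u" "pscale u (single x 1)"]
    by simp
qed

text \<open>A separable minimal polynomial over \<open>K\<close> also has coefficients in
  \<open>E\<close>, so \<open>separable_closure_injective\<close> applies to every field above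
  \<open>K\<close>.\<close>

lemma d_descends_from_closure:
  assumes E: "is_subfield E" "K \<subseteq> E" and A: "A \<subseteq> V \<inter> E" and x: "x \<in> V \<inter> E"
    and d: "single x 1 \<in> kaehler_relations V A"
  shows "single x 1 \<in> kaehler_relations (V \<inter> E) A"
proof (rule separable_closure_injective[OF sep_closed _ E(1) A x d])
  fix z
  obtain p where "minpoly K z p" "separable_poly p" using separable_minpoly by metis
  then show "\<exists>p\<in>polys E. p \<noteq> 0 \<and> separable_poly p \<and> poly p z = 0"
    using polys_mono[OF E(2)] by (auto simp: minpoly_def)
qed

end

text \<open>Connects additive valuations with the ring-theoretic development; the second part turns
  the condition defining the inertia group into membership in the maximal ideal.\<close>

lemma valuation_subring_of_valuation:
  fixes w :: "'a::field \<Rightarrow> 'g::linordered_ab_group_add extended"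
  assumes w: "valuation_on UNIV w"
  shows "valuation_subring {x. 0 \<le> w x}"
    and "0 < w y \<longleftrightarrow> y \<in> valuation_subring.maximal_ideal {x. 0 \<le> w x}"
proof -
  have fin: "\<exists>g. w x = Fin g" if "x \<noteq> 0" for x
    using w that by (cases "w x") (auto simp: valuation_on_def)
  have w0: "w 0 = Pinf" and mult: "w (x * y) = w x + w y" and add: "min (w x) (w y) \<le> w (x + y)"
    for x y
    using w by (auto simp: valuation_on_def)
  have zero: "(0 :: 'g extended) = Fin 0" by (simp add: zero_extended_def)
  have w1: "w 1 = 0"
  proof -
    obtain g where g: "w 1 = Fin g" using fin[of 1] by auto
    then show ?thesis using mult[of 1 1] by (simp add: zero)
  qed
  have wm1: "w (- 1) = 0"
  proof -
    obtain g where g: "w (- 1) = Fin g" using fin[of "- 1"] by auto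
    then show ?thesis using mult[of "- 1" "- 1"] w1 by (simp add: zero double_zero_sym)
  qed
  have inv: "\<exists>g. w x = Fin g \<and> w (inverse x) = Fin (- g)" if x: "x \<noteq> 0" for x
  proof -
    obtain g h where gh: "w x = Fin g" "w (inverse x) = Fin h" using fin[OF x] fin[of "inverse x"] x
      by auto
    then have "g + h = 0" using mult[of x "inverse x"] w1 x by (simp add: zero)
    then show ?thesis using gh by (simp add: eq_neg_iff_add_eq_0 add.commute)
  qed
  have pos: "0 \<le> a + b" if "0 \<le> a" "0 \<le> b" for a b :: "'g extended"
    using that by (cases a; cases b) (auto simp: zero)
  let ?V = "{x. 0 \<le> w x}"
  show V: "valuation_subring ?V"
  proof
    show "is_subring ?V"
    proof (rule is_subringI)
      show "- x \<in> ?V" if "x \<in> ?V" for x using mult[of "- 1" x] that wm1 pos by simp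
      show "x + y \<in> ?V" if "x \<in> ?V" "y \<in> ?V" for x y
        using add[of x y] that by (auto simp: min_def split: if_splits)
    qed (use w0 w1 mult pos in \<open>auto simp: zero\<close>)
    show "x \<in> ?V \<or> inverse x \<in> ?V" for x
    proof (cases "x = 0")
      case False then show ?thesis using inv[of x] by (auto simp: zero)
    qed (simp add: w0 zero)
  qed
  show "0 < w y \<longleftrightarrow> y \<in> valuation_subring.maximal_ideal ?V"
  proof (cases "y = 0")
    case False
    then show ?thesis using inv[of y]
      unfolding valuation_subring.maximal_ideal_def[OF V] by (auto simp: zero)
  next
    case True
    then show ?thesis unfolding valuation_subring.maximal_ideal_def[OF V] by (simp add: w0 zero)
  qed
qed

theorem theorem5p3:
  fixes K :: "'a::field set"
    and v w :: "'a \<Rightarrow> 'g::linordered_ab_group_add extended"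
  assumes "subfield K ring_of_type_algebra"
    and "valuation_on K v"
    and "separable_closure K (UNIV :: 'a set)"
    and "valuation_on (UNIV :: 'a set) w"
    and "\<forall>x\<in>K. w x = v x"
  shows
    "(zero_module (kaehler (valuation_ring w (UNIV :: 'a set)) (valuation_ring w K)) \<longleftrightarrow>
       (\<forall>L. finite_galois_extension K L \<longrightarrow>
          zero_module (kaehler (valuation_ring w L) (valuation_ring w K)))) \<and>
     (\<forall>(L :: 'a set) (l :: nat) (F :: nat \<Rightarrow> 'a set).
        finite_galois_extension K L \<and>
        K \<subseteq> F 0 \<and> F 0 = inertia_field w K L \<and> F l = L \<and>
        (\<forall>i<l. F i \<subseteq> F (Suc i) \<and> finite_galois_extension (F i) (F (Suc i)) \<and>
               prime (ring.dim ring_of_type_algebra (F i) (F (Suc i)))) \<longrightarrow>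
        (zero_module (kaehler (valuation_ring w L) (valuation_ring w K)) \<longleftrightarrow>
          (\<forall>i<l. zero_module
             (kaehler (valuation_ring w (F (Suc i))) (valuation_ring w (F i))))))"
proof -
  define V where "V = {x. 0 \<le> w x}"
  interpret valuation_subring V
    unfolding V_def by (rule valuation_subring_of_valuation(1)[OF assms(4)])
  interpret valued_separable_closure V K
    by (intro valued_separable_closure.intro separable_closure_base.intro valuation_subring_axioms
      assms(1,3))
  have ring: "valuation_ring w L = V \<inter> L" for L by (auto simp: valuation_ring_def V_def)
  have pos: "0 < w y \<longleftrightarrow> y \<in> maximal_ideal" for y
    using valuation_subring_of_valuation(2)[OF assms(4)] unfolding V_def .
  note sub = finite_galois_extensionD
  have zero_iff: "zero_module (kaehler (valuation_ring w L) (valuation_ring w E)) \<longleftrightarrow>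
      (\<forall>x\<in>V \<inter> L. single x 1 \<in> kaehler_relations (V \<inter> L) (V \<inter> E))"
    if "is_subfield L" "E \<subseteq> L" for L E
    unfolding ring using that is_subring_Int[OF V_subring subfield_subring]
    by (intro zero_module_kaehler_iff) auto
  have part1: "zero_module (kaehler (valuation_ring w UNIV) (valuation_ring w K)) \<longleftrightarrow>
      (\<forall>L. finite_galois_extension K L \<longrightarrow> zero_module (kaehler (valuation_ring w L) (valuation_ring w K)))"
    (is "?U \<longleftrightarrow> (\<forall>L. _ \<longrightarrow> ?Z L)")
  proof (intro iffI allI impI)
    fix L assume ?U and L: "finite_galois_extension K L"
    then have "\<forall>x\<in>V. single x 1 \<in> kaehler_relations V (V \<inter> K)"
      using zero_iff[OF is_subfield_UNIV, of K] by simp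
    then show "?Z L" unfolding zero_iff[OF sub[OF L]]
      using sub[OF L] by (intro ballI d_descends_from_closure) auto
  next
    assume *: "\<forall>L. finite_galois_extension K L \<longrightarrow> ?Z L"
    have "single x 1 \<in> kaehler_relations V (V \<inter> K)" if "x \<in> V" for x
    proof -
      obtain L where L: "finite_galois_extension K L" "x \<in> L"
        by (rule finite_galois_extension_containing)
      then have "single x 1 \<in> kaehler_relations (V \<inter> L) (V \<inter> K)"
        using * zero_iff[OF sub[OF L(1)]] that by auto
      then show ?thesis
        by (rule kaehler_relations_mono[rotated 2]) (auto intro: kaehler_relations.const)
    qed
    then show ?U using zero_iff[OF is_subfield_UNIV, of K] by simp
  qed
  have part2: "zero_module (kaehler (valuation_ring w L) (valuation_ring w K)) \<longleftrightarrow>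
      (\<forall>i<l. zero_module (kaehler (valuation_ring w (F (Suc i))) (valuation_ring w (F i))))"
    if L: "finite_galois_extension K L" and F: "K \<subseteq> F 0" "F 0 = inertia_field w K L" "F l = L"
      "\<And>i. i < l \<Longrightarrow> F i \<subseteq> F (Suc i)" "\<And>i. i < l \<Longrightarrow> finite_galois_extension (F i) (F (Suc i))"
    for L F and l :: nat
  proof -
    have Fsub: "is_subfield (F (Suc i))" if "i < l" for i
      by (rule finite_galois_extensionD[OF F(5)[OF that]])
    have mono: "F i \<subseteq> F j" if "i \<le> j" "j \<le> l" for i j
      using that by (induction j rule: dec_induct) (use F(4) in \<open>auto simp: subset_iff\<close>)
    have FL: "F i \<subseteq> L" if "i \<le> l" for i using mono[OF that] F(3) by simp
    have KF: "K \<subseteq> F i" if "i \<le> l" for i using mono[of 0 i] that F(1) by auto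
    show ?thesis
    proof (intro iffI allI impI)
      fix i assume P: "zero_module (kaehler (valuation_ring w L) (valuation_ring w K))" and i:
        "i < l"
      show "zero_module (kaehler (valuation_ring w (F (Suc i))) (valuation_ring w (F i)))"
        unfolding zero_iff[OF Fsub[OF i] F(4)[OF i]]
      proof (intro ballI d_descends_from_closure[OF Fsub[OF i]])
        fix x assume x: "x \<in> V \<inter> F (Suc i)"
        then have "x \<in> V \<inter> L" using FL[of "Suc i"] i by auto
        then have "single x 1 \<in> kaehler_relations (V \<inter> L) (V \<inter> K)"
          using P zero_iff[OF sub[OF L]] by blast
        \<comment> \<open>Enlarging the ring to \<open>V\<close> and the constants to those of
          \<open>F i\<close> keeps dx a relation; from there it descends to
          \<open>F (Suc i)\<close>.\<close>
        then show "single x 1 \<in> kaehler_relations V (V \<inter> F i)"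
          using KF[of i] i by (elim kaehler_relations_mono[rotated 2])
            (auto intro!: kaehler_relations.const)
      qed (use KF[of "Suc i"] F(4)[OF i] i in auto)
    next
      assume P: "\<forall>i<l. zero_module (kaehler (valuation_ring w (F (Suc i))) (valuation_ring w (F
        i)))"
      \<comment> \<open>Going up the tower, \<Omega> remains that of \<open>L\<close> over
        \<open>K\<close>; only the range of \<open>x\<close> grows, starting from the inertia
        field.\<close>
      have "\<forall>x\<in>V \<inter> F j. single x 1 \<in> kaehler_relations (V \<inter> L) (V \<inter> K)" if "j \<le> l" for j
        using that
      proof (induction j)
        case 0
        show ?case
        proof
          fix x assume x: "x \<in> V \<inter> F 0"
          have id: "restrict (\<lambda>x. x) L \<in> inertia_group w K L"
            using identity_in_galois_group[OF sub[OF L]]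
            by (auto simp: inertia_group_def ring pos maximal_ideal_0)
          show "single x 1 \<in> kaehler_relations (V \<inter> L) (V \<inter> K)"
            by (rule d_inertia_field[OF L _ id])
              (use x F(2) in \<open>auto simp: inertia_group_def inertia_field_def ring pos\<close>)
        qed
      next
        case (Suc j)
        then have j: "j < l" and IH: "\<forall>x\<in>V \<inter> F j. single x 1 \<in> kaehler_relations (V \<inter> L) (V \<inter> K)"
          by auto
        show ?case
        proof
          fix x assume "x \<in> V \<inter> F (Suc j)"
          then have "single x 1 \<in> kaehler_relations (V \<inter> F (Suc j)) (V \<inter> F j)"
            using P zero_iff[OF Fsub[OF j] F(4)[OF j]] j by blast
          \<comment> \<open>Relations of the step map to relations for \<open>L\<close> over
            \<open>K\<close>, because the differentials of its constants, taken from
            \<open>F j\<close>, vanish by induction.\<close>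
          then show "single x 1 \<in> kaehler_relations (V \<inter> L) (V \<inter> K)"
            using FL[of "Suc j"] j IH by (elim kaehler_relations_mono[rotated 2]) auto
        qed
      qed
      from this[of l] show "zero_module (kaehler (valuation_ring w L) (valuation_ring w K))"
        unfolding zero_iff[OF sub[OF L]] using F(3) by simp
    qed
  qed
  show ?thesis
    by (intro conjI part1 allI impI part2) auto
qed

end
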